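(* Let $c>0$ and $\Delta=(0,c]$. Let $\mu$ be an $s$-self-decomposable infinitely divisible distribution on $\mathbb R$ with Lévy measure $\nu$, and let $\nu_{(1)}(dx)=\mathbf 1_{(1,\infty)}(x)\,\nu(dx)/\nu((1,\infty))$. Then the following are equivalent: (i) $\mu\in\mathcal S_\Delta\cap\mathcal D_\Delta$; (ii) $\nu_{(1)}\in\mathcal S_\Delta$; (iii) $\nu_{(1)}\in\mathcal L_\Delta$ and $\mu(x+\Delta)\sim\nu(x+\Delta)$.
   Context: An infinitely divisible distribution $\mu$ on $\mathbb R$ has characteristic function $\widehat\mu(z)=\exp\{\int_{-\infty}^\infty(e^{izy}-1-izy\mathbf 1_{\{|y|\le1\}})\nu(dy)+iaz-\frac12b^2z^2\}$ with $a\in\mathbb R$, $b\ge0$ and Lévy measure $\nu$ satisfying $\nu(\{0\})=0$, $\int(1\wedge x^2)\nu(dx)<\infty$. It is $s$-self-decomposable (Jurek class) if $\nu(dx)=g(x)dx$ with a Lévy density $g$ that is non-increasing on $(0,\infty)$ and non-decreasing on $(-\infty,0)$. An assertion that $\nu_{(1)}$ belongs to a class includes $\nu((1,\infty))>0$, so that $\nu_{(1)}$ is defined. For $\Delta=(0,c]$ and a measure $F$, $F(x+\Delta):=F((x,x+c])$. $F^{*n}$ is the $n$-fold convolution. $\alpha(x)\sim\beta(x)$ means $\alpha(x)/\beta(x)\to1$ as $x\to\infty$. A non-negative measurable function $\alpha$ belongs to $\mathcal L$ if there is $x_0>0$ with $\alpha(x)>0$ for $x\ge x_0$ and, for every fixed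 $y>0$, $\alpha(x+y)\sim\alpha(x)$. A distribution $F$ is in $\mathcal L_\Delta$ if the function $x\mapsto F(x+\Delta)$ is in $\mathcal L$. $F\in\mathcal S_\Delta$ if $F\in\mathcal L_\Delta$ and $F^{*2}(x+\Delta)\sim 2F(x+\Delta)$. A function $\alpha:\mathbb R\to\mathbb R_+$ is almost decreasing if there exist $x_0>0$ and $K>0$ such that $\alpha(x+y)\le K\alpha(x)$ for all $x>x_0$, $y>0$. $F\in\mathcal D_\Delta$ if $x\mapsto F(x+\Delta)$ is almost decreasing. *)

theory Defs
  imports "HOL-Probability.Probability" "HOL-Library.Landau_Symbols"
begin

unbundle asymp_equiv_syntax

primrec conv_power :: "real measure \<Rightarrow> nat \<Rightarrow> real measure" where
  "conv_power F 0 = return borel 0"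
| "conv_power F (Suc n) = (F \<star> conv_power F n)"

definition infinitely_divisible :: "real measure \<Rightarrow> bool" where
  "infinitely_divisible \<mu> \<longleftrightarrow> real_distribution \<mu> \<and>
     (\<forall>n\<ge>1. \<exists>\<rho>. real_distribution \<rho> \<and> conv_power \<rho> n = \<mu>)"

definition levy_measure :: "real measure \<Rightarrow> bool" where
  "levy_measure \<nu> \<longleftrightarrow> sets \<nu> = sets borel \<and> emeasure \<nu> {0} = 0 \<and>
     (\<integral>\<^sup>+x. ennreal (min 1 (x\<^sup>2)) \<partial>\<nu>) < \<infinity>"

text \<open>The exponent of the Levy-Khintchine formula; for a Levy measure \<open>\<nu>\<close> the integrand is
  Bochner integrable.\<close>

definition levy_exponent :: "real \<Rightarrow> real \<Rightarrow> real measure \<Rightarrow> real \<Rightarrow> complex" where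
  "levy_exponent a b \<nu> z =
     (CLINT y|\<nu>. iexp (z * y) - 1 - \<i> * complex_of_real (z * y * indicator {y. \<bar>y\<bar> \<le> 1} y))
       + \<i> * complex_of_real (a * z) - complex_of_real (b\<^sup>2 * z\<^sup>2 / 2)"

definition levy_khintchine :: "real measure \<Rightarrow> real \<Rightarrow> real \<Rightarrow> real measure \<Rightarrow> bool" where
  "levy_khintchine \<mu> a b \<nu> \<longleftrightarrow> b \<ge> 0 \<and> levy_measure \<nu> \<and>
     (\<forall>z. char \<mu> z = exp (levy_exponent a b \<nu> z))"

text \<open>\<open>s_self_decomposable \<mu> a b \<nu>\<close>: the distribution \<open>\<mu>\<close> is infinitely divisible with
  Levy-Khintchine data \<open>a\<close>, \<open>b\<close>, \<open>\<nu>\<close> and is s-self-decomposable (Jurek class).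
  The value \<open>g 0\<close> is irrelevant.\<close>

definition s_self_decomposable ::
    "real measure \<Rightarrow> real \<Rightarrow> real \<Rightarrow> real measure \<Rightarrow> bool" where
  "s_self_decomposable \<mu> a b \<nu> \<longleftrightarrow>
     infinitely_divisible \<mu> \<and> levy_khintchine \<mu> a b \<nu> \<and>
     (\<exists>g::real \<Rightarrow> real. g \<in> borel_measurable borel \<and> (\<forall>x. 0 \<le> g x) \<and>
        \<nu> = density lborel (\<lambda>x. ennreal (g x)) \<and>
        antimono_on {0<..} g \<and> mono_on {..<0} g)"

text \<open>The normalised restriction of \<open>\<nu>\<close> to \<open>(1,\<infinity>)\<close>; it is the null measure
  if \<open>\<nu>\<close> does not charge that interval.\<close>

abbreviation normalized_tail :: "real measure \<Rightarrow> real measure" where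
  "normalized_tail \<nu> \<equiv> uniform_measure \<nu> {1<..}"

text \<open>\<open>F(x + \<Delta>)\<close> for \<open>\<Delta> = (0,c]\<close>. For a Levy measure this is a genuine (finite) value
  as soon as \<open>x > 0\<close>, which suffices for limits at infinity.\<close>

definition local_mass :: "real \<Rightarrow> real measure \<Rightarrow> real \<Rightarrow> real" where
  "local_mass c F x = measure F {x<..x + c}"

text \<open>The relation \<open>\<alpha> \<sim>[at_top] \<beta>\<close> of the library tolerates common zeros of both sides. In the
  classes below the right-hand side is eventually positive, so there it means exactly
  \<open>\<alpha> x / \<beta> x \<longlongrightarrow> 1\<close>.\<close>

definition long_tailed_fun :: "(real \<Rightarrow> real) set" where
  "long_tailed_fun = {\<alpha>. \<alpha> \<in> borel_measurable borel \<and> (\<forall>x. 0 \<le> \<alpha> x) \<and>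
     (\<exists>x0>0. \<forall>x\<ge>x0. \<alpha> x > 0) \<and>
     (\<forall>y>0. (\<lambda>x. \<alpha> (x + y)) \<sim>[at_top] \<alpha>)}"

definition almost_decreasing :: "(real \<Rightarrow> real) \<Rightarrow> bool" where
  "almost_decreasing \<alpha> \<longleftrightarrow> (\<exists>x0>0. \<exists>K>0. \<forall>x>x0. \<forall>y>0. \<alpha> (x + y) \<le> K * \<alpha> x)"

definition L_Delta :: "real \<Rightarrow> real measure set" where
  "L_Delta c = {F. real_distribution F \<and> local_mass c F \<in> long_tailed_fun}"

definition S_Delta :: "real \<Rightarrow> real measure set" where
  "S_Delta c = {F. F \<in> L_Delta c \<and>
     local_mass c (conv_power F 2) \<sim>[at_top] (\<lambda>x. 2 * local_mass c F x)}"

definition D_Delta :: "real \<Rightarrow> real measure set" where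
  "D_Delta c = {F. real_distribution F \<and> almost_decreasing (local_mass c F)}"

end

theory Submission
  imports Defs
begin

text \<open>
  Let \<open>k\<close> be the density of \<open>\<nu>\<close> on \<open>(1,\<infinity>)\<close>, extended by \<open>0\<close>, and let \<open>m\<close> be the local mass of \<open>\<mu>\<close>.
  Each of the three conditions is equivalent to one condition on the monotone function \<open>k\<close>: it is
  long-tailed, and the middle part \<open>\<integral> k(x - u) k(u) du\<close> over \<open>B \<le> u \<le> x - B\<close> of its self-convolution
  is at most \<open>\<epsilon> k(x)\<close> for all \<open>x\<close> once \<open>B\<close> is large (\<open>small_middle\<close>).

  The bridge between \<open>\<mu>\<close> and \<open>k\<close> is a size-bias identity. By Levy and Khintchine
  \<open>\<mu> = P \<star> M\<close>, where \<open>P\<close> is the compound Poisson law of the jumps above \<open>1\<close> and \<open>M\<close> collects everything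
  else; \<open>M\<close> has a finite exponential moment to the right (\<open>Levy_Khintchine_decomposition\<close>). For a
  compound Poisson law, \<open>t P(dt)\<close> is the convolution of \<open>u k(u) du\<close> with \<open>P\<close>. Convolving with the
  restriction of \<open>M\<close> to \<open>[-A,A]\<close> changes the size \<open>t\<close> by at most \<open>A\<close>, so the local mass \<open>q\<close> of the
  truncated law satisfies, up to a bounded error in the factor \<open>x\<close>,
  \<open>x q(x) = \<integral> u k(u) q(x - u) du\<close> (\<open>local_mass_size_bias\<close>).
  In this integral the \<open>u\<close> close to \<open>x\<close> contribute about \<open>x k(x) c\<close>, because \<open>\<integral> q\<close> is close to \<open>c\<close>;
  bounded \<open>u\<close> contribute something negligible against \<open>x\<close>; and the middle range is the only
  possible obstruction to \<open>m \<sim> c k\<close>. Monotonicity of \<open>k\<close> is what makes this elementary: the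
  contribution of the \<open>u\<close> close to \<open>x\<close> is bounded, above and below, by values of \<open>k\<close> at points at bounded
  distance from \<open>x\<close>.

  The identity is read in three ways. If \<open>m\<close> is long-tailed, almost decreasing and has a small
  middle part, then the mixed middle part is small too, and \<open>m \<sim> c k\<close> follows
  (\<open>law_regular_imp_density_asymp\<close>). If \<open>k\<close> is long-tailed and \<open>m \<sim> c k\<close>, then the \<open>u\<close> close to \<open>x\<close>
  already exhaust the left-hand side, so the middle part is at most \<open>\<epsilon> x k(x)\<close>; by the symmetry
  \<open>u \<mapsto> x - u\<close> the weight \<open>u\<close> is worth \<open>x / 2\<close> there, hence the middle part of \<open>k\<close> is small
  (\<open>density_asymp_imp_small_middle\<close>). If \<open>k\<close> is long-tailed with small middle part, the identity
  first bounds the local mass of \<open>P\<close> by a multiple of \<open>k\<close>, since small and middle \<open>u\<close> together return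
  at most half of the supremum of the quotient, and a second application gives \<open>m \<sim> c k\<close>
  (\<open>pi_bigo_density\<close>, \<open>density_regular_imp_law_asymp\<close>).

  It remains to translate the classes. For a law in \<open>S_Delta\<close> with almost decreasing local mass
  \<open>f\<close>, the self-convolution \<open>f * f\<close> is dominated by an average of the local mass of the twofold
  convolution, so its middle part is small (\<open>small_middle_if_S_Delta\<close>). Conversely, monotone
  densities are treated by direct bounds (\<open>S_Delta_iff\<close>), and \<open>\<mu>\<close> itself by applying the
  result to \<open>\<mu> \<star> \<mu>\<close>, whose jumps above \<open>1\<close> have density \<open>2 k\<close> (\<open>density_regular_imp_S_Delta\<close>).
\<close>

section \<open>Convolutions and compound Poisson laws\<close>

lemma real_distribution_convolution:
  assumes "real_distribution M" "real_distribution N"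
  shows "real_distribution (M \<star> N)"
proof -
  interpret M: real_distribution M by fact
  interpret N: real_distribution N by fact
  interpret pair_prob_space M N ..
  show ?thesis
    unfolding convolution_def by (rule real_distribution_distr) simp
qed

lemma char_convolution:
  assumes "real_distribution M" "real_distribution N"
  shows "char (M \<star> N) z = char M z * char N z"
proof -
  interpret M: real_distribution M by fact
  interpret N: real_distribution N by fact
  interpret pair_prob_space M N ..
  have int: "integrable (M \<Otimes>\<^sub>M N) (\<lambda>x. iexp (z * (fst x + snd x)))"
    by (rule integrable_iexp) (auto simp: measurable_split_conv)
  have "char (M \<star> N) z = (CLINT x|M \<Otimes>\<^sub>M N. iexp (z * (fst x + snd x)))"
    unfolding char_def convolution_def
    by (subst integral_distr) (auto simp: case_prod_beta)
  also have "\<dots> = (CLINT x|M. CLINT y|N. iexp (z * (x + y)))"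
    by (subst integral_fst'[symmetric]) (use int in \<open>auto simp: case_prod_beta\<close>)
  also have "\<dots> = (CLINT x|M. iexp (z * x) * (CLINT y|N. iexp (z * y)))"
    by (simp add: distrib_left exp_add)
  also have "\<dots> = char M z * char N z"
    by (simp add: char_def)
  finally show ?thesis .
qed

lemma real_distribution_return: "real_distribution (return borel (x::real))"
  by (auto simp: real_distribution_def real_distribution_axioms_def intro: prob_space_return)

lemma char_return: "char (return borel x) z = iexp (z * x)"
  unfolding char_def by (subst integral_return) auto

lemma real_distribution_conv_power:
  assumes "real_distribution F"
  shows "real_distribution (conv_power F n)"
  by (induction n) (auto intro: real_distribution_return real_distribution_convolution assms)

lemma char_conv_power:
  assumes "real_distribution F"
  shows "char (conv_power F n) z = char F z ^ n"
  by (induction n)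
     (auto simp: char_return char_convolution real_distribution_conv_power assms)

lemma nn_integral_convolution_prob:
  assumes "real_distribution M" "real_distribution N" "f \<in> borel_measurable borel"
  shows "(\<integral>\<^sup>+x. f x \<partial>(M \<star> N)) = (\<integral>\<^sup>+x. \<integral>\<^sup>+y. f (x + y) \<partial>N \<partial>M)"
proof -
  interpret M: real_distribution M by fact
  interpret N: real_distribution N by fact
  show ?thesis
    by (rule nn_integral_convolution) (auto simp: M.finite_measure_axioms N.finite_measure_axioms assms)
qed

lemma nn_integral_exp_conv:
  assumes "real_distribution M" "real_distribution N"
  shows "(\<integral>\<^sup>+x. ennreal (exp (s * x)) \<partial>(M \<star> N)) =
    (\<integral>\<^sup>+x. ennreal (exp (s * x)) \<partial>M) * (\<integral>\<^sup>+x. ennreal (exp (s * x)) \<partial>N)"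
proof -
  interpret M: real_distribution M by fact
  interpret N: real_distribution N by fact
  show ?thesis
    by (simp add: nn_integral_convolution_prob assms distrib_left exp_add ennreal_mult
        nn_integral_cmult nn_integral_multc)
qed

lemma nn_integral_exp_conv_power:
  assumes "real_distribution F"
  shows "(\<integral>\<^sup>+x. ennreal (exp (s * x)) \<partial>conv_power F n) = (\<integral>\<^sup>+x. ennreal (exp (s * x)) \<partial>F) ^ n"
  by (induction n)
     (auto simp: nn_integral_return nn_integral_exp_conv real_distribution_conv_power assms)

lemma size_bias_conv:
  assumes M: "real_distribution M" "AE x in M. 0 \<le> x" and N: "real_distribution N" "AE x in N. 0 \<le> x"
    and h[measurable]: "h \<in> borel_measurable borel"
  shows "(\<integral>\<^sup>+t. ennreal t * h t \<partial>(M \<star> N)) =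
    (\<integral>\<^sup>+x. \<integral>\<^sup>+y. ennreal x * h (x + y) \<partial>N \<partial>M) + (\<integral>\<^sup>+x. \<integral>\<^sup>+y. ennreal y * h (x + y) \<partial>N \<partial>M)"
proof -
  interpret M: real_distribution M by fact
  interpret N: real_distribution N by fact
  have "(\<integral>\<^sup>+t. ennreal t * h t \<partial>(M \<star> N)) = (\<integral>\<^sup>+x. \<integral>\<^sup>+y. ennreal (x + y) * h (x + y) \<partial>N \<partial>M)"
    by (rule nn_integral_convolution_prob) (auto simp: M N)
  also have "\<dots> = (\<integral>\<^sup>+x. \<integral>\<^sup>+y. ennreal x * h (x + y) + ennreal y * h (x + y) \<partial>N \<partial>M)"
  proof (intro nn_integral_cong_AE, use M(2) in eventually_elim)
    case (elim x)
    show ?case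
      by (rule nn_integral_cong_AE, use N(2) in eventually_elim) (simp add: elim distrib_right)
  qed
  also have "\<dots> = (\<integral>\<^sup>+x. (\<integral>\<^sup>+y. ennreal x * h (x + y) \<partial>N) + (\<integral>\<^sup>+y. ennreal y * h (x + y) \<partial>N) \<partial>M)"
    by (intro nn_integral_cong nn_integral_add) auto
  also have "\<dots> = (\<integral>\<^sup>+x. \<integral>\<^sup>+y. ennreal x * h (x + y) \<partial>N \<partial>M) + (\<integral>\<^sup>+x. \<integral>\<^sup>+y. ennreal y * h (x + y) \<partial>N \<partial>M)"
    by (rule nn_integral_add) auto
  finally show ?thesis .
qed

lemma AE_nonneg_convolution:
  assumes M: "real_distribution M" "AE x in M. 0 \<le> x" and N: "real_distribution N" "AE x in N. (0::real) \<le> x"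
  shows "AE x in M \<star> N. 0 \<le> x"
proof -
  interpret M: real_distribution M by fact
  interpret N: real_distribution N by fact
  have "emeasure (M \<star> N) {..<0} = (\<integral>\<^sup>+x. \<integral>\<^sup>+y. indicator {..<0} (x + y) \<partial>N \<partial>M)"
    by (subst nn_integral_indicator[symmetric], simp, rule nn_integral_convolution_prob) (auto simp: M N)
  also have "\<dots> = (\<integral>\<^sup>+x. \<integral>\<^sup>+y. 0 \<partial>N \<partial>M)"
  proof (intro nn_integral_cong_AE, use M(2) in eventually_elim)
    case (elim x)
    show ?case
      by (rule nn_integral_cong_AE, use N(2) in eventually_elim) (use elim in auto)
  qed
  finally have "emeasure (M \<star> N) {..<0} = 0" by simp
  then show ?thesis
    by (intro AE_I[of _ _ "{..<0}"]) auto
qed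

lemma AE_nonneg_conv_power:
  assumes "real_distribution F" "AE x in F. 0 \<le> x"
  shows "AE x in conv_power F n. 0 \<le> x"
proof (induction n)
  case 0
  have "Measurable.pred borel (\<lambda>x::real. 0 \<le> x)" by measurable
  then show ?case using AE_return[of "0::real" borel "\<lambda>x. 0 \<le> x"] unfolding conv_power.simps by simp
next
  case (Suc n)
  then show ?case
    unfolding conv_power.simps
    by (intro AE_nonneg_convolution real_distribution_conv_power assms)
qed

text \<open>
  By symmetry each of the \<open>n + 1\<close> independent summands carries the same share of the size of the
  sum; the share of the first one is isolated on the right.
\<close>

lemma size_bias_conv_power:
  assumes F: "real_distribution F" "AE x in F. 0 \<le> x"
    and h[measurable]: "h \<in> borel_measurable borel"
  shows "(\<integral>\<^sup>+t. ennreal t * h t \<partial>conv_power F (Suc n)) =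
    of_nat (Suc n) * (\<integral>\<^sup>+u. \<integral>\<^sup>+v. ennreal u * h (u + v) \<partial>conv_power F n \<partial>F)"
  using h
proof (induction n arbitrary: h)
  case 0
  interpret F: real_distribution F by fact
  note [measurable] = 0
  show ?case
    using size_bias_conv[OF F real_distribution_return, of 0 h]
    by (simp add: AE_return nn_integral_return)
next
  case (Suc n)
  interpret F: real_distribution F by fact
  interpret R: real_distribution "conv_power F k" for k by (rule real_distribution_conv_power[OF F(1)])
  interpret PP: pair_sigma_finite F F ..
  note [measurable] = Suc.prems
  let ?C = "conv_power F"
  let ?J = "\<integral>\<^sup>+u. \<integral>\<^sup>+v. ennreal u * h (u + v) \<partial>?C (Suc n) \<partial>F"
  have "(\<integral>\<^sup>+t. ennreal t * h t \<partial>conv_power F (Suc (Suc n))) =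
      ?J + (\<integral>\<^sup>+x. \<integral>\<^sup>+y. ennreal y * h (x + y) \<partial>?C (Suc n) \<partial>F)"
    unfolding conv_power.simps(2)[of F "Suc n"]
    by (rule size_bias_conv) (auto intro: F Suc.prems R.real_distribution_axioms AE_nonneg_conv_power
        simp del: conv_power.simps)
  also have "(\<integral>\<^sup>+x. \<integral>\<^sup>+y. ennreal y * h (x + y) \<partial>?C (Suc n) \<partial>F) =
     (\<integral>\<^sup>+x. of_nat (Suc n) * (\<integral>\<^sup>+u. \<integral>\<^sup>+v. ennreal u * h (x + (u + v)) \<partial>?C n \<partial>F) \<partial>F)"
  proof (rule nn_integral_cong)
    fix x
    show "(\<integral>\<^sup>+y. ennreal y * h (x + y) \<partial>?C (Suc n)) =
        of_nat (Suc n) * (\<integral>\<^sup>+u. \<integral>\<^sup>+v. ennreal u * h (x + (u + v)) \<partial>?C n \<partial>F)"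
      by (rule Suc.IH[of "\<lambda>y. h (x + y)"]) measurable
  qed
  also have "\<dots> = of_nat (Suc n) * (\<integral>\<^sup>+x. (\<integral>\<^sup>+u. \<integral>\<^sup>+v. ennreal u * h (x + (u + v)) \<partial>?C n \<partial>F) \<partial>F)"
    by (intro nn_integral_cmult) measurable
  also have "(\<integral>\<^sup>+x. (\<integral>\<^sup>+u. \<integral>\<^sup>+v. ennreal u * h (x + (u + v)) \<partial>?C n \<partial>F) \<partial>F) =
    (\<integral>\<^sup>+u. (\<integral>\<^sup>+x. \<integral>\<^sup>+v. ennreal u * h (x + (u + v)) \<partial>?C n \<partial>F) \<partial>F)"
    by (rule PP.Fubini'[symmetric]) measurable
  also have "\<dots> = ?J"
    unfolding conv_power.simps
    by (intro nn_integral_cong, subst nn_integral_convolution_prob)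
       (auto simp: F R.real_distribution_axioms algebra_simps)
  finally show ?case by (simp add: distrib_right)
qed

definition poisson_mixture :: "real \<Rightarrow> real measure \<Rightarrow> real measure" where
  "poisson_mixture r F = measure_pmf (poisson_pmf r) \<bind> conv_power F"

context
  fixes F :: "real measure" and r :: real
  assumes F: "real_distribution F" and r: "0 < r"
begin

lemma conv_power_kernel:
  "conv_power F \<in> measurable (measure_pmf (poisson_pmf r)) (subprob_algebra borel)"
proof -
  have "conv_power F n \<in> space (subprob_algebra borel)" for n
    using real_distribution_conv_power[OF F, of n]
    by (auto simp: space_subprob_algebra real_distribution_def real_distribution_axioms_def
        intro: prob_space_imp_subprob_space)
  then show ?thesis by auto
qed

lemma real_distribution_poisson_mixture: "real_distribution (poisson_mixture r F)"
proof -
  have "prob_space (poisson_mixture r F)"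
    unfolding poisson_mixture_def
    by (rule measure_pmf.prob_space_bind[OF _ conv_power_kernel])
       (use real_distribution_conv_power[OF F] in \<open>auto simp: real_distribution_def\<close>)
  moreover have "sets (poisson_mixture r F) = sets borel"
    unfolding poisson_mixture_def using real_distribution_conv_power[OF F]
    by (intro sets_bind) (auto simp: real_distribution_def real_distribution_axioms_def)
  ultimately show ?thesis
    by (auto simp: real_distribution_def real_distribution_axioms_def)
qed

lemma nn_integral_poisson_mixture:
  assumes "h \<in> borel_measurable borel"
  shows "(\<integral>\<^sup>+x. h x \<partial>poisson_mixture r F) =
    (\<Sum>n. ennreal (r ^ n / fact n * exp (- r)) * (\<integral>\<^sup>+x. h x \<partial>conv_power F n))"
  unfolding poisson_mixture_def
  by (subst nn_integral_bind[OF assms conv_power_kernel])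
     (simp add: nn_integral_measure_pmf nn_integral_count_space_nat r)

text \<open>
  Stated over both the reals and the complex numbers: it evaluates exponential moments and
  characteristic functions of a Poisson mixture alike.
\<close>

lemma poisson_weights_sums:
  fixes w :: "'a::{real_normed_field,banach}"
  shows "(\<lambda>n. of_real (r ^ n / fact n * exp (- r)) * w ^ n) sums exp (of_real r * (w - 1))"
proof -
  have "(\<lambda>n. (of_real r * w) ^ n /\<^sub>R fact n * exp (- of_real r)) sums (exp (of_real r * w) * exp (- of_real r))"
    by (intro sums_mult2 exp_converges)
  moreover have "exp (- of_real r) = (of_real (exp (- r)) :: 'a)"
    by (metis exp_of_real of_real_minus)
  moreover have "exp (of_real r * w) * exp (- of_real r) = exp (of_real r * (w - 1))"
    by (simp add: exp_add[symmetric] right_diff_distrib)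
  moreover have "(\<lambda>n. (of_real r * w) ^ n /\<^sub>R fact n * exp (- of_real r)) =
    (\<lambda>n. of_real (r ^ n / fact n * exp (- r)) * w ^ n)"
    by (auto simp: fun_eq_iff power_mult_distrib scaleR_conv_of_real divide_inverse calculation(2))
  ultimately show ?thesis by simp
qed

lemma char_poisson_mixture: "char (poisson_mixture r F) z = exp (of_real r * (char F z - 1))"
proof -
  interpret P: real_distribution "poisson_mixture r F" by (rule real_distribution_poisson_mixture)
  interpret R: real_distribution "conv_power F k" for k by (rule real_distribution_conv_power[OF F])
  have bd: "(\<integral>x. f x \<partial>poisson_mixture r F) = (\<integral>n. (\<integral>x. f x \<partial>conv_power F n) \<partial>measure_pmf (poisson_pmf r))"
    if "f \<in> borel_measurable borel" "\<And>x. \<bar>f x\<bar> \<le> 1" for f :: "real \<Rightarrow> real"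
    unfolding poisson_mixture_def
    by (rule integral_bind[where K=borel and B=1 and B'=1])
       (use that conv_power_kernel in \<open>auto intro: measure_pmf.finite_measure R.emeasure_le_1\<close>)
  let ?\<phi> = "\<lambda>n. char (conv_power F n) z"
  have int: "integrable (measure_pmf (poisson_pmf r)) ?\<phi>"
    by (rule measure_pmf.integrable_const_bound[where B=1]) (auto simp: R.cmod_char_le_1)
  have ReIm: "Re (char M z) = (\<integral>x. cos (z * x) \<partial>M)" "Im (char M z) = (\<integral>x. sin (z * x) \<partial>M)"
    if "real_distribution M" for M
  proof -
    interpret M: real_distribution M by fact
    have i: "integrable M (\<lambda>x. iexp (z * x))" by (rule M.integrable_iexp) auto
    show "Re (char M z) = (\<integral>x. cos (z * x) \<partial>M)"
      unfolding char_def by (subst integral_Re[OF i, symmetric]) (simp add: Re_exp)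
    show "Im (char M z) = (\<integral>x. sin (z * x) \<partial>M)"
      unfolding char_def by (subst integral_Im[OF i, symmetric]) (simp add: Im_exp)
  qed
  have "char (poisson_mixture r F) z = (\<integral>n. ?\<phi> n \<partial>measure_pmf (poisson_pmf r))"
    by (rule complex_eqI)
       (simp_all add: ReIm P.real_distribution_axioms bd R.real_distribution_axioms
          integral_Re[OF int, symmetric] integral_Im[OF int, symmetric])
  also have "\<dots> = (\<integral>n. of_real (pmf (poisson_pmf r) n) * ?\<phi> n \<partial>count_space UNIV)"
    unfolding measure_pmf_eq_density by (subst integral_density) (auto simp: scaleR_conv_of_real)
  also have "\<dots> = (\<Sum>n. of_real (pmf (poisson_pmf r) n) * ?\<phi> n)"
  proof (rule integral_count_space_nat)
    show "integrable (count_space UNIV) (\<lambda>n. of_real (pmf (poisson_pmf r) n) * ?\<phi> n)"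
      using int unfolding measure_pmf_eq_density
      by (subst (asm) integrable_density) (auto simp: scaleR_conv_of_real)
  qed
  also have "\<dots> = exp (of_real r * (char F z - 1))"
    using poisson_weights_sums[of "char F z"]
    by (simp add: sums_iff r char_conv_power[OF F])
  finally show ?thesis .
qed

lemma nn_integral_exp_poisson_mixture:
  assumes "(\<integral>\<^sup>+x. ennreal (exp (s * x)) \<partial>F) = ennreal w" "0 \<le> w"
  shows "(\<integral>\<^sup>+x. ennreal (exp (s * x)) \<partial>poisson_mixture r F) = ennreal (exp (r * (w - 1)))"
proof -
  have "(\<integral>\<^sup>+x. ennreal (exp (s * x)) \<partial>poisson_mixture r F) =
    (\<Sum>n. ennreal (r ^ n / fact n * exp (- r) * w ^ n))"
    by (subst nn_integral_poisson_mixture)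
       (use r in \<open>auto simp: nn_integral_exp_conv_power[OF F] assms ennreal_mult'[symmetric] ennreal_power\<close>)
  also have "\<dots> = ennreal (exp (r * (w - 1)))"
    using poisson_weights_sums[of w] r assms(2)
    by (subst suminf_ennreal2) (auto simp: sums_iff)
  finally show ?thesis .
qed

lemma AE_nonneg_poisson_mixture:
  assumes "AE x in F. 0 \<le> x"
  shows "AE x in poisson_mixture r F. 0 \<le> x"
  unfolding poisson_mixture_def
proof (subst AE_bind[OF conv_power_kernel])
  show "Measurable.pred borel (\<lambda>x::real. 0 \<le> x)" by measurable
qed (auto intro!: AE_nonneg_conv_power F assms)

text \<open>
  The Poisson weights \<open>w\<^sub>n\<close> satisfy \<open>(n + 1) w\<^sub>n\<^sub>+\<^sub>1 = r w\<^sub>n\<close>, which turns the factor \<open>n + 1\<close> in the size bias of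
  a convolution power into an index shift.
\<close>

lemma size_bias_poisson_mixture:
  assumes nonneg: "AE x in F. 0 \<le> x" and h[measurable]: "h \<in> borel_measurable borel"
  shows "(\<integral>\<^sup>+t. ennreal t * h t \<partial>poisson_mixture r F) =
    ennreal r * (\<integral>\<^sup>+u. ennreal u * (\<integral>\<^sup>+v. h (u + v) \<partial>poisson_mixture r F) \<partial>F)"
proof -
  interpret F: real_distribution F by (rule F)
  interpret R: real_distribution "conv_power F k" for k by (rule real_distribution_conv_power[OF F])
  let ?w = "\<lambda>n. ennreal (r ^ n / fact n * exp (- r))"
  define J where "J n = (\<integral>\<^sup>+u. \<integral>\<^sup>+v. ennreal u * h (u + v) \<partial>conv_power F n \<partial>F)" for n
  have w: "?w (Suc n) * of_nat (Suc n) = ennreal r * ?w n" for n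
  proof -
    have "r ^ Suc n / fact (Suc n) * exp (- r) * real (Suc n) = r * (r ^ n / fact n * exp (- r))"
      by (simp add: divide_simps)
    then show ?thesis
      using r by (subst ennreal_of_nat_eq_real_of_nat, subst (1 2) ennreal_mult[symmetric]) auto
  qed
  have "(\<integral>\<^sup>+t. ennreal t * h t \<partial>poisson_mixture r F) =
      (\<Sum>n. ?w n * (\<integral>\<^sup>+t. ennreal t * h t \<partial>conv_power F n))"
    by (rule nn_integral_poisson_mixture) measurable
  also have "\<dots> = (\<Sum>n. ?w (Suc n) * (\<integral>\<^sup>+t. ennreal t * h t \<partial>conv_power F (Suc n)))"
    by (subst suminf_offset[of _ 1]) (auto simp: nn_integral_return simp del: conv_power.simps(2))
  also have "\<dots> = (\<Sum>n. ennreal r * (?w n * J n))"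
    unfolding size_bias_conv_power[OF F nonneg h] J_def[symmetric]
    by (simp only: mult.assoc[symmetric] w)
  also have "\<dots> = ennreal r * (\<Sum>n. ?w n * J n)"
    by (rule ennreal_suminf_cmult)
  also have "(\<Sum>n. ?w n * J n) =
      (\<Sum>n. (\<integral>\<^sup>+u. ennreal u * (?w n * (\<integral>\<^sup>+v. h (u + v) \<partial>conv_power F n)) \<partial>F))"
    unfolding J_def
    by (simp add: nn_integral_cmult[symmetric] mult.left_commute)
  also have "\<dots> = (\<integral>\<^sup>+u. (\<Sum>n. ennreal u * (?w n * (\<integral>\<^sup>+v. h (u + v) \<partial>conv_power F n))) \<partial>F)"
    by (rule nn_integral_suminf[symmetric]) measurable
  also have "\<dots> = (\<integral>\<^sup>+u. ennreal u * (\<integral>\<^sup>+v. h (u + v) \<partial>poisson_mixture r F) \<partial>F)"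
    by (subst nn_integral_poisson_mixture) (auto simp: ennreal_suminf_cmult)
  finally show ?thesis .
qed

end

text \<open>
  The compound Poisson law with an arbitrary finite jump measure \<open>\<kappa>\<close>, with the properties used
  below. The null measure cannot be normalised and gives the point mass at \<open>0\<close>.
\<close>

lemma compound_poisson_exists:
  fixes \<kappa> :: "real measure"
  assumes fin: "finite_measure \<kappa>" and sets: "sets \<kappa> = sets borel"
  obtains P where "real_distribution P"
    and "\<And>z. char P z = exp (CLINT u|\<kappa>. iexp (z * u) - 1)"
    and "\<And>s. integrable \<kappa> (\<lambda>u. exp (s * u)) \<Longrightarrow>
      (\<integral>\<^sup>+x. ennreal (exp (s * x)) \<partial>P) = ennreal (exp (\<integral>u. exp (s * u) - 1 \<partial>\<kappa>))"
    and "AE u in \<kappa>. 0 \<le> u \<Longrightarrow> AE x in P. 0 \<le> x"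
    and "\<And>h. AE u in \<kappa>. 0 \<le> u \<Longrightarrow> h \<in> borel_measurable borel \<Longrightarrow>
      (\<integral>\<^sup>+t. ennreal t * h t \<partial>P) = (\<integral>\<^sup>+u. ennreal u * (\<integral>\<^sup>+v. h (u + v) \<partial>P) \<partial>\<kappa>)"
proof -
  interpret finite_measure \<kappa> by fact
  note [measurable_cong] = sets
  have space: "space \<kappa> = UNIV" using sets_eq_imp_space_eq[OF sets] by simp
  define r where "r = measure \<kappa> UNIV"
  show thesis
  proof (cases "r = 0")
    case True
    then have e0: "emeasure \<kappa> UNIV = 0" by (simp add: r_def emeasure_eq_measure)
    have \<kappa>: "\<kappa> = null_measure borel"
    proof (rule measure_eqI)
      fix A assume "A \<in> sets \<kappa>"
      have "emeasure \<kappa> A \<le> emeasure \<kappa> UNIV" by (rule emeasure_mono) (auto simp: sets)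
      then show "emeasure \<kappa> A = emeasure (null_measure borel) A" using e0 by simp
    qed (simp add: sets)
    have 1: "Measurable.pred borel (\<lambda>x::real. 0 \<le> x)" by measurable
    have "AE x in return borel 0. (0::real) \<le> x"
      using AE_return[of "0::real" borel "\<lambda>x. 0 \<le> x"] 1 by simp
    then show thesis
      by (intro that[of "return borel 0"])
         (auto simp: real_distribution_return char_return \<kappa> nn_integral_return)
  next
    case False
    then have r: "0 < r" unfolding r_def by (simp add: less_le)
    then have e: "emeasure \<kappa> UNIV = ennreal r" by (simp add: r_def emeasure_eq_measure)
    define F where "F = uniform_measure \<kappa> UNIV"
    have U: "UNIV \<in> sets \<kappa>" by (simp add: sets)
    have F: "real_distribution F"
      unfolding F_def real_distribution_def real_distribution_axioms_def
      using r by (auto intro!: prob_space_uniform_measure simp: e sets)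
    have dens: "F = density \<kappa> (\<lambda>x. ennreal (1 / r))"
      unfolding F_def uniform_measure_def e using r divide_ennreal[of 1 r] by simp
    have nnF: "(\<integral>\<^sup>+x. f x \<partial>F) = ennreal (1 / r) * (\<integral>\<^sup>+x. f x \<partial>\<kappa>)" if "f \<in> borel_measurable borel" for f
      unfolding dens using that by (simp add: nn_integral_density nn_integral_cmult)
    have intF: "(\<integral>x. f x \<partial>F) = (1 / r) *\<^sub>R (\<integral>x. f x \<partial>\<kappa>)"
      if "f \<in> borel_measurable borel" for f :: "real \<Rightarrow> 'b::{banach,second_countable_topology}"
      unfolding dens using that r by (subst integral_density) auto
    have AEF: "AE u in \<kappa>. 0 \<le> u \<Longrightarrow> AE u in F. 0 \<le> u"
      unfolding dens by (subst AE_density) auto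
    show thesis
    proof (rule that[of "poisson_mixture r F"])
      fix z
      have i: "integrable \<kappa> (\<lambda>u. iexp (z * u))"
        by (rule integrable_const_bound[where B=1]) auto
      have "of_real r * (char F z - 1) = (CLINT u|\<kappa>. iexp (z * u) - 1)"
        using r i unfolding char_def
        by (subst intF) (auto simp: space r_def[symmetric] scaleR_conv_of_real field_simps)
      then show "char (poisson_mixture r F) z = exp (CLINT u|\<kappa>. iexp (z * u) - 1)"
        by (simp add: char_poisson_mixture F r)
    next
      fix s assume i: "integrable \<kappa> (\<lambda>u. exp (s * u))"
      let ?w = "(1 / r) * (\<integral>u. exp (s * u) \<partial>\<kappa>)"
      have "(\<integral>\<^sup>+x. ennreal (exp (s * x)) \<partial>F) = ennreal ?w"
        using i r by (subst nnF) (auto simp: nn_integral_eq_integral ennreal_mult'[symmetric])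
      moreover have "r * (?w - 1) = (\<integral>u. exp (s * u) - 1 \<partial>\<kappa>)"
        using i r by (simp add: space r_def[symmetric] field_simps)
      ultimately show "(\<integral>\<^sup>+x. ennreal (exp (s * x)) \<partial>poisson_mixture r F)
          = ennreal (exp (\<integral>u. exp (s * u) - 1 \<partial>\<kappa>))"
        using nn_integral_exp_poisson_mixture[OF F r, of s ?w] r
        by (auto intro!: integral_nonneg_AE)
    next
      assume "AE u in \<kappa>. 0 \<le> u"
      then show "AE x in poisson_mixture r F. 0 \<le> x"
        by (intro AE_nonneg_poisson_mixture F r AEF)
    next
      fix h :: "real \<Rightarrow> ennreal" assume a: "AE u in \<kappa>. 0 \<le> u" and h[measurable]: "h \<in> borel_measurable borel"
      interpret P: real_distribution "poisson_mixture r F" by (rule real_distribution_poisson_mixture[OF F r])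
      have 1: "ennreal r * ennreal (1 / r) = 1"
        using r by (simp add: ennreal_mult[symmetric])
      show "(\<integral>\<^sup>+t. ennreal t * h t \<partial>poisson_mixture r F) =
          (\<integral>\<^sup>+u. ennreal u * (\<integral>\<^sup>+v. h (u + v) \<partial>poisson_mixture r F) \<partial>\<kappa>)"
        by (subst size_bias_poisson_mixture[OF F r AEF[OF a] h], subst nnF)
           (auto simp: mult.assoc[symmetric] 1)
    qed (rule real_distribution_poisson_mixture[OF F r])
  qed
qed

section \<open>The Levy-Khintchine decomposition\<close>

text \<open>
  Makes the exponential moments of a centred compound Poisson law with jumps in \<open>[-1,1]\<close> depend only
  on the second moment of the jumps.
\<close>

lemma exp_quadratic_bound:
  fixes y :: real assumes "\<bar>y\<bar> \<le> 1" shows "exp y - 1 - y \<le> y\<^sup>2"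
proof (cases "0 \<le> y")
  case True
  then show ?thesis using exp_bound[of y] assms by auto
next
  case False
  define t where "t = - y"
  have t: "0 < t" using False by (simp add: t_def)
  \<comment> \<open>The product is \<open>1 + t ^ 3\<close>, so \<open>1 - t + t\<^sup>2\<close> bounds \<open>1 / (1 + t)\<close> and hence \<open>exp (- t)\<close>.\<close>
  have "1 \<le> (1 + t) * (1 - t + t\<^sup>2)"
    using t by (simp add: algebra_simps power2_eq_square power3_eq_cube)
  also have "\<dots> \<le> exp t * (1 - t + t\<^sup>2)"
  proof (rule mult_right_mono)
    have "0 \<le> (1 - t / 2)\<^sup>2 + 3 / 4 * t\<^sup>2" by simp
    also have "\<dots> = 1 - t + t\<^sup>2" by (simp add: power2_eq_square algebra_simps)
    finally show "0 \<le> 1 - t + t\<^sup>2" .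
  qed simp
  finally have "exp (- t) \<le> 1 - t + t\<^sup>2"
    by (simp add: exp_minus field_simps)
  then show ?thesis by (simp add: t_def)
qed

lemma iexp_quadratic_bound:
  "cmod (iexp (z * y) - 1 - \<i> * complex_of_real (z * y)) \<le> z\<^sup>2 * y\<^sup>2"
proof -
  have "cmod (iexp (z * y) - (\<Sum>k\<le>1. (\<i> * complex_of_real (z * y)) ^ k / fact k)) \<le> \<bar>z * y\<bar> ^ Suc 1 / fact (Suc 1)"
    by (rule iexp_approx1)
  also have "\<dots> = z\<^sup>2 * y\<^sup>2 / 2"
    by (simp add: numeral_2_eq_2[symmetric] power_mult_distrib)
  also have "\<dots> \<le> z\<^sup>2 * y\<^sup>2" by simp
  finally show ?thesis by (simp add: algebra_simps)
qed

text \<open>Restriction of a measure to \<open>A\<close>, as a density, so that the rules for integrals against densities apply.\<close>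

abbreviation restr :: "real measure \<Rightarrow> real set \<Rightarrow> real measure" where
  "restr \<nu> A \<equiv> density \<nu> (\<lambda>x. ennreal (indicator A x))"

lemma sets_levy: "levy_measure \<nu> \<Longrightarrow> sets \<nu> = sets borel"
  by (simp add: levy_measure_def)

context
  fixes \<nu> :: "real measure"
  assumes levy: "levy_measure \<nu>"
  notes [measurable_cong] = sets_levy[OF levy]
begin

lemma integrable_min_levy: "integrable \<nu> (\<lambda>x. min 1 (x\<^sup>2))"
  using levy by (intro integrableI_nonneg) (auto simp: levy_measure_def)

lemma integrable_levy_bound:
  fixes f :: "real \<Rightarrow> 'b::{banach,second_countable_topology}"
  assumes "f \<in> borel_measurable borel" "\<And>x. norm (f x) \<le> C * min 1 (x\<^sup>2)"
  shows "integrable \<nu> f"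
  by (rule Bochner_Integration.integrable_bound[where f="\<lambda>x. C * min 1 (x\<^sup>2)"])
     (use assms integrable_min_levy in \<open>auto intro!: AE_I2 order.trans[OF assms(2)]\<close>)

lemma integrable_levy_away:
  fixes f :: "real \<Rightarrow> 'b::{banach,second_countable_topology}"
  assumes "f \<in> borel_measurable borel" "0 < d" "\<And>x. \<bar>x\<bar> \<ge> d \<Longrightarrow> norm (f x) \<le> C" "A \<in> sets borel"
    "A \<subseteq> {x. d \<le> \<bar>x\<bar>}"
  shows "integrable \<nu> (\<lambda>x. indicator A x *\<^sub>R f x)"
proof (rule integrable_levy_bound[where C="\<bar>C\<bar> / min 1 (d\<^sup>2)"])
  show "(\<lambda>x. indicator A x *\<^sub>R f x) \<in> borel_measurable borel" using assms by measurable
  fix x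
  have m: "0 < min 1 (d\<^sup>2)" using assms(2) by auto
  show "norm (indicator A x *\<^sub>R f x) \<le> \<bar>C\<bar> / min 1 (d\<^sup>2) * min 1 (x\<^sup>2)"
  proof (cases "x \<in> A")
    case True
    then have d: "d \<le> \<bar>x\<bar>" using assms by auto
    then have "d\<^sup>2 \<le> x\<^sup>2" using assms(2) by (simp add: abs_le_square_iff[symmetric])
    then have "1 \<le> min 1 (x\<^sup>2) / min 1 (d\<^sup>2)" using m by (auto simp: field_simps)
    then have "\<bar>C\<bar> * 1 \<le> \<bar>C\<bar> * (min 1 (x\<^sup>2) / min 1 (d\<^sup>2))" by (intro mult_left_mono) auto
    moreover have "norm (f x) \<le> \<bar>C\<bar>" using assms(3)[OF d] by simp
    ultimately show ?thesis using True by (simp add: field_simps)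
  next
    case False
    then show ?thesis using m by (auto intro!: mult_nonneg_nonneg divide_nonneg_nonneg)
  qed
qed

lemma finite_measure_restr:
  assumes "0 < d" "A \<in> sets borel" "A \<subseteq> {x. d \<le> \<bar>x\<bar>}"
  shows "finite_measure (restr \<nu> A)"
proof -
  have "integrable \<nu> (\<lambda>x. indicator A x *\<^sub>R (1::real))"
    by (rule integrable_levy_away[where d=d and C=1]) (use assms in auto)
  then have "emeasure (restr \<nu> A) (space (restr \<nu> A)) < \<infinity>"
    using assms(2) by (simp add: emeasure_density nn_integral_eq_integral)
  then show ?thesis by (intro finite_measureI) auto
qed

lemma integral_restr:
  fixes f :: "real \<Rightarrow> 'b::{banach,second_countable_topology}"
  assumes "f \<in> borel_measurable borel" "A \<in> sets borel"
  shows "(\<integral>x. f x \<partial>restr \<nu> A) = (\<integral>x. indicator A x *\<^sub>R f x \<partial>\<nu>)"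
  using assms by (subst integral_density) auto

lemma integrable_restr:
  fixes f :: "real \<Rightarrow> 'b::{banach,second_countable_topology}"
  assumes "f \<in> borel_measurable borel" "A \<in> sets borel"
  shows "integrable (restr \<nu> A) f \<longleftrightarrow> integrable \<nu> (\<lambda>x. indicator A x *\<^sub>R f x)"
  using assms by (subst integrable_density) auto

text \<open>
  Jumps between \<open>d\<close> and \<open>1\<close> in absolute value, compensated by their mean. The exponential moments
  are bounded independently of \<open>d\<close>, because \<open>exp y - 1 - y \<le> y\<^sup>2\<close> on \<open>[-1,1]\<close>; this uniformity is what
  allows \<open>d \<rightarrow> 0\<close>.
\<close>

lemma centred_compound_poisson_exists:
  assumes d: "0 < d" and A: "A \<in> sets borel" "A \<subseteq> {y. d \<le> \<bar>y\<bar> \<and> \<bar>y\<bar> \<le> 1}"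
  obtains S where "real_distribution S"
    "\<And>z. char S z = exp (CLINT y|\<nu>. indicator A y *\<^sub>R (iexp (z * y) - 1 - \<i> * complex_of_real (z * y)))"
    "\<And>s. \<bar>s\<bar> \<le> 1 \<Longrightarrow> (\<integral>\<^sup>+x. ennreal (exp (s * x)) \<partial>S) \<le> ennreal (exp (\<integral>y. min 1 (y\<^sup>2) \<partial>\<nu>))"
proof -
  note [measurable] = A(1)
  let ?\<kappa> = "restr \<nu> A"
  have int_A: "integrable \<nu> (\<lambda>y. indicator A y *\<^sub>R f y)"
    if [measurable]: "f \<in> borel_measurable borel" and "\<And>y. \<bar>y\<bar> \<le> 1 \<Longrightarrow> norm (f y) \<le> C"
    for f :: "real \<Rightarrow> 'b::{banach,second_countable_topology}" and C
  proof -
    have "integrable \<nu> (\<lambda>y. indicator A y *\<^sub>R (indicator {-1..1} y *\<^sub>R f y))"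
    proof (rule integrable_levy_away[where d=d and C="\<bar>C\<bar>"])
      fix y
      show "norm (indicat_real {-1..1} y *\<^sub>R f y) \<le> \<bar>C\<bar>"
        using that(2)[of y] by (auto simp: indicator_def intro: order.trans[OF _ abs_ge_self])
    qed (use d A in auto)
    moreover have "indicator A y *\<^sub>R (indicator {-1..1} y *\<^sub>R f y) = indicator A y *\<^sub>R f y" for y
      using A(2) by (auto simp: indicator_def)
    ultimately show ?thesis by (simp only:)
  qed
  have fin: "finite_measure ?\<kappa>"
    by (rule finite_measure_restr[OF d A(1)]) (use A(2) in auto)
  have setsr: "sets ?\<kappa> = sets borel" by (simp add: sets_levy[OF levy])
  obtain P where P: "real_distribution P" "\<And>z. char P z = exp (CLINT u|?\<kappa>. iexp (z * u) - 1)"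
    "\<And>s. integrable ?\<kappa> (\<lambda>u. exp (s * u)) \<Longrightarrow>
      (\<integral>\<^sup>+x. ennreal (exp (s * x)) \<partial>P) = ennreal (exp (\<integral>u. exp (s * u) - 1 \<partial>?\<kappa>))"
    by (rule compound_poisson_exists[OF fin setsr], rule that; assumption)
  define m where "m = (\<integral>y. indicator A y *\<^sub>R y \<partial>\<nu>)"
  have im: "integrable \<nu> (\<lambda>y. indicator A y *\<^sub>R y)" by (rule int_A[of _ 1]) auto
  show thesis
  proof (rule that[of "P \<star> return borel (- m)"])
    show "real_distribution (P \<star> return borel (- m))"
      by (intro real_distribution_convolution P real_distribution_return)
    fix z
    have i: "integrable \<nu> (\<lambda>y. indicator A y *\<^sub>R (iexp (z * y) - 1))"
      by (rule int_A[of _ 2]) (auto intro!: order.trans[OF norm_triangle_ineq4])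
    have im': "integrable \<nu> (\<lambda>y. (\<i> * complex_of_real z) * complex_of_real (indicator A y *\<^sub>R y))"
      using im by (intro integrable_mult_right integrable_of_real)
    have "(CLINT y|\<nu>. indicator A y *\<^sub>R (iexp (z * y) - 1 - \<i> * complex_of_real (z * y))) =
      (CLINT y|\<nu>. indicator A y *\<^sub>R (iexp (z * y) - 1) - (\<i> * complex_of_real z) * complex_of_real (indicator A y *\<^sub>R y))"
      by (intro Bochner_Integration.integral_cong refl) (auto simp: indicator_def)
    also have "\<dots> = (CLINT y|\<nu>. indicator A y *\<^sub>R (iexp (z * y) - 1))
        - (\<i> * complex_of_real z) * complex_of_real m"
      unfolding m_def
      by (subst Bochner_Integration.integral_diff[OF i im'])
         (simp only: integral_mult_right_zero integral_complex_of_real)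
    finally show "char (P \<star> return borel (- m)) z =
        exp (CLINT y|\<nu>. indicator A y *\<^sub>R (iexp (z * y) - 1 - \<i> * complex_of_real (z * y)))"
      by (simp add: char_convolution P real_distribution_return char_return integral_restr
          exp_diff exp_minus divide_inverse mult.assoc)
  next
    fix s :: real assume s: "\<bar>s\<bar> \<le> 1"
    have ie: "integrable ?\<kappa> (\<lambda>u. exp (s * u))"
    proof (subst integrable_restr)
      show "integrable \<nu> (\<lambda>x. indicator A x *\<^sub>R exp (s * x))"
      proof (rule int_A[of _ "exp 1"])
        fix y :: real assume "\<bar>y\<bar> \<le> 1"
        then have "\<bar>s * y\<bar> \<le> 1" using s by (simp add: abs_mult mult_le_one)
        then show "norm (exp (s * y)) \<le> exp 1" by auto
      qed auto
    qed (auto simp: A)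
    have i: "integrable \<nu> (\<lambda>y. indicator A y *\<^sub>R (exp (s * y) - 1))"
    proof -
      have "integrable \<nu> (\<lambda>y. indicator A y *\<^sub>R (1::real))" by (rule int_A[of _ 1]) auto
      moreover have "integrable \<nu> (\<lambda>y. indicator A y *\<^sub>R exp (s * y))"
        using ie by (subst (asm) integrable_restr) (auto simp: A)
      ultimately have "integrable \<nu> (\<lambda>y. indicator A y *\<^sub>R exp (s * y) - indicator A y *\<^sub>R 1)"
        by (intro Bochner_Integration.integrable_diff)
      then show ?thesis by (simp add: right_diff_distrib)
    qed
    have ims: "integrable \<nu> (\<lambda>y. s * (indicator A y *\<^sub>R y))"
      using im by (rule integrable_mult_right)
    have "(\<integral>u. exp (s * u) - 1 \<partial>?\<kappa>) - s * m =
        (\<integral>y. indicator A y *\<^sub>R (exp (s * y) - 1) - s * (indicator A y *\<^sub>R y) \<partial>\<nu>)"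
      unfolding m_def
      by (subst Bochner_Integration.integral_diff[OF i ims], subst integral_mult_right_zero, subst integral_restr)
         (simp_all add: A)
    also have "\<dots> \<le> (\<integral>y. min 1 (y\<^sup>2) \<partial>\<nu>)"
    proof (rule integral_mono[OF _ integrable_min_levy])
      show "integrable \<nu> (\<lambda>y. indicator A y *\<^sub>R (exp (s * y) - 1) - s * (indicator A y *\<^sub>R y))"
        using i ims by (rule Bochner_Integration.integrable_diff)
      fix y :: real
      show "indicator A y *\<^sub>R (exp (s * y) - 1) - s * (indicator A y *\<^sub>R y) \<le> min 1 (y\<^sup>2)"
      proof (cases "y \<in> A")
        case True
        then have y: "\<bar>y\<bar> \<le> 1" using A(2) by auto
        then have "y\<^sup>2 \<le> 1" by (simp add: abs_square_le_1)
        moreover have "s\<^sup>2 \<le> 1" using s by (simp add: abs_square_le_1)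
        then have "(s * y)\<^sup>2 \<le> y\<^sup>2" by (simp add: power_mult_distrib mult_left_le_one_le)
        moreover have "exp (s * y) - 1 - s * y \<le> (s * y)\<^sup>2"
          using s y by (intro exp_quadratic_bound) (simp add: abs_mult mult_le_one)
        ultimately show ?thesis using True by simp
      qed auto
    qed
    finally have le: "(\<integral>u. exp (s * u) - 1 \<partial>?\<kappa>) - s * m \<le> (\<integral>y. min 1 (y\<^sup>2) \<partial>\<nu>)" .
    have "(\<integral>\<^sup>+x. ennreal (exp (s * x)) \<partial>(P \<star> return borel (- m))) =
        ennreal (exp ((\<integral>u. exp (s * u) - 1 \<partial>?\<kappa>) - s * m))"
      by (simp add: nn_integral_exp_conv P(1) real_distribution_return P(3)[OF ie] nn_integral_return
          ennreal_mult[symmetric] exp_add[symmetric])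
    then show "(\<integral>\<^sup>+x. ennreal (exp (s * x)) \<partial>(P \<star> return borel (- m))) \<le> ennreal (exp (\<integral>y. min 1 (y\<^sup>2) \<partial>\<nu>))"
      using le by (simp add: ennreal_leI)
  qed
qed


text \<open>Markov inequality for \<open>exp x + exp (- x)\<close>.\<close>

lemma tight_if_exp_moments_bounded:
  assumes S: "\<And>n. real_distribution (S n)"
    and bound: "\<And>n s. \<bar>s\<bar> \<le> 1 \<Longrightarrow> (\<integral>\<^sup>+x. ennreal (exp (s * x)) \<partial>S n) \<le> ennreal C"
  shows "tight S"
  unfolding tight_def
proof (intro conjI allI impI S)
  fix \<epsilon> :: real assume \<epsilon>: "0 < \<epsilon>"
  define K where "K = max 1 (ln ((2 * \<bar>C\<bar> + 1) / \<epsilon>))"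
  have K: "0 < K" "(2 * \<bar>C\<bar> + 1) / \<epsilon> \<le> exp K"
  proof -
    have "(2 * \<bar>C\<bar> + 1) / \<epsilon> = exp (ln ((2 * \<bar>C\<bar> + 1) / \<epsilon>))"
      using \<epsilon> by (subst exp_ln) (auto intro!: divide_pos_pos)
    also have "\<dots> \<le> exp K" by (simp add: K_def)
    finally show "(2 * \<bar>C\<bar> + 1) / \<epsilon> \<le> exp K" .
  qed (simp add: K_def)
  have "measure (S n) {-K<..K} > 1 - \<epsilon>" for n
  proof -
    interpret S: real_distribution "S n" by (rule S)
    have "ennreal (exp K) * emeasure (S n) (UNIV - {-K<..K}) =
        (\<integral>\<^sup>+x. ennreal (exp K) * indicator (UNIV - {-K<..K}) x \<partial>S n)"
      by (rule nn_integral_cmult_indicator[symmetric]) simp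
    also have "\<dots> \<le> (\<integral>\<^sup>+x. ennreal (exp (1 * x)) + ennreal (exp (- 1 * x)) \<partial>S n)"
    proof (rule nn_integral_mono)
      fix x
      show "ennreal (exp K) * indicator (UNIV - {-K<..K}) x \<le> ennreal (exp (1 * x)) + ennreal (exp (- 1 * x))"
      proof (cases "x \<in> {-K<..K}")
        case False
        then have "exp K \<le> exp x \<or> exp K \<le> exp (- x)" by auto
        then have "exp K \<le> exp x + exp (- x)"
          using exp_ge_zero[of x] exp_ge_zero[of "- x"] by linarith
        then show ?thesis using False by (simp add: ennreal_plus[symmetric] del: ennreal_plus)
      qed simp
    qed
    also have "\<dots> = (\<integral>\<^sup>+x. ennreal (exp (1 * x)) \<partial>S n) + (\<integral>\<^sup>+x. ennreal (exp (- 1 * x)) \<partial>S n)"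
      by (rule nn_integral_add) auto
    also have "\<dots> \<le> ennreal C + ennreal C"
      by (intro add_mono bound) auto
    also have "\<dots> \<le> ennreal (2 * \<bar>C\<bar>)"
      by (auto simp: ennreal_plus[symmetric] abs_if ennreal_neg simp del: ennreal_plus intro!: ennreal_leI)
    finally have "exp K * measure (S n) (UNIV - {-K<..K}) \<le> 2 * \<bar>C\<bar>"
      by (simp add: S.emeasure_eq_measure ennreal_mult[symmetric])
    then have "(2 * \<bar>C\<bar> + 1) / \<epsilon> * measure (S n) (UNIV - {-K<..K}) \<le> 2 * \<bar>C\<bar>"
      using K(2) by (meson measure_nonneg mult_right_mono order.trans)
    then have "(2 * \<bar>C\<bar> + 1) * measure (S n) (UNIV - {-K<..K}) \<le> 2 * \<bar>C\<bar> * \<epsilon>"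
      using \<epsilon> by (simp add: field_simps)
    also have "\<dots> < (2 * \<bar>C\<bar> + 1) * \<epsilon>" using \<epsilon> by (simp add: algebra_simps)
    finally have "measure (S n) (UNIV - {-K<..K}) < \<epsilon>" by (simp add: mult_less_cancel_left_pos)
    moreover have "measure (S n) (UNIV - {-K<..K}) = 1 - measure (S n) {-K<..K}"
      using S.prob_compl[of "{-K<..K}"] by simp
    ultimately show ?thesis by simp
  qed
  with K(1) show "\<exists>a b. a < b \<and> (\<forall>n. 1 - \<epsilon> < measure (S n) {a<..b})"
    by (intro exI[of _ "-K"] exI[of _ K]) auto
qed

text \<open>The truncations \<open>min (exp x) k\<close> are bounded and continuous, so their integrals converge; Fatou removes the truncation.\<close>

lemma exp_moment_weak_limit:
  assumes S: "\<And>n. real_distribution (S n)" and M: "real_distribution M" and conv: "weak_conv_m S M"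
    and bound: "\<And>n. (\<integral>\<^sup>+x. ennreal (exp x) \<partial>S n) \<le> ennreal C"
  shows "(\<integral>\<^sup>+x. ennreal (exp x) \<partial>M) \<le> ennreal C"
proof -
  interpret M: real_distribution M by (rule M)
  have trunc: "(\<integral>\<^sup>+x. ennreal (min (exp x) (real k)) \<partial>M) \<le> ennreal C" for k :: nat
  proof -
    have b: "norm (min (exp x) (real k)) \<le> real k" for x :: real by auto
    have lim: "(\<lambda>n. \<integral>x. min (exp x) (real k) \<partial>S n) \<longlonglongrightarrow> (\<integral>x. min (exp x) (real k) \<partial>M)"
      by (rule weak_conv_imp_integral_bdd_continuous_conv[OF S M conv _ b]) (intro continuous_intros)
    have "(\<integral>x. min (exp x) (real k) \<partial>S n) \<le> \<bar>C\<bar>" for n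
    proof -
      interpret S: real_distribution "S n" by (rule S)
      have "ennreal (\<integral>x. min (exp x) (real k) \<partial>S n) = (\<integral>\<^sup>+x. ennreal (min (exp x) (real k)) \<partial>S n)"
        by (intro nn_integral_eq_integral[symmetric] S.integrable_const_bound[where B="real k"]) auto
      also have "\<dots> \<le> (\<integral>\<^sup>+x. ennreal (exp x) \<partial>S n)"
        by (intro nn_integral_mono ennreal_leI) auto
      also have "\<dots> \<le> ennreal \<bar>C\<bar>" by (rule order.trans[OF bound]) (simp add: ennreal_leI)
      finally show ?thesis by simp
    qed
    then have "(\<integral>x. min (exp x) (real k) \<partial>M) \<le> \<bar>C\<bar>"
      using LIMSEQ_le_const2[OF lim] by blast
    moreover have "(\<integral>\<^sup>+x. ennreal (min (exp x) (real k)) \<partial>M) = ennreal (\<integral>x. min (exp x) (real k) \<partial>M)"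
      by (intro nn_integral_eq_integral M.integrable_const_bound[where B="real k"]) auto
    moreover have "0 \<le> C"
    proof (rule ccontr)
      interpret S: real_distribution "S 0" by (rule S)
      assume "\<not> 0 \<le> C"
      then have "(\<integral>\<^sup>+x. ennreal (exp x) \<partial>S 0) = 0" using bound[of 0] by (simp add: ennreal_neg)
      then have "AE x in S 0. False" by (subst (asm) nn_integral_0_iff_AE) auto
      then show False by simp
    qed
    ultimately show ?thesis by (simp add: ennreal_leI)
  qed
  have "(\<integral>\<^sup>+x. ennreal (exp x) \<partial>M) = (\<integral>\<^sup>+x. liminf (\<lambda>k. ennreal (min (exp x) (real k))) \<partial>M)"
  proof (rule nn_integral_cong)
    fix x :: real
    have "(\<lambda>k. ennreal (min (exp x) (real k))) \<longlonglongrightarrow> ennreal (exp x)"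
    proof (rule tendsto_eventually, rule eventually_sequentiallyI)
      fix k assume "nat \<lceil>exp x\<rceil> \<le> k"
      then have "exp x \<le> real k" by linarith
      then show "ennreal (min (exp x) (real k)) = ennreal (exp x)" by simp
    qed
    then show "ennreal (exp x) = liminf (\<lambda>k. ennreal (min (exp x) (real k)))"
      by (rule lim_imp_Liminf[OF trivial_limit_sequentially, symmetric])
  qed
  also have "\<dots> \<le> liminf (\<lambda>k. \<integral>\<^sup>+x. ennreal (min (exp x) (real k)) \<partial>M)"
    by (rule nn_integral_liminf) auto
  also have "\<dots> \<le> ennreal C"
    by (rule order.trans[OF Liminf_le_Limsup Limsup_bounded]) (auto simp: trunc)
  finally show ?thesis .
qed

text \<open>
  The law of the compensated jumps of size at most \<open>1\<close>, which may have infinite total mass. It is a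
  weak limit of the compensated jumps of size at least \<open>1 / n\<close>: bounded exponential moments give
  tightness, the characteristic functions converge by dominated convergence, and the moment bound
  passes to the limit.
\<close>

lemma small_jumps_exists:
  obtains S where "real_distribution S"
    "\<And>z. char S z = exp (CLINT y|\<nu>. indicator {-1..1} y *\<^sub>R (iexp (z * y) - 1 - \<i> * complex_of_real (z * y)))"
    "(\<integral>\<^sup>+x. ennreal (exp x) \<partial>S) < \<infinity>"
proof -
  define A :: "nat \<Rightarrow> real set" where "A n = {y. inverse (real (Suc n)) \<le> \<bar>y\<bar> \<and> \<bar>y\<bar> \<le> 1}" for n
  have [measurable]: "A n \<in> sets borel" for n unfolding A_def by measurable
  define C where "C = exp (\<integral>y. min 1 (y\<^sup>2) \<partial>\<nu>)"
  let ?f = "\<lambda>z y. iexp (z * y) - 1 - \<i> * complex_of_real (z * y)"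
  have "\<exists>S. real_distribution S \<and>
    (\<forall>z. char S z = exp (CLINT y|\<nu>. indicator (A n) y *\<^sub>R ?f z y)) \<and>
    (\<forall>s. \<bar>s\<bar> \<le> 1 \<longrightarrow> (\<integral>\<^sup>+x. ennreal (exp (s * x)) \<partial>S) \<le> ennreal C)" for n
    by (rule centred_compound_poisson_exists[of "inverse (real (Suc n))" "A n"])
       (auto simp: A_def C_def)
  then obtain S where S: "\<And>n. real_distribution (S n)"
    "\<And>n z. char (S n) z = exp (CLINT y|\<nu>. indicator (A n) y *\<^sub>R ?f z y)"
    "\<And>n s. \<bar>s\<bar> \<le> 1 \<Longrightarrow> (\<integral>\<^sup>+x. ennreal (exp (s * x)) \<partial>S n) \<le> ennreal C"
    by metis
  have "tight S" using S(1,3) by (rule tight_if_exp_moments_bounded)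
  from tight_imp_convergent_subsubsequence[OF this strict_mono_id]
  obtain k M where k: "strict_mono (k :: nat \<Rightarrow> nat)" and M: "real_distribution M"
    and conv: "weak_conv_m (S \<circ> k) M" by (auto simp: id_def comp_def)
  show thesis
  proof (rule that[OF M])
    fix z
    have lim: "(\<lambda>n. CLINT y|\<nu>. indicator (A n) y *\<^sub>R ?f z y) \<longlonglongrightarrow> (CLINT y|\<nu>. indicator {-1..1} y *\<^sub>R ?f z y)"
    proof (rule integral_dominated_convergence[where w="\<lambda>y. z\<^sup>2 * min 1 (y\<^sup>2)"])
      show "AE y in \<nu>. (\<lambda>n. indicator (A n) y *\<^sub>R ?f z y) \<longlonglongrightarrow> indicator {-1..1} y *\<^sub>R ?f z y"
      proof (rule AE_I2)
        fix y :: real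
        show "(\<lambda>n. indicator (A n) y *\<^sub>R ?f z y) \<longlonglongrightarrow> indicator {-1..1} y *\<^sub>R ?f z y"
        proof (cases "y = 0")
          case False
          then obtain N where N: "inverse (real (Suc N)) < \<bar>y\<bar>"
            using reals_Archimedean[of "\<bar>y\<bar>"] by auto
          have "indicator (A n) y = (indicator {-1..1} y :: real)" if "N \<le> n" for n
          proof -
            have "inverse (real (Suc n)) \<le> inverse (real (Suc N))" using that by (simp add: field_simps)
            then have "inverse (real (Suc n)) \<le> \<bar>y\<bar>" using N by linarith
            then show ?thesis by (auto simp: A_def indicator_def simp del: of_nat_Suc)
          qed
          then show ?thesis
            by (intro tendsto_eventually eventually_sequentiallyI[of N]) simp
        qed simp
      qed
      show "AE y in \<nu>. norm (indicator (A n) y *\<^sub>R ?f z y) \<le> z\<^sup>2 * min 1 (y\<^sup>2)" for n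
      proof (rule AE_I2)
        fix y :: real
        show "norm (indicator (A n) y *\<^sub>R ?f z y) \<le> z\<^sup>2 * min 1 (y\<^sup>2)"
        proof (cases "y \<in> A n")
          case True
          then have "y\<^sup>2 \<le> 1" by (simp add: A_def abs_square_le_1)
          then show ?thesis using True iexp_quadratic_bound[of z y] by simp
        qed auto
      qed
      show "integrable \<nu> (\<lambda>y. z\<^sup>2 * min 1 (y\<^sup>2))"
        by (intro integrable_mult_right integrable_min_levy)
    qed measurable
    have "(\<lambda>n. char ((S \<circ> k) n) z) \<longlonglongrightarrow> char M z"
      by (rule levy_continuity1[OF _ M conv]) (simp add: S)
    moreover have "(\<lambda>n. char ((S \<circ> k) n) z) \<longlonglongrightarrow> exp (CLINT y|\<nu>. indicator {-1..1} y *\<^sub>R ?f z y)"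
      using LIMSEQ_subseq_LIMSEQ[OF tendsto_exp[OF lim] k] by (simp add: S(2) comp_def)
    ultimately show "char M z = exp (CLINT y|\<nu>. indicator {-1..1} y *\<^sub>R ?f z y)"
      by (rule LIMSEQ_unique)
  next
    have "(\<integral>\<^sup>+x. ennreal (exp x) \<partial>M) \<le> ennreal C"
      by (rule exp_moment_weak_limit[OF _ M conv]) (use S(1) S(3)[of 1] in auto)
    also have "\<dots> < \<infinity>" by simp
    finally show "(\<integral>\<^sup>+x. ennreal (exp x) \<partial>M) < \<infinity>" .
  qed
qed

end

lemma scaled_normal_exists:
  obtains G where "real_distribution G"
    "\<And>z. char G z = exp (- complex_of_real (b\<^sup>2 * z\<^sup>2 / 2))"
    "(\<integral>\<^sup>+x. ennreal (exp x) \<partial>G) < \<infinity>"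
proof -
  interpret N: real_distribution std_normal_distribution by (rule real_dist_normal_dist)
  have m: "(\<lambda>x. b * x) \<in> borel_measurable std_normal_distribution"
    by (intro borel_measurable_times borel_measurable_const measurable_ident_sets[OF N.events_eq_borel])
  define G where "G = distr std_normal_distribution borel (\<lambda>x. b * x)"
  show thesis
  proof (rule that[of G])
    show "real_distribution G" unfolding G_def by (rule N.real_distribution_distr[OF m])
    show "char G z = exp (- complex_of_real (b\<^sup>2 * z\<^sup>2 / 2))" for z
    proof -
      have "char G z = char std_normal_distribution (z * b)"
        unfolding G_def char_def by (subst integral_distr[OF m]) (auto simp: mult.assoc)
      also have "\<dots> = exp (- complex_of_real (b\<^sup>2 * z\<^sup>2 / 2))"
        by (simp add: char_std_normal_distribution exp_of_real[symmetric] power_mult_distrib mult.commute)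
      finally show ?thesis .
    qed
    have eq: "std_normal_density x * exp (b * x) = exp (b\<^sup>2 / 2) * normal_density b 1 x" for x
    proof -
      have "exp (- x\<^sup>2 / 2) * exp (b * x) = exp (b\<^sup>2 / 2) * exp (- (x - b)\<^sup>2 / 2)"
        by (simp add: exp_add[symmetric] power2_eq_square field_simps)
      then show ?thesis by (simp add: normal_density_def)
    qed
    have "(\<integral>\<^sup>+x. ennreal (exp x) \<partial>G) = (\<integral>\<^sup>+x. ennreal (exp (b * x)) \<partial>std_normal_distribution)"
      unfolding G_def by (subst nn_integral_distr[OF m]) auto
    also have "\<dots> = (\<integral>\<^sup>+x. ennreal (exp (b\<^sup>2 / 2)) * ennreal (normal_density b 1 x) \<partial>lborel)"
    proof (subst nn_integral_density)
      show "(\<lambda>x. ennreal (exp (b * x))) \<in> borel_measurable lborel"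
        unfolding measurable_lborel2 by measurable
    qed (auto simp: ennreal_mult'[symmetric] eq measurable_ident_sets[OF sets_lborel])
    also have "\<dots> = ennreal (exp (b\<^sup>2 / 2)) * (\<integral>\<^sup>+x. ennreal (normal_density b 1 x) \<partial>lborel)"
      by (rule nn_integral_cmult) measurable
    also have "(\<integral>\<^sup>+x. ennreal (normal_density b 1 x) \<partial>lborel) = 1"
      using prob_space.emeasure_space_1[OF prob_space_normal_density[of 1 b]] by (simp add: emeasure_density)
    finally show "(\<integral>\<^sup>+x. ennreal (exp x) \<partial>G) < \<infinity>" by simp
  qed
qed


text \<open>
  One exponential moment makes the right tail negligible, since long-tailed functions decay more
  slowly than any exponential.
\<close>

definition light_right_tail :: "real measure \<Rightarrow> bool" where
  "light_right_tail M \<longleftrightarrow> real_distribution M \<and> (\<integral>\<^sup>+x. ennreal (exp x) \<partial>M) < \<infinity>"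

lemma light_right_tail_convolution:
  assumes "light_right_tail M" "light_right_tail N"
  shows "light_right_tail (M \<star> N)"
  using assms nn_integral_exp_conv[of M N 1]
  by (auto simp: light_right_tail_def real_distribution_convolution ennreal_mult_less_top)

text \<open>
  \<open>t P(dt)\<close> is the convolution of \<open>P\<close> with the measure \<open>u k(u) du\<close>; this characterises, among laws on
  the half-line, the compound Poisson laws with jump density \<open>k\<close> when \<open>k\<close> lives on \<open>(0,\<infinity>)\<close> and
  is integrable.
\<close>

definition size_bias_identity :: "real measure \<Rightarrow> (real \<Rightarrow> real) \<Rightarrow> bool" where
  "size_bias_identity P k \<longleftrightarrow> real_distribution P \<and> (AE x in P. 0 \<le> x) \<and>
     (\<forall>h\<in>borel_measurable borel. (\<integral>\<^sup>+t. ennreal t * h t \<partial>P) =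
        (\<integral>\<^sup>+u. ennreal (u * k u) * (\<integral>\<^sup>+v. h (u + v) \<partial>P) \<partial>lborel))"

text \<open>
  The Levy measure is split at \<open>-1\<close> and \<open>1\<close>. Jumps above \<open>1\<close> form \<open>P\<close>. The factor \<open>M\<close> is the
  convolution of the drift, a normal law, the compensated small jumps and the jumps below \<open>-1\<close>; none
  of them has a heavy right tail. The product of the characteristic functions is that of \<open>\<mu>\<close>.
\<close>

theorem Levy_Khintchine_decomposition:
  assumes \<mu>: "real_distribution \<mu>" and lk: "levy_khintchine \<mu> a b \<nu>"
    and \<nu>: "\<nu> = density lborel (\<lambda>x. ennreal (g x))" and g[measurable]: "g \<in> borel_measurable borel"
    and g0: "\<And>x. 0 \<le> g x"
  obtains P M where "size_bias_identity P (\<lambda>x. g x * indicator {1<..} x)" "light_right_tail M" "\<mu> = (P \<star> M)"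
proof -
  have levy: "levy_measure \<nu>" and char: "\<And>z. char \<mu> z = exp (levy_exponent a b \<nu> z)"
    using lk by (auto simp: levy_khintchine_def)
  note [measurable_cong] = sets_levy[OF levy]
  have finP: "finite_measure (restr \<nu> {1<..})" and finN: "finite_measure (restr \<nu> {..<-1})"
    by (rule finite_measure_restr[OF levy, of 1]; auto)+
  have setsr: "sets (restr \<nu> A) = sets borel" for A by (simp add: sets_levy[OF levy])
  obtain P where P: "real_distribution P" "\<And>z. char P z = exp (CLINT u|restr \<nu> {1<..}. iexp (z * u) - 1)"
    "\<And>s. integrable (restr \<nu> {1<..}) (\<lambda>u. exp (s * u)) \<Longrightarrow>
      (\<integral>\<^sup>+x. ennreal (exp (s * x)) \<partial>P) = ennreal (exp (\<integral>u. exp (s * u) - 1 \<partial>restr \<nu> {1<..}))"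
    "AE u in restr \<nu> {1<..}. 0 \<le> u \<Longrightarrow> AE x in P. 0 \<le> x"
    "\<And>h. AE u in restr \<nu> {1<..}. 0 \<le> u \<Longrightarrow> h \<in> borel_measurable borel \<Longrightarrow>
      (\<integral>\<^sup>+t. ennreal t * h t \<partial>P) = (\<integral>\<^sup>+u. ennreal u * (\<integral>\<^sup>+v. h (u + v) \<partial>P) \<partial>restr \<nu> {1<..})"
    by (rule compound_poisson_exists[OF finP setsr], rule that; assumption)
  obtain N where N: "real_distribution N" "\<And>z. char N z = exp (CLINT u|restr \<nu> {..<-1}. iexp (z * u) - 1)"
    "\<And>s. integrable (restr \<nu> {..<-1}) (\<lambda>u. exp (s * u)) \<Longrightarrow>
      (\<integral>\<^sup>+x. ennreal (exp (s * x)) \<partial>N) = ennreal (exp (\<integral>u. exp (s * u) - 1 \<partial>restr \<nu> {..<-1}))"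
    "AE u in restr \<nu> {..<-1}. 0 \<le> u \<Longrightarrow> AE x in N. 0 \<le> x"
    "\<And>h. AE u in restr \<nu> {..<-1}. 0 \<le> u \<Longrightarrow> h \<in> borel_measurable borel \<Longrightarrow>
      (\<integral>\<^sup>+t. ennreal t * h t \<partial>N) = (\<integral>\<^sup>+u. ennreal u * (\<integral>\<^sup>+v. h (u + v) \<partial>N) \<partial>restr \<nu> {..<-1})"
    by (rule compound_poisson_exists[OF finN setsr], rule that; assumption)
  obtain S where S: "real_distribution S"
    "\<And>z. char S z = exp (CLINT y|\<nu>. indicator {-1..1} y *\<^sub>R (iexp (z * y) - 1 - \<i> * complex_of_real (z * y)))"
    "(\<integral>\<^sup>+x. ennreal (exp x) \<partial>S) < \<infinity>"
    by (rule small_jumps_exists[OF levy], rule that; assumption)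
  obtain G where G: "real_distribution G" "\<And>z. char G z = exp (- complex_of_real (b\<^sup>2 * z\<^sup>2 / 2))"
    "(\<integral>\<^sup>+x. ennreal (exp x) \<partial>G) < \<infinity>"
    by (rule scaled_normal_exists, rule that; assumption)
  define M where "M = (return borel a \<star> (G \<star> (S \<star> N)))"
  note rd = real_distribution_convolution real_distribution_return P(1) N(1) S(1) G(1)
  have "integrable (restr \<nu> {..<-1}) (\<lambda>u. exp (1 * u))"
    by (rule finite_measure.integrable_const_bound[OF finN, where B=1])
       (auto simp: AE_density indicator_def measurable_cong_sets[OF sets_levy[OF levy] refl])
  then have "light_right_tail N"
    using N(3)[of 1] by (simp add: light_right_tail_def N)
  then have M: "light_right_tail M"
    unfolding M_def using S G rd
    by (intro light_right_tail_convolution) (auto simp: light_right_tail_def nn_integral_return)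
  have AE: "AE u in restr \<nu> {1<..}. 0 \<le> u"
    by (subst AE_density) (auto simp: indicator_def)
  have sb: "size_bias_identity P (\<lambda>x. g x * indicator {1<..} x)"
    unfolding size_bias_identity_def
  proof (intro conjI ballI P(1) P(4)[OF AE])
    interpret P: real_distribution P by (rule P)
    fix h :: "real \<Rightarrow> ennreal" assume h[measurable]: "h \<in> borel_measurable borel"
    have "(\<integral>\<^sup>+t. ennreal t * h t \<partial>P) = (\<integral>\<^sup>+u. ennreal u * (\<integral>\<^sup>+v. h (u + v) \<partial>P) \<partial>restr \<nu> {1<..})"
      by (rule P(5)[OF AE h])
    also have "restr \<nu> {1<..} = density lborel (\<lambda>x. ennreal (g x) * ennreal (indicator {1<..} x))"
      unfolding \<nu> by (rule density_density_eq) measurable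
    also have "(\<integral>\<^sup>+u. ennreal u * (\<integral>\<^sup>+v. h (u + v) \<partial>P) \<partial>\<dots>) =
      (\<integral>\<^sup>+u. ennreal (g u) * ennreal (indicator {1<..} u) * (ennreal u * (\<integral>\<^sup>+v. h (u + v) \<partial>P)) \<partial>lborel)"
      by (rule nn_integral_density) measurable
    also have "\<dots> = (\<integral>\<^sup>+u. ennreal (u * (g u * indicator {1<..} u)) * (\<integral>\<^sup>+v. h (u + v) \<partial>P) \<partial>lborel)"
      by (intro nn_integral_cong)
         (auto simp: indicator_def ennreal_mult g0 mult_ac)
    finally show "(\<integral>\<^sup>+t. ennreal t * h t \<partial>P) =
        (\<integral>\<^sup>+u. ennreal (u * (g u * indicator {1<..} u)) * (\<integral>\<^sup>+v. h (u + v) \<partial>P) \<partial>lborel)" .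
  qed
  have "char \<mu> z = char (P \<star> M) z" for z
  proof -
    let ?I = "\<lambda>y. iexp (z * y) - 1 - \<i> * complex_of_real (z * y * indicator {y. \<bar>y\<bar> \<le> 1} y)"
    let ?p = "\<lambda>y. indicator {1<..} y *\<^sub>R (iexp (z * y) - 1)"
    let ?n = "\<lambda>y. indicator {..<-1} y *\<^sub>R (iexp (z * y) - 1)"
    let ?s = "\<lambda>y. indicator {-1..1} y *\<^sub>R (iexp (z * y) - 1 - \<i> * complex_of_real (z * y))"
    have ip: "integrable \<nu> ?p" and in': "integrable \<nu> ?n"
      by (rule integrable_levy_away[OF levy, where d=1 and C=2];
          auto intro!: order.trans[OF norm_triangle_ineq4])+
    have is': "integrable \<nu> ?s"
    proof (rule integrable_levy_bound[OF levy, where C="z\<^sup>2"])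
      fix y :: real
      show "norm (?s y) \<le> z\<^sup>2 * min 1 (y\<^sup>2)"
      proof (cases "y \<in> {-1..1}")
        case True
        then have "\<bar>y\<bar> \<le> 1" by auto
        then have "y\<^sup>2 \<le> 1" by (simp add: abs_square_le_1)
        then show ?thesis using True iexp_quadratic_bound[of z y] by simp
      qed auto
    qed measurable
    have "(CLINT y|\<nu>. ?I y) = (CLINT y|\<nu>. ?p y + (?s y + ?n y))"
      by (intro Bochner_Integration.integral_cong refl) (auto simp: indicator_def)
    also have "\<dots> = (CLINT y|\<nu>. ?p y) + ((CLINT y|\<nu>. ?s y) + (CLINT y|\<nu>. ?n y))"
      using ip in' is' by simp
    finally have I: "(CLINT y|\<nu>. ?I y) = \<dots>" .
    have r: "(CLINT u|restr \<nu> A. iexp (z * u) - 1) = (CLINT y|\<nu>. indicator A y *\<^sub>R (iexp (z * y) - 1))"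
      if "A \<in> sets borel" for A
      by (rule integral_restr[OF levy _ that]) measurable
    show ?thesis
      unfolding char levy_exponent_def I M_def
      by (simp add: char_convolution rd char_return P(2) N(2) S(2) G(2) r mult_exp_exp
            del: real_scaleR_def of_real_mult of_real_divide of_real_power)
         (simp add: algebra_simps)
  qed
  then have "\<mu> = (P \<star> M)"
    by (intro Levy_uniqueness \<mu> ext) (auto simp: M_def rd)
  with sb M show thesis by (rule that)
qed

section \<open>Long-tailed and almost decreasing functions\<close>

text \<open>
  One half of \<open>\<sim>\<close>: for eventually positive functions, \<open>f \<sim> g\<close> is \<open>f \<preceq> g\<close> together with \<open>g \<preceq> f\<close>
  (\<open>asymp_equiv_iff_asymp_le\<close>). Upper and lower estimates can thus be proved, shifted and chained
  separately.
\<close>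

definition asymp_le :: "(real \<Rightarrow> real) \<Rightarrow> (real \<Rightarrow> real) \<Rightarrow> bool" (infix "\<preceq>" 50) where
  "f \<preceq> g \<longleftrightarrow> (\<forall>\<eta>>1. \<forall>\<^sub>F x in at_top. f x \<le> \<eta> * g x)"

lemma asymp_leD: "f \<preceq> g \<Longrightarrow> 1 < \<eta> \<Longrightarrow> \<forall>\<^sub>F x in at_top. f x \<le> \<eta> * g x"
  by (simp add: asymp_le_def)

lemma asymp_leI:
  assumes g: "\<And>x. 0 \<le> g x"
    and ev: "\<And>\<delta>. 0 < \<delta> \<Longrightarrow> \<delta> < 1 \<Longrightarrow> \<forall>\<^sub>F x in at_top. (1 - \<delta>) * f x \<le> (1 + \<delta>) * g x"
  shows "f \<preceq> g"
  unfolding asymp_le_def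
proof (intro allI impI)
  fix \<eta> :: real assume \<eta>: "1 < \<eta>"
  define \<delta> where "\<delta> = (\<eta> - 1) / (\<eta> + 1)"
  have \<delta>: "0 < \<delta>" "\<delta> < 1" using \<eta> by (auto simp: \<delta>_def)
  have eq: "1 + \<delta> = \<eta> * (1 - \<delta>)" using \<eta> by (simp add: \<delta>_def field_simps)
  from ev[OF \<delta>] show "\<forall>\<^sub>F x in at_top. f x \<le> \<eta> * g x"
  proof eventually_elim
    case (elim x)
    then have "(1 - \<delta>) * f x \<le> (1 - \<delta>) * (\<eta> * g x)" by (simp add: eq mult_ac)
    then show ?case using \<delta> by (simp add: mult_le_cancel_left)
  qed
qed

lemma asymp_le_refl:
  assumes "\<And>x. 0 \<le> f x" shows "f \<preceq> f"
  unfolding asymp_le_def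
proof (intro allI impI always_eventually)
  fix \<eta> x :: real assume "1 < \<eta>"
  then show "f x \<le> \<eta> * f x" using mult_right_mono[of 1 \<eta> "f x"] assms by simp
qed

lemma asymp_le_trans [trans]:
  assumes "f \<preceq> g" "g \<preceq> h" shows "f \<preceq> h"
  unfolding asymp_le_def
proof (intro allI impI)
  fix \<eta> :: real assume "1 < \<eta>"
  then have s: "1 < sqrt \<eta>" by simp
  from asymp_leD[OF assms(1) s] asymp_leD[OF assms(2) s]
  show "\<forall>\<^sub>F x in at_top. f x \<le> \<eta> * h x"
  proof eventually_elim
    case (elim x)
    have "f x \<le> sqrt \<eta> * g x" by (rule elim)
    also have "\<dots> \<le> sqrt \<eta> * (sqrt \<eta> * h x)" using elim s by (intro mult_left_mono) auto
    also have "\<dots> = \<eta> * h x" using s by (simp add: mult.assoc[symmetric])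
    finally show ?case .
  qed
qed

lemma eventually_at_top_shift:
  fixes t :: real
  assumes "\<forall>\<^sub>F x in at_top. Q x" shows "\<forall>\<^sub>F x in at_top. Q (x + t)"
proof -
  from assms obtain N where N: "\<And>x. N \<le> x \<Longrightarrow> Q x" by (auto simp: eventually_at_top_linorder)
  show ?thesis
    by (rule eventually_at_top_linorderI[of "N - t"]) (auto intro: N)
qed

lemma asymp_le_shift: "f \<preceq> g \<Longrightarrow> (\<lambda>x. f (x + t)) \<preceq> (\<lambda>x. g (x + t))"
  unfolding asymp_le_def by (auto dest: eventually_at_top_shift[where t=t])

lemma asymp_le_cmult: "f \<preceq> g \<Longrightarrow> 0 \<le> a \<Longrightarrow> (\<lambda>x. a * f x) \<preceq> (\<lambda>x. a * g x)"
  unfolding asymp_le_def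
proof (intro allI impI)
  fix \<eta> :: real assume *: "\<forall>\<eta>>1. \<forall>\<^sub>F x in at_top. f x \<le> \<eta> * g x" "0 \<le> a" "1 < \<eta>"
  then have "\<forall>\<^sub>F x in at_top. f x \<le> \<eta> * g x" by blast
  then show "\<forall>\<^sub>F x in at_top. a * f x \<le> \<eta> * (a * g x)"
  proof eventually_elim
    case (elim x)
    then have "a * f x \<le> a * (\<eta> * g x)" using *(2) by (rule mult_left_mono)
    then show ?case by (simp add: mult_ac)
  qed
qed

lemma asymp_le_cong:
  assumes "\<forall>\<^sub>F x in at_top. f x = f' x" "\<forall>\<^sub>F x in at_top. g x = g' x" "f \<preceq> g"
  shows "f' \<preceq> g'"
  unfolding asymp_le_def
proof (intro allI impI)
  fix \<eta> :: real assume "1 < \<eta>"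
  from asymp_leD[OF assms(3) this] assms(1,2)
  show "\<forall>\<^sub>F x in at_top. f' x \<le> \<eta> * g' x" by eventually_elim simp
qed

lemma bigo_iff_eventually_le:
  fixes f g :: "real \<Rightarrow> real"
  assumes "\<And>x. 0 \<le> f x" "\<And>x. 0 \<le> g x"
  shows "f \<in> O(g) \<longleftrightarrow> (\<exists>C>0. \<forall>\<^sub>F x in at_top. f x \<le> C * g x)"
  using assms unfolding bigo_def by simp

lemma asymp_le_imp_bigo:
  assumes "f \<preceq> g" "\<And>x. 0 \<le> f x" "\<And>x. 0 \<le> g x" shows "f \<in> O(g)"
  using asymp_leD[OF assms(1), of 2] by (subst bigo_iff_eventually_le) (auto simp: assms(2,3) intro!: exI[of _ 2])

lemma bigtheta_if_asymp_le:
  assumes "f \<preceq> (\<lambda>x. a * g x)" "(\<lambda>x. a * g x) \<preceq> f" "0 < a" "\<And>x. 0 \<le> f x" "\<And>x. 0 \<le> g x"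
  shows "f \<in> \<Theta>(g)"
  using asymp_le_imp_bigo[OF assms(1)] asymp_le_imp_bigo[OF assms(2)] assms(3-5)
  by (auto simp: bigtheta_def bigomega_iff_bigo)

lemma asymp_equiv_iff_asymp_le:
  assumes g: "\<forall>\<^sub>F x in at_top. 0 < g x"
  shows "f \<sim>[at_top] g \<longleftrightarrow> f \<preceq> g \<and> g \<preceq> f"
proof
  assume "f \<sim>[at_top] g"
  moreover have "\<forall>\<^sub>F x in at_top. f x \<noteq> 0 \<or> g x \<noteq> 0" using g by eventually_elim auto
  ultimately have lim: "((\<lambda>x. f x / g x) \<longlongrightarrow> 1) at_top"
    by (rule asymp_equivD_strong)
  have "\<forall>\<^sub>F x in at_top. f x \<le> \<eta> * g x" if "1 < \<eta>" for \<eta>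
    using order_tendstoD(2)[OF lim that] g
    by eventually_elim (simp add: field_simps)
  moreover have "\<forall>\<^sub>F x in at_top. g x \<le> \<eta> * f x" if \<eta>: "1 < \<eta>" for \<eta>
  proof -
    have "1 / \<eta> < 1" using \<eta> by simp
    from order_tendstoD(1)[OF lim this] g
    show ?thesis
    proof eventually_elim
      case (elim x)
      then show ?case using \<eta> by (simp add: field_simps)
    qed
  qed
  ultimately show "f \<preceq> g \<and> g \<preceq> f" by (simp add: asymp_le_def)
next
  assume le: "f \<preceq> g \<and> g \<preceq> f"
  have "((\<lambda>x. f x / g x) \<longlongrightarrow> 1) at_top"
  proof (rule order_tendstoI)
    fix a :: real assume a: "1 < a"
    define \<eta> where "\<eta> = (1 + a) / 2"
    have \<eta>: "1 < \<eta>" "\<eta> < a" using a by (auto simp: \<eta>_def)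
    from asymp_leD[OF conjunct1[OF le] \<eta>(1)] g
    show "\<forall>\<^sub>F x in at_top. f x / g x < a"
    proof eventually_elim
      case (elim x)
      then have "f x / g x \<le> \<eta>" by (simp add: field_simps)
      then show ?case using \<eta> by simp
    qed
  next
    fix a :: real assume a: "a < 1"
    define b where "b = (1 + max a 0) / 2"
    have b: "0 < b" "b < 1" "a < b" using a by (auto simp: b_def)
    then have "1 < 1 / b" by simp
    from asymp_leD[OF conjunct2[OF le] this] g
    show "\<forall>\<^sub>F x in at_top. a < f x / g x"
    proof eventually_elim
      case (elim x)
      then have "b \<le> f x / g x" using b by (simp add: field_simps)
      then show ?case using b by simp
    qed
  qed
  then show "f \<sim>[at_top] g" by (rule asymp_equivI')
qed

text \<open>
  One-sided comparison with all shifts, including negative ones, is the same as \<open>\<sim>\<close> for positive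
  shifts: the reverse comparison for \<open>t\<close> is the comparison for \<open>-t\<close>, shifted.
\<close>

lemma long_tailed_fun_iff:
  "\<phi> \<in> long_tailed_fun \<longleftrightarrow> \<phi> \<in> borel_measurable borel \<and> (\<forall>x. 0 \<le> \<phi> x) \<and>
     (\<forall>\<^sub>F x in at_top. 0 < \<phi> x) \<and> (\<forall>t. (\<lambda>x. \<phi> (x + t)) \<preceq> \<phi>)"
proof -
  have pos: "(\<exists>x0>0. \<forall>x\<ge>x0. 0 < \<phi> x) \<longleftrightarrow> (\<forall>\<^sub>F x in at_top. 0 < \<phi> x)"
    unfolding eventually_at_top_linorder
  proof safe
    fix N assume "\<forall>n\<ge>N. 0 < \<phi> n"
    then show "\<exists>x0>0. \<forall>x\<ge>x0. 0 < \<phi> x" by (intro exI[of _ "max N 1"]) auto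
  qed auto
  have "(\<forall>y>0. (\<lambda>x. \<phi> (x + y)) \<sim>[at_top] \<phi>) \<longleftrightarrow> (\<forall>t. (\<lambda>x. \<phi> (x + t)) \<preceq> \<phi>)"
    if nonneg: "\<forall>x. 0 \<le> \<phi> x" and ev: "\<forall>\<^sub>F x in at_top. 0 < \<phi> x"
  proof
    assume L: "\<forall>y>0. (\<lambda>x. \<phi> (x + y)) \<sim>[at_top] \<phi>"
    show "\<forall>t. (\<lambda>x. \<phi> (x + t)) \<preceq> \<phi>"
    proof
      fix t :: real
      consider "0 < t" | "t = 0" | "t < 0" by linarith
      then show "(\<lambda>x. \<phi> (x + t)) \<preceq> \<phi>"
      proof cases
        case 1 then show ?thesis using L asymp_equiv_iff_asymp_le[OF ev] by blast
      next
        case 2 then show ?thesis using nonneg by (simp add: asymp_le_refl)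
      next
        case 3
        then have "\<phi> \<preceq> (\<lambda>x. \<phi> (x + (- t)))"
          using L asymp_equiv_iff_asymp_le[OF ev] by (metis neg_0_less_iff_less)
        from asymp_le_shift[OF this, of t] show ?thesis by simp
      qed
    qed
  next
    assume R: "\<forall>t. (\<lambda>x. \<phi> (x + t)) \<preceq> \<phi>"
    show "\<forall>y>0. (\<lambda>x. \<phi> (x + y)) \<sim>[at_top] \<phi>"
    proof (intro allI impI)
      fix y :: real
      have "\<phi> \<preceq> (\<lambda>x. \<phi> (x + y))"
        using asymp_le_shift[OF R[rule_format, of "- y"], of y] by simp
      with R show "(\<lambda>x. \<phi> (x + y)) \<sim>[at_top] \<phi>"
        by (simp add: asymp_equiv_iff_asymp_le[OF ev])
    qed
  qed
  then show ?thesis unfolding long_tailed_fun_def mem_Collect_eq pos by blast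
qed

lemma long_tailedD:
  assumes "\<phi> \<in> long_tailed_fun"
  shows "\<phi> \<in> borel_measurable borel" "0 \<le> \<phi> x" "\<forall>\<^sub>F x in at_top. 0 < \<phi> x" "(\<lambda>x. \<phi> (x + t)) \<preceq> \<phi>"
  using assms by (auto simp: long_tailed_fun_iff)

lemma long_tailed_preceq_shift:
  assumes "\<phi> \<in> long_tailed_fun" shows "\<phi> \<preceq> (\<lambda>x. \<phi> (x + t))"
  using asymp_le_shift[OF long_tailedD(4)[OF assms, of "- t"], of t] by simp

lemma long_tailed_transfer:
  assumes \<phi>: "\<phi> \<in> long_tailed_fun" and \<psi>: "\<psi> \<in> borel_measurable borel" "\<And>x. 0 \<le> \<psi> x"
    and le: "\<phi> \<preceq> \<psi>" "\<psi> \<preceq> \<phi>"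
  shows "\<psi> \<in> long_tailed_fun"
  unfolding long_tailed_fun_iff
proof (intro conjI allI \<psi>)
  have "(1::real) < 2" by simp
  from asymp_leD[OF le(1) this] long_tailedD(3)[OF \<phi>]
  show "\<forall>\<^sub>F x in at_top. 0 < \<psi> x" by eventually_elim auto
  fix t
  have "(\<lambda>x. \<psi> (x + t)) \<preceq> (\<lambda>x. \<phi> (x + t))" by (rule asymp_le_shift[OF le(2)])
  also have "(\<lambda>x. \<phi> (x + t)) \<preceq> \<phi>" by (rule long_tailedD[OF \<phi>])
  also have "\<phi> \<preceq> \<psi>" by (rule le)
  finally show "(\<lambda>x. \<psi> (x + t)) \<preceq> \<psi>" .
qed

lemma long_tailed_cmult:
  assumes "\<phi> \<in> long_tailed_fun" "0 < a"
  shows "(\<lambda>x. a * \<phi> x) \<in> long_tailed_fun"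
  using assms asymp_le_cmult[of _ \<phi> a] by (auto simp: long_tailed_fun_iff elim: eventually_mono)

text \<open>
  The argument may move by an amount that depends on the accuracy \<open>\<delta>\<close>, as long as one of the two
  functions is long-tailed and can absorb the shift.
\<close>

lemma asymp_leI_shift:
  assumes lt: "f \<in> long_tailed_fun \<or> g \<in> long_tailed_fun" and f: "\<And>x. 0 \<le> f x" and g: "\<And>x. 0 \<le> g x"
    and ev: "\<And>\<delta>. 0 < \<delta> \<Longrightarrow> \<delta> < 1 \<Longrightarrow> \<exists>D. \<forall>\<^sub>F x in at_top. (1 - \<delta>) * f (x + D) \<le> (1 + \<delta>) * g x"
  shows "f \<preceq> g"
proof (rule asymp_leI[OF g])
  fix \<delta> :: real assume \<delta>: "0 < \<delta>" "\<delta> < 1"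
  define \<eta> where "\<eta> = \<delta> / 4"
  have \<eta>: "0 < \<eta>" "\<eta> < 1" "\<eta> \<le> \<delta>" using \<delta> by (auto simp: \<eta>_def)
  have "\<delta> * \<delta> \<le> \<delta>" using \<delta> by (simp add: mult_left_le)
  then have sq: "(1 + \<eta>) * (1 + \<eta>) \<le> 1 + \<delta>" using \<delta> by (simp add: \<eta>_def field_simps)
  obtain D where D: "\<forall>\<^sub>F x in at_top. (1 - \<eta>) * f (x + D) \<le> (1 + \<eta>) * g x"
    using ev[OF \<eta>(1,2)] by blast
  have fin: "(1 - \<delta>) * f x \<le> (1 + \<delta>) * g x" if "(1 - \<eta>) * f x \<le> (1 + \<eta>) * ((1 + \<eta>) * g x)" for x
  proof -
    have "(1 - \<delta>) * f x \<le> (1 - \<eta>) * f x" using f \<eta> by (intro mult_right_mono) auto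
    also note that
    also have "(1 + \<eta>) * ((1 + \<eta>) * g x) \<le> (1 + \<delta>) * g x" using mult_right_mono[OF sq g[of x]] by simp
    finally show ?thesis .
  qed
  from lt show "\<forall>\<^sub>F x in at_top. (1 - \<delta>) * f x \<le> (1 + \<delta>) * g x"
  proof
    assume "f \<in> long_tailed_fun"
    then have "f \<preceq> (\<lambda>x. f (x + D))" by (rule long_tailed_preceq_shift)
    from D asymp_leD[OF this, of "1 + \<eta>"] \<eta> have "\<forall>\<^sub>F x in at_top. (1 - \<eta>) * f (x + D) \<le> (1 + \<eta>) * g x \<and>
        f x \<le> (1 + \<eta>) * f (x + D)" by (simp add: eventually_conj_iff)
    then show ?thesis
    proof eventually_elim
      case (elim x)
      have "(1 - \<eta>) * f x \<le> (1 + \<eta>) * ((1 - \<eta>) * f (x + D))"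
        using elim \<eta> mult_left_mono[of "f x" "(1 + \<eta>) * f (x + D)" "1 - \<eta>"] by (simp add: mult_ac)
      also have "\<dots> \<le> (1 + \<eta>) * ((1 + \<eta>) * g x)" using elim \<eta> by (intro mult_left_mono) auto
      finally show ?case by (rule fin)
    qed
  next
    assume "g \<in> long_tailed_fun"
    then have "\<forall>\<^sub>F x in at_top. g (x + - D) \<le> (1 + \<eta>) * g x"
      using \<eta> by (intro asymp_leD long_tailedD(4)) auto
    with eventually_at_top_shift[OF D, of "- D"] show ?thesis
    proof eventually_elim
      case (elim x)
      have "(1 - \<eta>) * f x \<le> (1 + \<eta>) * g (x + - D)" using elim by simp
      also have "\<dots> \<le> (1 + \<eta>) * ((1 + \<eta>) * g x)" using elim \<eta> by (intro mult_left_mono) auto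
      finally show ?case by (rule fin)
    qed
  qed
qed

lemma asymp_leI_perturbed:
  assumes lt: "g \<in> long_tailed_fun"
    and ev: "\<And>\<delta>. 0 < \<delta> \<Longrightarrow> \<exists>B. \<forall>\<^sub>F x in at_top. f x \<le> \<delta> * g x + (1 + \<delta>) * g (x - B)"
  shows "f \<preceq> g"
  unfolding asymp_le_def
proof (intro allI impI)
  fix \<eta> :: real assume \<eta>: "1 < \<eta>"
  define \<delta> where "\<delta> = min 1 (\<eta> - 1) / 4"
  have \<delta>: "0 < \<delta>" "\<delta> \<le> 1" "1 + 4 * \<delta> \<le> \<eta>" using \<eta> by (auto simp: \<delta>_def)
  obtain B where B: "\<forall>\<^sub>F x in at_top. f x \<le> \<delta> * g x + (1 + \<delta>) * g (x - B)" using ev[OF \<delta>(1)] by blast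
  have "\<forall>\<^sub>F x in at_top. g (x + - B) \<le> (1 + \<delta>) * g x"
    using \<delta> lt by (intro asymp_leD long_tailedD(4)) auto
  with B show "\<forall>\<^sub>F x in at_top. f x \<le> \<eta> * g x"
  proof eventually_elim
    case (elim x)
    have "\<delta> * \<delta> \<le> \<delta>" using \<delta> by (simp add: mult_left_le)
    moreover have "(1 + \<delta>) * (1 + \<delta>) = 1 + 2 * \<delta> + \<delta> * \<delta>" by (simp add: algebra_simps)
    ultimately have "\<delta> + (1 + \<delta>) * (1 + \<delta>) \<le> \<eta>" using \<delta> by linarith
    from mult_right_mono[OF this long_tailedD(2)[OF lt, of x]]
    have "\<delta> * g x + (1 + \<delta>) * ((1 + \<delta>) * g x) \<le> \<eta> * g x" by (simp add: algebra_simps)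
    moreover have "(1 + \<delta>) * g (x - B) \<le> (1 + \<delta>) * ((1 + \<delta>) * g x)"
      using elim \<delta> by (intro mult_left_mono) auto
    ultimately show ?case using elim by linarith
  qed
qed

lemma almost_decreasing_bigtheta:
  assumes \<phi>: "almost_decreasing \<phi>" and nonneg: "\<And>x. 0 \<le> \<phi> x" "\<And>x. 0 \<le> \<psi> x" and \<psi>: "\<psi> \<in> \<Theta>(\<phi>)"
  shows "almost_decreasing \<psi>"
proof -
  obtain x0 K where K: "0 < K" and ad: "\<And>x y. x0 < x \<Longrightarrow> 0 < y \<Longrightarrow> \<phi> (x + y) \<le> K * \<phi> x"
    using \<phi> by (auto simp: almost_decreasing_def)
  obtain C C' where C: "0 < C" "0 < C'" and "\<forall>\<^sub>F x in at_top. \<psi> x \<le> C * \<phi> x" "\<forall>\<^sub>F x in at_top. \<phi> x \<le> C' * \<psi> x"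
    using \<psi> nonneg by (auto simp: bigtheta_def bigomega_iff_bigo bigo_iff_eventually_le)
  from eventually_conj[OF this(3,4)] obtain x1 where x1: "\<And>x. x1 \<le> x \<Longrightarrow> \<psi> x \<le> C * \<phi> x \<and> \<phi> x \<le> C' * \<psi> x"
    by (auto simp: eventually_at_top_linorder)
  show ?thesis
    unfolding almost_decreasing_def
  proof (intro exI conjI allI impI)
    show "0 < max 1 (max x0 x1)" "0 < C * K * C'" using K C by auto
    fix x y :: real assume x: "max 1 (max x0 x1) < x" and y: "0 < y"
    have "\<psi> (x + y) \<le> C * \<phi> (x + y)" using x1[of "x + y"] x y by auto
    also have "\<dots> \<le> C * (K * \<phi> x)" using ad[of x y] x y C by (intro mult_left_mono) auto
    also have "\<dots> \<le> C * (K * (C' * \<psi> x))" using x1[of x] x y C K by (intro mult_left_mono) auto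
    finally show "\<psi> (x + y) \<le> C * K * C' * \<psi> x" by (simp add: mult_ac)
  qed
qed

text \<open>
  A long-tailed almost decreasing function is bounded on the whole half-line \<open>[x - T,\<infinity>)\<close> by a
  multiple of its value at \<open>x\<close>. The order of quantifiers matters: \<open>K\<close> does not depend on \<open>T\<close>.
\<close>

lemma regular_backward_bound:
  assumes \<phi>: "\<phi> \<in> long_tailed_fun" and ad: "almost_decreasing \<phi>"
  shows "\<exists>K>0. \<forall>T. \<forall>\<^sub>F x in at_top. \<forall>y\<ge>x - T. \<phi> y \<le> K * \<phi> x"
proof -
  obtain x0 K where K: "0 < K" and ad: "\<And>x y. x0 < x \<Longrightarrow> 0 < y \<Longrightarrow> \<phi> (x + y) \<le> K * \<phi> x"
    using ad by (auto simp: almost_decreasing_def)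
  have "\<forall>\<^sub>F x in at_top. \<forall>y\<ge>x - T. \<phi> y \<le> (K * 2) * \<phi> x" for T
  proof -
    have "\<forall>\<^sub>F x in at_top. \<phi> (x + (- T - 1)) \<le> 2 * \<phi> x"
      using asymp_leD[OF long_tailedD(4)[OF \<phi>], of 2 "- T - 1"] by simp
    moreover have "\<forall>\<^sub>F x in at_top. x0 + T + 1 < x" by (rule eventually_gt_at_top)
    ultimately show ?thesis
    proof eventually_elim
      case (elim x)
      show ?case
      proof (intro allI impI)
        fix y assume y: "x - T \<le> y"
        have "\<phi> ((x - T - 1) + (y - (x - T - 1))) \<le> K * \<phi> (x - T - 1)"
          using elim y by (intro ad) auto
        also have "\<dots> \<le> K * (2 * \<phi> x)"
          using elim K by (intro mult_left_mono) (auto simp: algebra_simps)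
        finally show "\<phi> y \<le> K * 2 * \<phi> x" by simp
      qed
    qed
  qed
  with K show ?thesis by (intro exI[of _ "K * 2"]) auto
qed

section \<open>Self-convolutions with small middle part\<close>

lemma nn_integral_reflect:
  fixes x :: real
  assumes "f \<in> borel_measurable borel"
  shows "(\<integral>\<^sup>+u. f (x - u) \<partial>lborel) = (\<integral>\<^sup>+u. f u \<partial>lborel)"
  using nn_integral_real_affine[of f "- 1" x] assms by simp

text \<open>
  A finite total mass is nearly attained on bounded intervals; \<open>ennreal\<close> sends negative numbers to \<open>0\<close>,
  which covers the case \<open>Q < \<epsilon>\<close>.
\<close>

lemma nn_integral_mass_below:
  fixes f :: "real \<Rightarrow> ennreal"
  assumes [measurable]: "f \<in> borel_measurable M" "sets M = sets borel" and Q: "(\<integral>\<^sup>+x. f x \<partial>M) = ennreal Q" and \<epsilon>: "0 < \<epsilon>"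
  obtains B0 where "\<And>B. B0 \<le> B \<Longrightarrow> ennreal (Q - \<epsilon>) \<le> (\<integral>\<^sup>+x. f x * indicator {-B..<B} x \<partial>M)"
proof -
  have [measurable_cong]: "sets M = sets borel" by fact
  have "(\<integral>\<^sup>+x. f x \<partial>M) = (SUP n. \<integral>\<^sup>+x. f x * indicator {- real n..<real n} x \<partial>M)"
  proof (subst nn_integral_monotone_convergence_SUP[symmetric])
    show "incseq (\<lambda>n x. f x * indicator {- real n..<real n} x)"
      by (auto simp: incseq_def le_fun_def intro!: mult_left_mono indicator_leI)
    show "(\<integral>\<^sup>+x. f x \<partial>M) = (\<integral>\<^sup>+x. (SUP n. f x * indicator {- real n..<real n} x) \<partial>M)"
    proof (rule nn_integral_cong)
      fix x :: real
      obtain n where n: "\<bar>x\<bar> < real n" using reals_Archimedean2 by blast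
      then have "f x \<le> f x * indicator {- real n..<real n} x" by (auto simp: indicator_def)
      also have "\<dots> \<le> (SUP n. f x * indicator {- real n..<real n} x)" by (rule SUP_upper) simp
      finally show "f x = (SUP n. f x * indicator {- real n..<real n} x)"
        by (intro antisym SUP_least) (auto simp: indicator_def)
    qed
  qed measurable
  then have sup: "(SUP n. \<integral>\<^sup>+x. f x * indicator {- real n..<real n} x \<partial>M) = ennreal Q" using Q by simp
  show thesis
  proof (cases "Q \<le> \<epsilon>")
    case True
    then show thesis by (intro that[of 0]) (simp add: ennreal_neg)
  next
    case False
    then have "ennreal (Q - \<epsilon>) < (SUP n. \<integral>\<^sup>+x. f x * indicator {- real n..<real n} x \<partial>M)"
      unfolding sup using \<epsilon> by (simp add: ennreal_less_iff)
    then obtain n where n: "ennreal (Q - \<epsilon>) < (\<integral>\<^sup>+x. f x * indicator {- real n..<real n} x \<partial>M)"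
      by (auto simp: less_SUP_iff)
    show thesis
    proof (rule that[of "real n"])
      fix B assume "real n \<le> B"
      then have "(\<integral>\<^sup>+x. f x * indicator {- real n..<real n} x \<partial>M) \<le> (\<integral>\<^sup>+x. f x * indicator {-B..<B} x \<partial>M)"
        by (intro nn_integral_mono mult_left_mono) (auto simp: indicator_def)
      with n show "ennreal (Q - \<epsilon>) \<le> (\<integral>\<^sup>+x. f x * indicator {-B..<B} x \<partial>M)" by simp
    qed
  qed
qed

text \<open>
  The part of the convolution integral at \<open>x\<close> where both arguments are at least \<open>B\<close>; it is \<open>0\<close> if
  \<open>x < 2 B\<close>.
\<close>

definition middle :: "(real \<Rightarrow> real) \<Rightarrow> (real \<Rightarrow> real) \<Rightarrow> real \<Rightarrow> real \<Rightarrow> ennreal" where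
  "middle \<phi> \<psi> B x = (\<integral>\<^sup>+u. ennreal (\<phi> (x - u) * \<psi> u) * indicator {B..x - B} u \<partial>lborel)"

text \<open>
  The bound is required for every \<open>x\<close> and not only for large \<open>x\<close>. Nothing is lost
  (\<open>small_middleI\<close>), since the middle part is empty for \<open>x < 2 B\<close>, and \<open>B\<close> can then be chosen
  before \<open>x\<close>.
\<close>

definition small_middle :: "(real \<Rightarrow> real) \<Rightarrow> bool" where
  "small_middle \<phi> \<longleftrightarrow> (\<forall>\<epsilon>>0. \<exists>B0. \<forall>B\<ge>B0. \<forall>x. middle \<phi> \<phi> B x \<le> ennreal (\<epsilon> * \<phi> x))"

lemma middle_empty: "x < 2 * B \<Longrightarrow> middle \<phi> \<psi> B x = 0"
  by (simp add: middle_def)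

lemma middle_antimono: "B \<le> B' \<Longrightarrow> middle \<phi> \<psi> B' x \<le> middle \<phi> \<psi> B x"
  unfolding middle_def
  by (intro nn_integral_mono mult_left_mono) (auto simp: indicator_def)

lemma middle_mono:
  assumes "0 \<le> a" "\<phi>' \<in> borel_measurable borel" "\<psi>' \<in> borel_measurable borel"
    and le: "\<And>u. B \<le> u \<Longrightarrow> u \<le> x - B \<Longrightarrow> \<phi> (x - u) * \<psi> u \<le> a * (\<phi>' (x - u) * \<psi>' u)"
  shows "middle \<phi> \<psi> B x \<le> ennreal a * middle \<phi>' \<psi>' B x"
proof -
  note [measurable] = assms(2,3)
  have "middle \<phi> \<psi> B x \<le> (\<integral>\<^sup>+u. ennreal a * (ennreal (\<phi>' (x - u) * \<psi>' u) * indicator {B..x - B} u) \<partial>lborel)"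
    unfolding middle_def
    by (intro nn_integral_mono)
       (auto simp: indicator_def ennreal_mult'[symmetric] assms(1) intro!: ennreal_leI le)
  also have "\<dots> = ennreal a * middle \<phi>' \<psi>' B x"
    unfolding middle_def by (rule nn_integral_cmult) measurable
  finally show ?thesis .
qed

lemma small_middleI:
  assumes "\<And>\<epsilon>. 0 < \<epsilon> \<Longrightarrow> \<exists>B. \<forall>\<^sub>F x in at_top. middle \<phi> \<phi> B x \<le> ennreal (\<epsilon> * \<phi> x)"
  shows "small_middle \<phi>"
  unfolding small_middle_def
proof (intro allI impI)
  fix \<epsilon> :: real assume "0 < \<epsilon>"
  from assms[OF this] obtain B X where X: "\<And>x. X \<le> x \<Longrightarrow> middle \<phi> \<phi> B x \<le> ennreal (\<epsilon> * \<phi> x)"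
    by (auto simp: eventually_at_top_linorder)
  show "\<exists>B0. \<forall>B\<ge>B0. \<forall>x. middle \<phi> \<phi> B x \<le> ennreal (\<epsilon> * \<phi> x)"
  proof (intro exI[of _ "max B (X / 2)"] allI impI)
    fix B' x assume B': "max B (X / 2) \<le> B'"
    show "middle \<phi> \<phi> B' x \<le> ennreal (\<epsilon> * \<phi> x)"
    proof (cases "x < 2 * B'")
      case False
      then have "middle \<phi> \<phi> B x \<le> ennreal (\<epsilon> * \<phi> x)" using B' by (intro X) auto
      then show ?thesis using middle_antimono[of B B' \<phi> \<phi> x] B' by (auto intro: order.trans)
    qed (simp add: middle_empty)
  qed
qed

text \<open>
  Only the order of magnitude of the function matters, because both factors and the
  bound are evaluated at arguments of size at least \<open>B\<close>.
\<close>

lemma small_middle_bigtheta: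
  assumes sm: "small_middle \<phi>" and \<phi>: "\<phi> \<in> borel_measurable borel" "\<And>x. 0 \<le> \<phi> x" and nonneg: "\<And>x. 0 \<le> \<psi> x"
    and \<psi>: "\<psi> \<in> \<Theta>(\<phi>)"
  shows "small_middle \<psi>"
proof (rule small_middleI)
  obtain C C' where C: "0 < C" "0 < C'" and up: "\<forall>\<^sub>F x in at_top. \<psi> x \<le> C * \<phi> x"
    and lo: "\<forall>\<^sub>F x in at_top. \<phi> x \<le> C' * \<psi> x"
    using \<psi> \<phi>(2) nonneg by (auto simp: bigtheta_def bigomega_iff_bigo bigo_iff_eventually_le)
  fix \<epsilon> :: real assume \<epsilon>: "0 < \<epsilon>"
  define \<delta> where "\<delta> = \<epsilon> / (C * C * C')"
  have \<delta>: "0 < \<delta>" using \<epsilon> C by (simp add: \<delta>_def)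
  obtain B0 where B0: "\<And>B x. B0 \<le> B \<Longrightarrow> middle \<phi> \<phi> B x \<le> ennreal (\<delta> * \<phi> x)"
    using sm \<delta> unfolding small_middle_def by meson
  obtain x1 where x1: "\<And>x. x1 \<le> x \<Longrightarrow> \<psi> x \<le> C * \<phi> x"
    using up by (auto simp: eventually_at_top_linorder)
  define B where "B = max B0 x1"
  from lo have "\<forall>\<^sub>F x in at_top. middle \<psi> \<psi> B x \<le> ennreal (\<epsilon> * \<psi> x)"
  proof eventually_elim
    case (elim x)
    have "middle \<psi> \<psi> B x \<le> ennreal (C * C) * middle \<phi> \<phi> B x"
    proof (rule middle_mono)
      fix u assume "B \<le> u" "u \<le> x - B"
      then have "\<psi> (x - u) * \<psi> u \<le> (C * \<phi> (x - u)) * (C * \<phi> u)"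
        using C \<phi>(2) nonneg by (intro mult_mono x1) (auto simp: B_def)
      then show "\<psi> (x - u) * \<psi> u \<le> C * C * (\<phi> (x - u) * \<phi> u)" by (simp add: mult_ac)
    qed (use C \<phi> in auto)
    also have "\<dots> \<le> ennreal (C * C) * ennreal (\<delta> * \<phi> x)"
      by (intro mult_left_mono B0) (auto simp: B_def)
    also have "\<dots> = ennreal (C * C * \<delta> * \<phi> x)"
      using C \<delta> \<phi>(2)[of x] by (simp add: ennreal_mult[symmetric] mult.assoc)
    also have "\<dots> \<le> ennreal (C * C * \<delta> * (C' * \<psi> x))"
      using C \<delta> elim by (intro ennreal_leI mult_left_mono) auto
    also have "C * C * \<delta> * (C' * \<psi> x) = \<epsilon> * \<psi> x"
      using C by (simp add: \<delta>_def)
    finally show ?case .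
  qed
  then show "\<exists>B. \<forall>\<^sub>F x in at_top. middle \<psi> \<psi> B x \<le> ennreal (\<epsilon> * \<psi> x)" by blast
qed

section \<open>Local masses\<close>

definition window :: "real \<Rightarrow> real \<Rightarrow> real \<Rightarrow> ennreal" where
  "window c x t = indicator {x<..x + c} t"

lemma window_eq: "window c x t = (if x < t \<and> t \<le> x + c then 1 else 0)"
  by (auto simp: window_def indicator_def)

lemma measurable_window [measurable (raw)]:
  assumes "f \<in> borel_measurable M" "h \<in> borel_measurable M"
  shows "(\<lambda>z. window c (f z) (h z)) \<in> borel_measurable M"
  unfolding window_eq using assms by measurable

context
  fixes R :: "real measure" and c :: real
  assumes fin: "finite_measure R" and sets_R: "sets R = sets borel" and c: "0 < c"
  notes [measurable_cong] = sets_R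
begin

lemma ennreal_local_mass: "ennreal (local_mass c R x) = (\<integral>\<^sup>+t. window c x t \<partial>R)"
proof -
  interpret finite_measure R by (rule fin)
  have "(\<integral>\<^sup>+t. window c x t \<partial>R) = emeasure R {x<..x + c}"
    unfolding window_def by (rule nn_integral_indicator) (simp add: sets_R)
  then show ?thesis by (simp add: local_mass_def emeasure_eq_measure)
qed

lemma local_mass_nonneg: "0 \<le> local_mass c R x"
  by (simp add: local_mass_def)

lemma measurable_local_mass: "local_mass c R \<in> borel_measurable borel"
proof -
  interpret finite_measure R by (rule fin)
  have "(\<lambda>x. enn2real (\<integral>\<^sup>+t. window c x t \<partial>R)) \<in> borel_measurable borel" by measurable
  then show ?thesis
    unfolding ennreal_local_mass[symmetric] by (simp add: local_mass_nonneg)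
qed

lemma nn_integral_window: "(\<integral>\<^sup>+x. window c x t \<partial>lborel) = ennreal c"
proof -
  have "(\<integral>\<^sup>+x. window c x t \<partial>lborel) = (\<integral>\<^sup>+x. indicator {t - c..<t} x \<partial>lborel)"
    by (intro nn_integral_cong) (auto simp: window_eq indicator_def)
  then show ?thesis using c by simp
qed

lemma nn_integral_local_mass:
  "(\<integral>\<^sup>+x. ennreal (local_mass c R x) \<partial>lborel) = ennreal (c * measure R UNIV)"
proof -
  interpret finite_measure R by (rule fin)
  interpret pair_sigma_finite lborel R ..
  have "(\<integral>\<^sup>+x. ennreal (local_mass c R x) \<partial>lborel) = (\<integral>\<^sup>+x. \<integral>\<^sup>+t. window c x t \<partial>R \<partial>lborel)"
    by (simp add: ennreal_local_mass)
  also have "\<dots> = (\<integral>\<^sup>+t. \<integral>\<^sup>+x. window c x t \<partial>lborel \<partial>R)"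
    by (rule Fubini'[symmetric]) measurable
  also have "\<dots> = ennreal (c * measure R UNIV)"
    using c sets_eq_imp_space_eq[OF sets_R]
    by (simp add: nn_integral_window emeasure_eq_measure ennreal_mult)
  finally show ?thesis .
qed

lemma integrable_local_mass: "integrable lborel (local_mass c R)"
  by (rule integrableI_nonneg)
     (use measurable_local_mass in \<open>auto simp: local_mass_nonneg nn_integral_local_mass\<close>)

lemma local_mass_convolution:
  assumes "finite_measure S" "sets S = sets borel"
  shows "ennreal (local_mass c (R \<star> S) x) = (\<integral>\<^sup>+y. ennreal (local_mass c R (x - y)) \<partial>S)"
proof -
  interpret R: finite_measure R by (rule fin)
  interpret S: finite_measure S by fact
  note [measurable_cong] = assms(2)
  interpret pair_sigma_finite R S ..
  have RS: "finite_measure (R \<star> S)"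
    by (rule convolution_finite) (auto simp: fin assms sets_R)
  have "ennreal (local_mass c (R \<star> S) x) = (\<integral>\<^sup>+t. window c x t \<partial>(R \<star> S))"
    using RS by (simp add: local_mass_def window_def finite_measure.emeasure_eq_measure)
  also have "\<dots> = (\<integral>\<^sup>+v. \<integral>\<^sup>+y. window c x (v + y) \<partial>S \<partial>R)"
    by (rule nn_integral_convolution) (auto simp: fin assms sets_R)
  also have "\<dots> = (\<integral>\<^sup>+y. \<integral>\<^sup>+v. window c x (v + y) \<partial>R \<partial>S)"
    by (rule Fubini'[symmetric]) measurable
  also have "\<dots> = (\<integral>\<^sup>+y. ennreal (local_mass c R (x - y)) \<partial>S)"
    unfolding ennreal_local_mass by (intro nn_integral_cong) (auto simp: window_eq intro!: nn_integral_cong)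
  finally show ?thesis .
qed

end

lemma conv_power_2:
  assumes "real_distribution F" shows "conv_power F 2 = (F \<star> F)"
proof (rule Levy_uniqueness)
  show "char (conv_power F 2) = char (F \<star> F)"
    by (rule ext) (simp add: char_conv_power char_convolution assms power2_eq_square)
qed (auto intro: real_distribution_conv_power real_distribution_convolution assms)

text \<open>
  Writing one factor \<open>f(u)\<close> as an integral of \<open>1\<close> over the window \<open>(u,u + c]\<close> and integrating over \<open>u\<close> first
  turns the product into an average, over \<open>r\<close> in \<open>[0,c]\<close>, of the local mass of \<open>F \<star> F\<close> at \<open>x + r\<close>.
\<close>

lemma local_mass_self_convolution_le:
  assumes F: "real_distribution F" and c: "0 < c"
  defines "f \<equiv> local_mass c F"
  shows "(\<integral>\<^sup>+u. ennreal (f (x - u) * f u) \<partial>lborel) \<le>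
    (\<integral>\<^sup>+r. ennreal (local_mass c (F \<star> F) (x + r)) * indicator {0..c} r \<partial>lborel)"
proof -
  interpret F: real_distribution F by fact
  interpret pair_sigma_finite lborel F ..
  note fin = F.finite_measure_axioms and sets = F.events_eq_borel
  have [measurable]: "f \<in> borel_measurable borel" unfolding f_def by (rule measurable_local_mass[OF fin sets c])
  have f0: "0 \<le> f u" for u by (simp add: f_def local_mass_def)
  have "(\<integral>\<^sup>+u. ennreal (f (x - u) * f u) \<partial>lborel) = (\<integral>\<^sup>+u. \<integral>\<^sup>+t. ennreal (f (x - u)) * window c u t \<partial>F \<partial>lborel)"
    by (intro nn_integral_cong)
       (simp add: nn_integral_cmult ennreal_local_mass[OF fin sets c, symmetric] f_def[symmetric] ennreal_mult f0)
  also have "\<dots> = (\<integral>\<^sup>+t. \<integral>\<^sup>+u. ennreal (f (x - u)) * window c u t \<partial>lborel \<partial>F)"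
    by (rule Fubini'[symmetric]) measurable
  also have "\<dots> = (\<integral>\<^sup>+t. \<integral>\<^sup>+r. ennreal (f (x - (t - r))) * window c (t - r) t \<partial>lborel \<partial>F)"
    by (intro nn_integral_cong nn_integral_reflect[symmetric]) measurable
  also have "\<dots> \<le> (\<integral>\<^sup>+t. \<integral>\<^sup>+r. ennreal (f (x + r - t)) * indicator {0..c} r \<partial>lborel \<partial>F)"
    by (intro nn_integral_mono) (auto simp: window_eq indicator_def algebra_simps)
  also have "\<dots> = (\<integral>\<^sup>+r. \<integral>\<^sup>+t. ennreal (f (x + r - t)) * indicator {0..c} r \<partial>F \<partial>lborel)"
    by (rule Fubini') measurable
  also have "\<dots> = (\<integral>\<^sup>+r. ennreal (local_mass c (F \<star> F) (x + r)) * indicator {0..c} r \<partial>lborel)"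
    by (intro nn_integral_cong)
       (simp add: nn_integral_multc local_mass_convolution[OF fin sets c fin sets] f_def[symmetric])
  finally show ?thesis .
qed


text \<open>
  Averages of \<open>\<phi>\<close> over a bounded range of shifts behave like \<open>\<phi>\<close> times the total weight. Pointwise
  convergence of \<open>\<phi>(x + r) / \<phi>(x)\<close> is dominated by the bound of \<open>regular_backward_bound\<close>.
\<close>

lemma long_tailed_average_bounds:
  assumes \<phi>: "\<phi> \<in> long_tailed_fun" and ad: "almost_decreasing \<phi>"
    and w: "integrable lborel w" "\<And>r. 0 \<le> w r" "\<And>r. T < \<bar>r\<bar> \<Longrightarrow> w r = 0"
    and W: "(\<integral>r. w r \<partial>lborel) = W"
  shows "a < W \<Longrightarrow> \<forall>\<^sub>F x in at_top. ennreal (a * \<phi> x) \<le> (\<integral>\<^sup>+r. ennreal (\<phi> (x + r) * w r) \<partial>lborel)"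
    and "W < b \<Longrightarrow> \<forall>\<^sub>F x in at_top. (\<integral>\<^sup>+r. ennreal (\<phi> (x + r) * w r) \<partial>lborel) \<le> ennreal (b * \<phi> x)"
proof -
  note [measurable] = long_tailedD(1)[OF \<phi>]
  note \<phi>0 = long_tailedD(2)[OF \<phi>]
  have [measurable]: "w \<in> borel_measurable borel" using w(1) by auto
  obtain K where K: "0 < K" and bd: "\<And>T. \<forall>\<^sub>F x in at_top. \<forall>y\<ge>x - T. \<phi> y \<le> K * \<phi> x"
    using regular_backward_bound[OF \<phi> ad] by auto
  have dom: "\<forall>\<^sub>F x in at_top. 0 < \<phi> x \<and> (\<forall>r. \<bar>\<phi> (x + r) / \<phi> x * w r\<bar> \<le> K * w r)"
    using bd[of T] long_tailedD(3)[OF \<phi>]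
  proof eventually_elim
    case (elim x)
    have "\<bar>\<phi> (x + r) / \<phi> x * w r\<bar> \<le> K * w r" for r
    proof (cases "T < \<bar>r\<bar>")
      case False
      then have "\<phi> (x + r) \<le> K * \<phi> x" using elim by auto
      then have "\<phi> (x + r) / \<phi> x \<le> K" using elim by (simp add: field_simps)
      then show ?thesis
        using w(2)[of r] \<phi>0 mult_right_mono[of "\<phi> (x + r) / \<phi> x" K "w r"] by (simp add: abs_mult)
    qed (simp add: w(3))
    then show ?case using elim by blast
  qed
  define I where "I x = (\<integral>r. \<phi> (x + r) / \<phi> x * w r \<partial>lborel)" for x
  have lim: "(I \<longlongrightarrow> W) at_top"
    unfolding I_def W[symmetric]
  proof (rule integral_dominated_convergence_at_top[where w="\<lambda>r. K * w r"])
    show "AE r in lborel. ((\<lambda>x. \<phi> (x + r) / \<phi> x * w r) \<longlongrightarrow> w r) at_top"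
    proof (rule AE_I2)
      fix r
      have "(\<lambda>x. \<phi> (x + r)) \<sim>[at_top] \<phi>"
        using long_tailedD(4)[OF \<phi>, of r] long_tailed_preceq_shift[OF \<phi>, of r]
        by (simp add: asymp_equiv_iff_asymp_le[OF long_tailedD(3)[OF \<phi>]])
      then have "((\<lambda>x. \<phi> (x + r) / \<phi> x) \<longlongrightarrow> 1) at_top"
        by (rule asymp_equivD_strong) (use long_tailedD(3)[OF \<phi>] in \<open>auto elim: eventually_mono\<close>)
      from tendsto_mult_right[OF this, of "w r"]
      show "((\<lambda>x. \<phi> (x + r) / \<phi> x * w r) \<longlongrightarrow> w r) at_top" by simp
    qed
    show "\<forall>\<^sub>F x in at_top. AE r in lborel. norm (\<phi> (x + r) / \<phi> x * w r) \<le> K * w r"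
      using dom by eventually_elim auto
  qed (use w(1) in auto)
  have eq: "\<forall>\<^sub>F x in at_top. (\<integral>\<^sup>+r. ennreal (\<phi> (x + r) * w r) \<partial>lborel) = ennreal (I x * \<phi> x) \<and> 0 < \<phi> x"
    using dom
  proof eventually_elim
    case (elim x)
    have "integrable lborel (\<lambda>r. \<phi> (x + r) / \<phi> x * w r)"
      by (rule Bochner_Integration.integrable_bound[where f="\<lambda>r. K * w r"])
         (use w(1) K w(2) elim in auto)
    then have "ennreal (I x) = (\<integral>\<^sup>+r. ennreal (\<phi> (x + r) / \<phi> x * w r) \<partial>lborel)"
      unfolding I_def by (intro nn_integral_eq_integral[symmetric]) (auto simp: \<phi>0 w(2))
    then have "ennreal (\<phi> x) * ennreal (I x) = (\<integral>\<^sup>+r. ennreal (\<phi> x) * ennreal (\<phi> (x + r) / \<phi> x * w r) \<partial>lborel)"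
      by (simp add: nn_integral_cmult)
    also have "\<dots> = (\<integral>\<^sup>+r. ennreal (\<phi> (x + r) * w r) \<partial>lborel)"
      using elim by (intro nn_integral_cong) (simp add: ennreal_mult'[symmetric])
    finally show ?case using elim ennreal_mult''[of "\<phi> x" "I x"] by (simp add: mult.commute)
  qed
  show "\<forall>\<^sub>F x in at_top. ennreal (a * \<phi> x) \<le> (\<integral>\<^sup>+r. ennreal (\<phi> (x + r) * w r) \<partial>lborel)" if "a < W"
    using eq order_tendstoD(1)[OF lim that]
    by eventually_elim (auto intro!: ennreal_leI mult_right_mono)
  show "\<forall>\<^sub>F x in at_top. (\<integral>\<^sup>+r. ennreal (\<phi> (x + r) * w r) \<partial>lborel) \<le> ennreal (b * \<phi> x)" if "W < b"
    using eq order_tendstoD(2)[OF lim that]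
    by eventually_elim (auto intro!: ennreal_leI mult_right_mono)
qed

lemma ennreal_le_diffI:
  assumes "ennreal a + m \<le> ennreal b" "0 \<le> a"
  shows "m \<le> ennreal (b - a)"
proof (cases m)
  case (real r)
  then have "ennreal (a + r) \<le> ennreal b" using assms by (simp add: ennreal_plus)
  then have "a + r \<le> b \<or> a + r \<le> 0" by (auto simp: ennreal_le_iff2)
  then have "r \<le> b - a \<or> r = 0" using assms real by auto
  then show ?thesis using real by (auto intro: ennreal_leI)
qed (use assms in \<open>auto simp: top_unique\<close>)

text \<open>
  The total \<open>f * f\<close> is at most about \<open>2 c f(x)\<close>, by \<open>local_mass_self_convolution_le\<close> and membership in
  \<open>S_Delta\<close>. The ranges where one of the two arguments lies in \<open>[-B,B)\<close> already account for nearly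
  \<open>2 c f(x)\<close>, because \<open>\<integral> f = c\<close>. Hence only \<open>\<epsilon> f(x)\<close> is left for the middle part.
\<close>

lemma small_middle_if_S_Delta:
  assumes c: "0 < c" and F: "F \<in> S_Delta c" and ad: "almost_decreasing (local_mass c F)"
  shows "small_middle (local_mass c F)"
proof (rule small_middleI)
  define f where "f = local_mass c F"
  have rF: "real_distribution F" and lt: "f \<in> long_tailed_fun"
    and f2: "local_mass c (conv_power F 2) \<sim>[at_top] (\<lambda>x. 2 * f x)"
    using F by (auto simp: S_Delta_def L_Delta_def f_def)
  interpret F: real_distribution F by (rule rF)
  note fin = F.finite_measure_axioms and sets = F.events_eq_borel
  have ad: "almost_decreasing f" using ad by (simp add: f_def)
  note [measurable] = long_tailedD(1)[OF lt]
  have f0: "0 \<le> f x" for x by (rule long_tailedD(2)[OF lt])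
  have F1: "measure F UNIV = 1" using F.prob_space by simp
  fix \<epsilon> :: real assume \<epsilon>: "0 < \<epsilon>"
  \<comment> \<open>\<open>2 c (1 + \<delta>)\<^sup>2 - 2 (c - 2 \<delta>) \<le> \<delta> (6 c + 4)\<close> for \<open>\<delta> \<le> 1\<close>, which is the excess that must stay below \<open>\<epsilon>\<close>.\<close>
  define \<delta> where "\<delta> = min (min 1 (c / 2)) (\<epsilon> / (6 * c + 4))"
  have \<delta>: "0 < \<delta>" "\<delta> \<le> 1" "2 * \<delta> \<le> c" "\<delta> * (6 * c + 4) \<le> \<epsilon>"
  proof -
    have "\<delta> * (6 * c + 4) \<le> \<epsilon> / (6 * c + 4) * (6 * c + 4)"
      using c by (intro mult_right_mono) (auto simp: \<delta>_def)
    then show "\<delta> * (6 * c + 4) \<le> \<epsilon>" using c by simp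
  qed (use \<epsilon> c in \<open>auto simp: \<delta>_def\<close>)
  have total: "(\<integral>\<^sup>+x. ennreal (f x) \<partial>lborel) = ennreal c"
    unfolding f_def by (simp add: nn_integral_local_mass[OF fin sets c] F1)
  obtain B0 where B0: "\<And>B. B0 \<le> B \<Longrightarrow> ennreal (c - \<delta>) \<le> (\<integral>\<^sup>+x. ennreal (f x) * indicator {-B..<B} x \<partial>lborel)"
    using nn_integral_mass_below[of "\<lambda>x. ennreal (f x)" lborel c \<delta>] total \<delta>(1) by auto
  define B where "B = max B0 1"
  have B: "0 < B" by (simp add: B_def)
  have i2: "integrable lborel (\<lambda>r. f r * indicator {-B..<B} r)"
    using integrable_mult_indicator[OF _ integrable_local_mass[OF fin sets c], of "{-B..<B}"]
    by (simp add: f_def mult.commute)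
  have i2': "integrable lborel (\<lambda>r. f (- r) * indicator {-B..<B} (- r))"
    using lborel_integrable_real_affine[OF i2, of "- 1" 0] by simp
  have "ennreal (c - \<delta>) \<le> ennreal (\<integral>r. f r * indicator {-B..<B} r \<partial>lborel)"
  proof (subst nn_integral_eq_integral[symmetric, OF i2])
    show "ennreal (c - \<delta>) \<le> (\<integral>\<^sup>+x. ennreal (f x * indicator {-B..<B} x) \<partial>lborel)"
      using B0[of B] by (simp add: B_def ennreal_mult' ennreal_indicator f0)
  qed (auto simp: f0)
  moreover have "0 \<le> (\<integral>r. f r * indicator {-B..<B} r \<partial>lborel)"
    by (intro integral_nonneg_AE) (auto simp: f0)
  ultimately have J: "c - \<delta> \<le> (\<integral>r. f r * indicator {-B..<B} r \<partial>lborel)"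
    by simp
  also have "\<dots> = (\<integral>r. f (- r) * indicator {-B..<B} (- r) \<partial>lborel)"
    using lborel_integral_real_affine[of "- 1" "\<lambda>r. f r * indicator {-B..<B} r" 0] by simp
  finally have J': "c - 2 * \<delta> < \<dots>" using \<delta> by simp
  have lower: "\<forall>\<^sub>F x in at_top. ennreal ((c - 2 * \<delta>) * f x) \<le>
      (\<integral>\<^sup>+r. ennreal (f (x + r) * (f (- r) * indicator {-B..<B} (- r))) \<partial>lborel)"
    by (rule long_tailed_average_bounds(1)[OF lt ad i2' _ _ refl J', of B]) (auto simp: f0 indicator_def)
  have upper: "\<forall>\<^sub>F x in at_top. (\<integral>\<^sup>+r. ennreal (f (x + r) * indicator {0..c} r) \<partial>lborel) \<le> ennreal (c * (1 + \<delta>) * f x)"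
  proof (rule long_tailed_average_bounds(2)[OF lt ad, of _ c c])
    show "c < c * (1 + \<delta>)" using c \<delta> by (simp add: algebra_simps)
    show "indicator {0..c} r = (0 :: real)" if "c < \<bar>r\<bar>" for r
      using that by (auto simp: indicator_def)
  qed (use c in auto)
  have ev2: "\<forall>\<^sub>F x in at_top. 0 < 2 * f x"
    using long_tailedD(3)[OF lt] by eventually_elim simp
  have "\<forall>\<^sub>F x in at_top. local_mass c (F \<star> F) x \<le> (1 + \<delta>) * (2 * f x)"
    using f2 \<delta>(1) unfolding asymp_equiv_iff_asymp_le[OF ev2] conv_power_2[OF rF]
    by (intro asymp_leD) auto
  then obtain N where N: "\<And>x. N \<le> x \<Longrightarrow> local_mass c (F \<star> F) x \<le> (1 + \<delta>) * (2 * f x)"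
    by (auto simp: eventually_at_top_linorder)
  have "\<forall>\<^sub>F x in at_top. middle f f B x \<le> ennreal (\<epsilon> * f x)"
    using lower upper eventually_ge_at_top[of N] eventually_gt_at_top[of "2 * B"]
  proof eventually_elim
    case (elim x)
    let ?h = "\<lambda>u. ennreal (f (x - u) * f u)"
    let ?e = "ennreal ((c - 2 * \<delta>) * f x)"
    have left: "?e \<le> (\<integral>\<^sup>+u. ?h u * indicator {-B..<B} u \<partial>lborel)"
    proof -
      have "(\<integral>\<^sup>+u. ?h u * indicator {-B..<B} u \<partial>lborel) =
          (\<integral>\<^sup>+u. ?h (0 - u) * indicator {-B..<B} (0 - u) \<partial>lborel)"
        by (rule nn_integral_reflect[symmetric]) measurable
      also have "\<dots> = (\<integral>\<^sup>+r. ennreal (f (x + r) * (f (- r) * indicator {-B..<B} (- r))) \<partial>lborel)"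
        by (intro nn_integral_cong) (auto simp: indicator_def)
      finally show ?thesis using elim by simp
    qed
    have "(\<integral>\<^sup>+u. ?h u * indicator {x - B<..x + B} u \<partial>lborel) =
        (\<integral>\<^sup>+u. ?h (x - u) * indicator {x - B<..x + B} (x - u) \<partial>lborel)"
      by (rule nn_integral_reflect[symmetric]) measurable
    also have "\<dots> = (\<integral>\<^sup>+u. ?h u * indicator {-B..<B} u \<partial>lborel)"
      by (intro nn_integral_cong) (auto simp: indicator_def mult.commute)
    finally have right: "?e \<le> (\<integral>\<^sup>+u. ?h u * indicator {x - B<..x + B} u \<partial>lborel)" using left by simp
    have "(?e + ?e) + middle f f B x \<le> (\<integral>\<^sup>+u. ?h u * indicator {-B..<B} u \<partial>lborel) +
        (\<integral>\<^sup>+u. ?h u * indicator {x - B<..x + B} u \<partial>lborel) + (\<integral>\<^sup>+u. ?h u * indicator {B..x - B} u \<partial>lborel)"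
      unfolding middle_def by (intro add_mono left right order_refl)
    also have "\<dots> = (\<integral>\<^sup>+u. ?h u * indicator {-B..<B} u + ?h u * indicator {x - B<..x + B} u
        + ?h u * indicator {B..x - B} u \<partial>lborel)"
      by (simp add: nn_integral_add)
    also have "\<dots> \<le> (\<integral>\<^sup>+u. ?h u \<partial>lborel)"
      using elim B by (intro nn_integral_mono) (auto simp: indicator_def)
    also have "\<dots> \<le> (\<integral>\<^sup>+r. ennreal (local_mass c (F \<star> F) (x + r)) * indicator {0..c} r \<partial>lborel)"
      using local_mass_self_convolution_le[OF rF c, of x] by (simp add: f_def)
    also have "\<dots> \<le> (\<integral>\<^sup>+r. ennreal (2 * (1 + \<delta>)) * ennreal (f (x + r) * indicator {0..c} r) \<partial>lborel)"
    proof (intro nn_integral_mono)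
      fix r
      show "ennreal (local_mass c (F \<star> F) (x + r)) * indicator {0..c} r \<le>
          ennreal (2 * (1 + \<delta>)) * ennreal (f (x + r) * indicator {0..c} r)"
      proof (cases "r \<in> {0..c}")
        case True
        then have "local_mass c (F \<star> F) (x + r) \<le> (1 + \<delta>) * (2 * f (x + r))"
          using elim by (intro N) auto
        then have "local_mass c (F \<star> F) (x + r) \<le> 2 * (1 + \<delta>) * f (x + r)"
          by (simp only: mult_ac)
        then have "ennreal (local_mass c (F \<star> F) (x + r)) \<le> ennreal (2 * (1 + \<delta>) * f (x + r))"
          by (rule ennreal_leI)
        also have "\<dots> = ennreal (2 * (1 + \<delta>)) * ennreal (f (x + r))"
          using f0 by (rule ennreal_mult'')
        finally show ?thesis using True by simp
      qed simp
    qed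
    also have "\<dots> = ennreal (2 * (1 + \<delta>)) * (\<integral>\<^sup>+r. ennreal (f (x + r) * indicator {0..c} r) \<partial>lborel)"
      by (rule nn_integral_cmult) measurable
    also have "\<dots> \<le> ennreal (2 * (1 + \<delta>)) * ennreal (c * (1 + \<delta>) * f x)"
      using elim by (intro mult_left_mono) auto
    also have "\<dots> = ennreal (2 * (1 + \<delta>) * (c * (1 + \<delta>) * f x))"
      using \<delta> by (simp add: ennreal_mult')
    also have "?e + ?e = ennreal (2 * ((c - 2 * \<delta>) * f x))"
      using \<delta> f0[of x] by (simp add: ennreal_plus[symmetric] del: ennreal_plus)
    finally have "middle f f B x \<le> ennreal (2 * (1 + \<delta>) * (c * (1 + \<delta>) * f x) - 2 * ((c - 2 * \<delta>) * f x))"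
      using \<delta> f0[of x] by (intro ennreal_le_diffI) auto
    also have "\<dots> \<le> ennreal (\<epsilon> * f x)"
    proof (rule ennreal_leI)
      have "\<delta> * \<delta> \<le> \<delta>" using \<delta> by (simp add: mult_left_le)
      then have "2 * c * (\<delta> * \<delta>) \<le> 2 * c * \<delta>" using c by (intro mult_left_mono) auto
      then have "2 * (1 + \<delta>) * (c * (1 + \<delta>)) - 2 * (c - 2 * \<delta>) \<le> \<delta> * (6 * c + 4)"
        by (simp add: algebra_simps)
      also have "\<dots> \<le> \<epsilon>" by (rule \<delta>(4))
      finally have "(2 * (1 + \<delta>) * (c * (1 + \<delta>)) - 2 * (c - 2 * \<delta>)) * f x \<le> \<epsilon> * f x"
        using f0[of x] by (intro mult_right_mono)
      then show "2 * (1 + \<delta>) * (c * (1 + \<delta>) * f x) - 2 * ((c - 2 * \<delta>) * f x) \<le> \<epsilon> * f x"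
        by (simp add: algebra_simps)
    qed
    finally show ?case .
  qed
  then show "\<exists>B. \<forall>\<^sub>F x in at_top. middle (local_mass c F) (local_mass c F) B x \<le> ennreal (\<epsilon> * local_mass c F x)"
    unfolding f_def by blast
qed

section \<open>Convolution with a light factor\<close>

lemma regular_exponential_bound:
  assumes \<phi>: "\<phi> \<in> long_tailed_fun" and ad: "almost_decreasing \<phi>"
  obtains K x1 where "1 \<le> K" "\<And>x. x1 \<le> x \<Longrightarrow> 0 < \<phi> x"
    "\<And>x y. x1 \<le> x \<Longrightarrow> 0 \<le> y \<Longrightarrow> \<phi> (x + y) \<le> K * \<phi> x"
    "\<And>x y. x1 \<le> x \<Longrightarrow> 0 \<le> y \<Longrightarrow> \<phi> x \<le> K * exp (y / 2) * \<phi> (x + y)"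
proof -
  obtain x0 K0 where K0: "0 < K0" and ad: "\<And>x y. x0 < x \<Longrightarrow> 0 < y \<Longrightarrow> \<phi> (x + y) \<le> K0 * \<phi> x"
    using ad by (auto simp: almost_decreasing_def)
  from asymp_leD[OF long_tailed_preceq_shift[OF \<phi>, of 1], of "exp (1 / 2)"]
  have "\<forall>\<^sub>F x in at_top. \<phi> x \<le> exp (1 / 2) * \<phi> (x + 1)" by simp
  with long_tailedD(3)[OF \<phi>] eventually_gt_at_top[of x0]
  have "\<forall>\<^sub>F x in at_top. 0 < \<phi> x \<and> x0 < x \<and> \<phi> x \<le> exp (1 / 2) * \<phi> (x + 1)"
    by eventually_elim auto
  then obtain x1 where x1: "\<And>x. x1 \<le> x \<Longrightarrow> 0 < \<phi> x \<and> x0 < x \<and> \<phi> x \<le> exp (1 / 2) * \<phi> (x + 1)"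
    by (auto simp: eventually_at_top_linorder)
  define K where "K = max K0 1"
  have K1: "1 \<le> K" by (simp add: K_def)
  have down: "\<phi> (x + y) \<le> K * \<phi> x" if "x1 \<le> x" "0 \<le> y" for x y
  proof (cases "y = 0")
    case True
    then show ?thesis using x1[OF that(1)] mult_right_mono[of 1 K "\<phi> x"] by (simp add: K_def)
  next
    case False
    then have "\<phi> (x + y) \<le> K0 * \<phi> x" using that x1[OF that(1)] by (intro ad) auto
    also have "\<dots> \<le> K * \<phi> x" using x1[OF that(1)] by (intro mult_right_mono) (auto simp: K_def)
    finally show ?thesis .
  qed
  have step: "\<phi> x \<le> exp (real n / 2) * \<phi> (x + real n)" if "x1 \<le> x" for x n
  proof (induction n)
    case (Suc n)
    have "\<phi> (x + real n) \<le> exp (1 / 2) * \<phi> (x + real n + 1)" using x1[of "x + real n"] that by auto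
    then have "exp (real n / 2) * \<phi> (x + real n) \<le> exp (real n / 2) * (exp (1 / 2) * \<phi> (x + real n + 1))"
      by (intro mult_left_mono) auto
    also have "\<dots> = exp (real (Suc n) / 2) * \<phi> (x + real (Suc n))"
      by (simp add: mult.assoc[symmetric] exp_add[symmetric] add_divide_distrib add_ac)
    finally show ?case using Suc by simp
  qed simp
  show thesis
  proof (rule that[of "K * exp (1 / 2)" x1])
    have "1 * 1 \<le> K * exp (1 / 2)" by (intro mult_mono) (auto simp: K_def)
    then show "1 \<le> K * exp (1 / 2)" by simp
    show "0 < \<phi> x" if "x1 \<le> x" for x using x1[OF that] by simp
    show "\<phi> (x + y) \<le> K * exp (1 / 2) * \<phi> x" if "x1 \<le> x" "0 \<le> y" for x y
    proof -
      have "K * \<phi> x \<le> K * exp (1 / 2) * \<phi> x"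
        using x1[OF that(1)] K1 mult_left_mono[of 1 "exp (1 / 2)" K] by (intro mult_right_mono) auto
      then show ?thesis using down[OF that] by simp
    qed
    show "\<phi> x \<le> K * exp (1 / 2) * exp (y / 2) * \<phi> (x + y)" if "x1 \<le> x" "0 \<le> y" for x y
    proof -
      define n where "n = nat \<lceil>y\<rceil>"
      have n: "y \<le> real n" "real n \<le> y + 1" using that(2) by (auto simp: n_def)
      have "\<phi> (x + real n) = \<phi> ((x + y) + (real n - y))" by simp
      also have "\<dots> \<le> K * \<phi> (x + y)" using that n by (intro down) auto
      finally have 1: "\<phi> (x + real n) \<le> K * \<phi> (x + y)" .
      have "\<phi> x \<le> exp (real n / 2) * \<phi> (x + real n)" by (rule step[OF that(1)])
      also have "\<dots> \<le> exp ((y + 1) / 2) * (K * \<phi> (x + y))"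
        using 1 n long_tailedD(2)[OF \<phi>] by (intro mult_mono) auto
      also have "\<dots> = K * exp (1 / 2) * exp (y / 2) * \<phi> (x + y)"
        by (simp add: add_divide_distrib exp_add)
      finally show ?thesis .
    qed
  qed
qed

text \<open>
  Large displacements by the light factor do not matter. Displacements to the left only increase the
  argument of \<open>\<phi>\<close>, and are harmless because \<open>\<phi>\<close> is almost decreasing; displacements \<open>y\<close> to the right
  cost at most a factor \<open>exp (y / 2)\<close>, which is integrable against \<open>M\<close>. Displacements so large
  that the bound \<open>\<pi> = O(\<phi>)\<close> no longer applies have probability of order \<open>exp (- x)\<close>, while \<open>\<phi>(x)\<close> is at
  least of order \<open>exp (- x / 2)\<close>.
\<close>

lemma light_tail_negligible:
  assumes \<phi>: "\<phi> \<in> long_tailed_fun" "almost_decreasing \<phi>" and M: "light_right_tail M"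
    and \<pi>: "\<pi> \<in> borel_measurable borel" "\<And>x. 0 \<le> \<pi> x" "\<And>x. \<pi> x \<le> 1"
    and O: "\<pi> \<in> O(\<phi>)" and \<epsilon>: "0 < \<epsilon>"
  obtains A0 where "\<And>A. A0 \<le> A \<Longrightarrow>
    \<forall>\<^sub>F x in at_top. (\<integral>\<^sup>+y. ennreal (\<pi> (x - y)) * indicator (- {-A..A}) y \<partial>M) \<le> ennreal (\<epsilon> * \<phi> x)"
proof -
  interpret M: real_distribution M using M by (simp add: light_right_tail_def)
  note [measurable] = \<pi>(1)
  obtain C where C: "0 < C" "\<forall>\<^sub>F x in at_top. \<pi> x \<le> C * \<phi> x"
    using O \<pi>(2) long_tailedD(2)[OF \<phi>(1)] by (auto simp: bigo_iff_eventually_le)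
  obtain K x2 where K: "1 \<le> K" and pos: "\<And>x. x2 \<le> x \<Longrightarrow> 0 < \<phi> x"
    and down: "\<And>x y. x2 \<le> x \<Longrightarrow> 0 \<le> y \<Longrightarrow> \<phi> (x + y) \<le> K * \<phi> x"
    and up: "\<And>x y. x2 \<le> x \<Longrightarrow> 0 \<le> y \<Longrightarrow> \<phi> x \<le> K * exp (y / 2) * \<phi> (x + y)"
    by (rule regular_exponential_bound[OF \<phi>], rule that; assumption)
  obtain x3 where x3: "\<And>x. x3 \<le> x \<Longrightarrow> \<pi> x \<le> C * \<phi> x"
    using C(2) by (auto simp: eventually_at_top_linorder)
  define x1 where "x1 = max x2 x3"
  let ?h = "\<lambda>y::real. ennreal (1 + exp (y / 2))"
  have pointwise: "\<pi> (x - y) \<le> C * K * \<phi> x * (1 + exp (y / 2)) + exp (- (x - x1)) * exp y" if x: "x1 \<le> x" for x y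
  proof -
    have \<phi>x: "0 < \<phi> x" using pos[of x] x by (simp add: x1_def)
    consider "x - y < x1" | "x1 \<le> x - y" "0 \<le> y" | "y < 0" by linarith
    then show ?thesis
    proof cases
      case 1
      have "\<pi> (x - y) \<le> 1" by (rule \<pi>)
      also have "1 \<le> exp (- (x - x1)) * exp y" using 1 by (simp add: exp_add[symmetric])
      also have "\<dots> \<le> C * K * \<phi> x * (1 + exp (y / 2)) + exp (- (x - x1)) * exp y"
        using C K \<phi>x by (simp add: add_pos_pos)
      finally show ?thesis .
    next
      case 2
      have "\<pi> (x - y) \<le> C * \<phi> (x - y)" using 2 by (intro x3) (auto simp: x1_def)
      also have "\<dots> \<le> C * (K * exp (y / 2) * \<phi> (x - y + y))"
        using 2 C by (intro mult_left_mono up) (auto simp: x1_def)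
      also have "\<dots> \<le> C * K * \<phi> x * (1 + exp (y / 2))"
        using C K \<phi>x by (simp add: algebra_simps)
      finally show ?thesis by (simp add: add_increasing2)
    next
      case 3
      have "\<pi> (x - y) \<le> C * \<phi> (x + (- y))" using x3[of "x - y"] x 3 by (simp add: x1_def)
      also have "\<dots> \<le> C * (K * \<phi> x)"
        using 3 C x by (intro mult_left_mono down) (auto simp: x1_def)
      also have "\<dots> \<le> C * K * \<phi> x * (1 + exp (y / 2))"
        using C K \<phi>x by (simp add: algebra_simps)
      finally show ?thesis by (simp add: add_increasing2)
    qed
  qed
  obtain E where E: "0 \<le> E" "(\<integral>\<^sup>+y. ennreal (exp y) \<partial>M) = ennreal E"
    using M unfolding light_right_tail_def by (cases "\<integral>\<^sup>+y. ennreal (exp y) \<partial>M") auto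
  have "(\<integral>\<^sup>+y. ?h y \<partial>M) \<le> (\<integral>\<^sup>+y. 2 + ennreal (exp y) \<partial>M)"
  proof (rule nn_integral_mono)
    fix y :: real
    have "exp (y / 2) \<le> 1 + exp y"
    proof (cases "0 \<le> y")
      case False
      then have "exp (y / 2) \<le> 1" by simp
      then show ?thesis using exp_ge_zero[of y] by linarith
    qed (simp add: add_increasing)
    then have "ennreal (1 + exp (y / 2)) \<le> ennreal (2 + exp y)" by (intro ennreal_leI) simp
    then show "?h y \<le> 2 + ennreal (exp y)" by simp
  qed
  also have "\<dots> = 2 + ennreal E"
    using M.emeasure_space_1 by (subst nn_integral_add) (auto simp: E)
  also have "\<dots> < \<infinity>" by (simp add: less_top[symmetric])
  finally obtain Q where Q: "0 \<le> Q" "(\<integral>\<^sup>+y. ?h y \<partial>M) = ennreal Q"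
    by (cases "\<integral>\<^sup>+y. ?h y \<partial>M") auto
  \<comment> \<open>Half of \<open>\<epsilon>\<close> is spent on the moderate displacements, after the factor \<open>C K\<close>.\<close>
  define \<delta> where "\<delta> = \<epsilon> / (2 * C * K)"
  have \<delta>: "0 < \<delta>" using \<epsilon> C K by (simp add: \<delta>_def)
  obtain B0 where B0: "\<And>B. B0 \<le> B \<Longrightarrow> ennreal (Q - \<delta>) \<le> (\<integral>\<^sup>+y. ?h y * indicator {-B..<B} y \<partial>M)"
    by (rule nn_integral_mass_below[OF _ M.events_eq_borel Q(2) \<delta>]) auto
  show thesis
  proof (rule that[of B0])
    fix A assume A: "B0 \<le> A"
    let ?I = "indicator (- {-A..A}) :: real \<Rightarrow> ennreal"
    have tail: "(\<integral>\<^sup>+y. ?h y * ?I y \<partial>M) \<le> ennreal \<delta>"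
    proof (cases "Q \<le> \<delta>")
      case True
      have "(\<integral>\<^sup>+y. ?h y * ?I y \<partial>M) \<le> (\<integral>\<^sup>+y. ?h y \<partial>M)"
        by (intro nn_integral_mono) (auto simp: indicator_def)
      also have "\<dots> \<le> ennreal \<delta>" using Q True by (simp add: ennreal_leI)
      finally show ?thesis .
    next
      case False
      have "ennreal (Q - \<delta>) + (\<integral>\<^sup>+y. ?h y * ?I y \<partial>M) \<le>
          (\<integral>\<^sup>+y. ?h y * indicator {-A..<A} y \<partial>M) + (\<integral>\<^sup>+y. ?h y * ?I y \<partial>M)"
        by (intro add_right_mono B0 A)
      also have "\<dots> = (\<integral>\<^sup>+y. ?h y * indicator {-A..<A} y + ?h y * ?I y \<partial>M)"
        by (rule nn_integral_add[symmetric]) measurable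
      also have "\<dots> \<le> (\<integral>\<^sup>+y. ?h y \<partial>M)"
        by (intro nn_integral_mono) (auto simp: indicator_def)
      finally have "(\<integral>\<^sup>+y. ?h y * ?I y \<partial>M) \<le> ennreal (Q - (Q - \<delta>))"
        using False Q by (intro ennreal_le_diffI) auto
      then show ?thesis by simp
    qed
    \<comment> \<open>Beyond \<open>X\<close> the exponentially small term is at most \<open>\<epsilon> / 2 * \<phi> x\<close>.\<close>
    define X where "X = max x1 (x1 + 2 * (2 * E * K / (\<phi> x1 * \<epsilon>)))"
    show "\<forall>\<^sub>F x in at_top. (\<integral>\<^sup>+y. ennreal (\<pi> (x - y)) * ?I y \<partial>M) \<le> ennreal (\<epsilon> * \<phi> x)"
      using eventually_ge_at_top[of X]
    proof eventually_elim
      case (elim x)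
      have x: "x1 \<le> x" using elim by (simp add: X_def)
      have \<phi>x: "0 < \<phi> x" "0 < \<phi> x1" using pos[of x] pos[of x1] x by (auto simp: x1_def)
      define s where "s = (x - x1) / 2"
      have "2 * E * K / (\<phi> x1 * \<epsilon>) \<le> s" using elim by (auto simp: X_def s_def)
      also have "s \<le> exp s" using exp_ge_add_one_self[of s] by linarith
      finally have Es: "2 * E * K \<le> exp s * (\<phi> x1 * \<epsilon>)"
        using \<phi>x \<epsilon> by (simp add: field_simps)
      have \<phi>1: "\<phi> x1 \<le> K * exp s * \<phi> x" using up[of x1 "x - x1"] x by (simp add: s_def x1_def)
      have "2 * E * K \<le> exp s * (K * exp s * \<phi> x * \<epsilon>)"
        using Es \<phi>1 \<epsilon> by (meson exp_ge_zero less_imp_le mult_left_mono mult_right_mono order.trans)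
      then have "K * (2 * E) \<le> K * (exp s * exp s * \<phi> x * \<epsilon>)" by (simp add: mult_ac)
      then have "2 * E \<le> exp s * exp s * \<phi> x * \<epsilon>" using K by (simp add: mult_le_cancel_left)
      then have "exp (- (2 * s)) * (2 * E) \<le> exp (- (2 * s)) * (exp s * exp s * \<phi> x * \<epsilon>)"
        by (intro mult_left_mono) auto
      also have "\<dots> = (exp (- (2 * s)) * (exp s * exp s)) * \<phi> x * \<epsilon>" by (simp add: mult_ac)
      also have "exp (- (2 * s)) * (exp s * exp s) = 1" by (simp add: exp_add[symmetric])
      finally have second': "exp (- (2 * s)) * (2 * E) \<le> 1 * \<phi> x * \<epsilon>" .
      have "2 * s = x - x1" by (simp add: s_def)
      then have second: "exp (- (x - x1)) * E \<le> \<epsilon> / 2 * \<phi> x" using second' by (simp add: mult_ac)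
      have "(\<integral>\<^sup>+y. ennreal (\<pi> (x - y)) * ?I y \<partial>M) \<le>
         (\<integral>\<^sup>+y. ennreal (C * K * \<phi> x) * (?h y * ?I y) + ennreal (exp (- (x - x1))) * ennreal (exp y) \<partial>M)"
      proof (rule nn_integral_mono)
        fix y
        have "ennreal (\<pi> (x - y)) \<le> ennreal (C * K * \<phi> x * (1 + exp (y / 2)) + exp (- (x - x1)) * exp y)"
          by (intro ennreal_leI pointwise x)
        also have "\<dots> = ennreal (C * K * \<phi> x) * ?h y + ennreal (exp (- (x - x1))) * ennreal (exp y)"
          using C K \<phi>x by (subst ennreal_plus) (auto simp: ennreal_mult add_nonneg_nonneg simp del: ennreal_plus)
        finally show "ennreal (\<pi> (x - y)) * ?I y \<le>
            ennreal (C * K * \<phi> x) * (?h y * ?I y) + ennreal (exp (- (x - x1))) * ennreal (exp y)"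
          by (auto simp: indicator_def)
      qed
      also have "\<dots> = ennreal (C * K * \<phi> x) * (\<integral>\<^sup>+y. ?h y * ?I y \<partial>M) + ennreal (exp (- (x - x1))) * ennreal E"
        by (simp add: nn_integral_add nn_integral_cmult E)
      also have "\<dots> \<le> ennreal (C * K * \<phi> x) * ennreal \<delta> + ennreal (exp (- (x - x1))) * ennreal E"
        by (intro add_right_mono mult_left_mono tail) simp
      also have "\<dots> = ennreal (C * K * \<phi> x * \<delta> + exp (- (x - x1)) * E)"
        using C K \<phi>x \<delta> E by (simp add: ennreal_mult ennreal_plus)
      also have "\<dots> \<le> ennreal (\<epsilon> * \<phi> x)"
      proof (rule ennreal_leI)
        have CK: "C * K * \<delta> = \<epsilon> / 2" using C K by (simp add: \<delta>_def field_simps)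
        have "C * K * \<phi> x * \<delta> = (C * K * \<delta>) * \<phi> x" by (simp only: mult_ac)
        also have "\<dots> = \<epsilon> / 2 * \<phi> x" by (simp only: CK)
        finally show "C * K * \<phi> x * \<delta> + exp (- (x - x1)) * E \<le> \<epsilon> * \<phi> x"
          using second by linarith
      qed
      finally show ?case .
    qed
  qed
qed

lemma measure_blocks_le:
  assumes R: "finite_measure R" "sets R = sets borel" and c: "0 < c"
  shows "measure R {a<..a + real n * c} \<le> (\<Sum>j<n. local_mass c R (a + real j * c))"
proof (induction n)
  case (Suc n)
  interpret finite_measure R by (rule R)
  define b where "b = real n * c"
  have b: "0 \<le> b" "a + real (Suc n) * c = a + b + c" using c by (auto simp: b_def algebra_simps)
  have "{a<..a + real (Suc n) * c} = {a<..a + real n * c} \<union> {a + real n * c<..a + real n * c + c}"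
    using c b(1) unfolding b(2) b_def[symmetric] by auto
  then have "measure R {a<..a + real (Suc n) * c} \<le>
      measure R {a<..a + real n * c} + measure R {a + real n * c<..a + real n * c + c}"
    using measure_Un_le[of "{a<..a + real n * c}" R "{a + real n * c<..a + real n * c + c}"]
    by (simp add: R)
  then show ?case using Suc by (simp add: local_mass_def)
qed simp

text \<open>
  With probability at least one half the light factor moves its argument by at most \<open>L\<close>. Hence half
  of the local mass of \<open>P\<close> at \<open>x\<close> is at most the mass that \<open>P \<star> M\<close> gives to a fixed number of adjacent
  windows near \<open>x\<close>.
\<close>

lemma factor_local_mass_bigo:
  assumes P: "real_distribution P" and M: "real_distribution M" and c: "0 < c"
    and lt: "local_mass c (P \<star> M) \<in> long_tailed_fun" and ad: "almost_decreasing (local_mass c (P \<star> M))"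
  shows "local_mass c P \<in> O(local_mass c (P \<star> M))"
proof -
  interpret P: real_distribution P by fact
  interpret M: real_distribution M by fact
  interpret PM: real_distribution "P \<star> M" by (rule real_distribution_convolution[OF P M])
  let ?m = "local_mass c (P \<star> M)"
  obtain K where K: "0 < K" and bd: "\<And>T. \<forall>\<^sub>F x in at_top. \<forall>y\<ge>x - T. ?m y \<le> K * ?m x"
    using regular_backward_bound[OF lt ad] by auto
  have "(\<integral>\<^sup>+y. 1 \<partial>M) = ennreal 1" using M.emeasure_space_1 by simp
  then obtain L where "ennreal (1 - 1 / 2) \<le> (\<integral>\<^sup>+y. 1 * indicator {-L..<L} y \<partial>M)"
    using nn_integral_mass_below[OF _ M.events_eq_borel, of "\<lambda>_. 1" 1 "1 / 2"] by auto
  then have "ennreal (1 - 1 / 2) \<le> emeasure M {-L..<L}" by simp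
  then have L: "1 / 2 \<le> measure M {-L..<L}"
    unfolding M.emeasure_eq_measure ennreal_le_iff[OF measure_nonneg] by simp
  have L0: "0 < L"
  proof (rule ccontr)
    assume "\<not> 0 < L"
    then have "{-L..<L} = {}" by auto
    then show False using L by simp
  qed
  define n where "n = nat \<lceil>(2 * L + c) / c\<rceil>"
  have "(2 * L + c) / c \<le> real n" unfolding n_def by (rule real_nat_ceiling_ge)
  then have n: "2 * L + c \<le> real n * c" using c by (simp add: field_simps)
  have bound: "local_mass c P x \<le> 2 * measure (P \<star> M) {x - L<..x - L + real n * c}" for x
  proof -
    let ?J = "{x - L<..x - L + real n * c}"
    have "ennreal (local_mass c P x) * ennreal (1 / 2) \<le> ennreal (local_mass c P x) * emeasure M {-L..<L}"
      unfolding M.emeasure_eq_measure by (intro mult_left_mono ennreal_leI L) simp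
    also have "\<dots> = (\<integral>\<^sup>+y. ennreal (local_mass c P x) * indicator {-L..<L} y \<partial>M)"
      by (rule nn_integral_cmult_indicator[symmetric]) simp
    also have "\<dots> \<le> (\<integral>\<^sup>+y. \<integral>\<^sup>+v. indicator ?J (v + y) \<partial>P \<partial>M)"
    proof (rule nn_integral_mono)
      fix y
      have "ennreal (local_mass c P x) \<le> (\<integral>\<^sup>+v. indicator ?J (v + y) \<partial>P)" if "y \<in> {-L..<L}"
        unfolding ennreal_local_mass[OF P.finite_measure_axioms P.events_eq_borel c]
        using that n by (intro nn_integral_mono) (auto simp: window_def indicator_def)
      then show "ennreal (local_mass c P x) * indicator {-L..<L} y \<le> (\<integral>\<^sup>+v. indicator ?J (v + y) \<partial>P)"
        by (auto simp: indicator_def)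
    qed
    also have "\<dots> = (\<integral>\<^sup>+y. \<integral>\<^sup>+v. indicator ?J (y + v) \<partial>P \<partial>M)"
      by (simp add: add.commute)
    also have "\<dots> = emeasure (M \<star> P) ?J"
      by (rule convolution_emeasure'[symmetric])
         (auto simp: P.finite_measure_axioms M.finite_measure_axioms)
    also have "M \<star> P = (P \<star> M)"
      by (rule convolution_commutative) (auto simp: P.finite_measure_axioms M.finite_measure_axioms)
    finally have "ennreal (local_mass c P x * (1 / 2)) \<le> ennreal (measure (P \<star> M) ?J)"
      by (subst ennreal_mult') (auto simp: local_mass_def PM.emeasure_eq_measure)
    then show ?thesis by simp
  qed
  have "\<forall>\<^sub>F x in at_top. local_mass c P x \<le> (2 * (real n * K + 1)) * ?m x"
    using bd[of L]
  proof eventually_elim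
    case (elim x)
    have "measure (P \<star> M) {x - L<..x - L + real n * c} \<le> (\<Sum>j<n. ?m (x - L + real j * c))"
      by (rule measure_blocks_le[OF PM.finite_measure_axioms PM.events_eq_borel c])
    also have "\<dots> \<le> (\<Sum>j<n. K * ?m x)"
      using elim c by (intro sum_mono) auto
    also have "\<dots> = real n * K * ?m x" by simp
    also have "\<dots> \<le> (real n * K + 1) * ?m x"
      by (intro mult_right_mono) (auto simp: local_mass_def)
    finally show ?case using bound[of x] unfolding mult.assoc by linarith
  qed
  then show ?thesis
    using K by (subst bigo_iff_eventually_le)
      (auto simp: local_mass_def intro!: exI[of _ "2 * (real n * K + 1)"] add_nonneg_pos)
qed

section \<open>The size-bias identity for local masses\<close>

text \<open>
  Integrating the size-bias identity over a window. On the event that the sum lies in \<open>(x,x + c]\<close> and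
  the displacement in \<open>[-A,A]\<close>, the size \<open>t\<close> of the summand from \<open>P\<close> differs from \<open>x\<close> by at most \<open>A + c\<close>.
\<close>

lemma local_mass_size_bias:
  fixes \<sigma> :: "real measure"
  assumes P: "size_bias_identity P k" and \<sigma>: "finite_measure \<sigma>" "sets \<sigma> = sets borel" "AE y in \<sigma>. \<bar>y\<bar> \<le> A"
    and k[measurable]: "k \<in> borel_measurable borel" and A: "0 \<le> A" and c: "0 < c" and x: "0 \<le> x"
  defines "q \<equiv> local_mass c (P \<star> \<sigma>)" and "D \<equiv> A + c"
  defines "W \<equiv> (\<integral>\<^sup>+u. ennreal (u * k u) * ennreal (q (x - u)) \<partial>lborel)"
  shows "W \<le> ennreal ((x + D) * q x)" and "ennreal ((x - D) * q x) \<le> W"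
proof -
  interpret P: real_distribution P using P by (simp add: size_bias_identity_def)
  interpret \<sigma>: finite_measure \<sigma> by fact
  note [measurable_cong] = \<sigma>(2)
  interpret pair_sigma_finite P \<sigma> ..
  interpret L: pair_sigma_finite lborel \<sigma> ..
  have finP: "finite_measure P" by (rule P.finite_measure_axioms)
  have id: "(\<integral>\<^sup>+t. ennreal t * h t \<partial>P) = (\<integral>\<^sup>+u. ennreal (u * k u) * (\<integral>\<^sup>+v. h (u + v) \<partial>P) \<partial>lborel)"
    if "h \<in> borel_measurable borel" for h
    using P that by (simp add: size_bias_identity_def)
  have q0: "0 \<le> q z" for z by (simp add: q_def local_mass_def)
  have q: "ennreal (q z) = (\<integral>\<^sup>+y. \<integral>\<^sup>+t. window c z (t + y) \<partial>P \<partial>\<sigma>)" for z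
  proof -
    have "ennreal (q z) = (\<integral>\<^sup>+y. ennreal (local_mass c P (z - y)) \<partial>\<sigma>)"
      unfolding q_def by (rule local_mass_convolution[OF finP P.events_eq_borel c \<sigma>(1,2)])
    also have "\<dots> = (\<integral>\<^sup>+y. \<integral>\<^sup>+t. window c z (t + y) \<partial>P \<partial>\<sigma>)"
      unfolding ennreal_local_mass[OF finP P.events_eq_borel c]
      by (intro nn_integral_cong) (auto simp: window_eq algebra_simps)
    finally show ?thesis .
  qed
  have "(\<integral>\<^sup>+y. \<integral>\<^sup>+t. ennreal t * window c x (t + y) \<partial>P \<partial>\<sigma>) =
      (\<integral>\<^sup>+y. \<integral>\<^sup>+u. ennreal (u * k u) * (\<integral>\<^sup>+v. window c x (u + v + y) \<partial>P) \<partial>lborel \<partial>\<sigma>)"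
    by (intro nn_integral_cong id) measurable
  also have "\<dots> = (\<integral>\<^sup>+u. \<integral>\<^sup>+y. ennreal (u * k u) * (\<integral>\<^sup>+v. window c x (u + v + y) \<partial>P) \<partial>\<sigma> \<partial>lborel)"
    by (rule L.Fubini') measurable
  also have "\<dots> = (\<integral>\<^sup>+u. ennreal (u * k u) * (\<integral>\<^sup>+y. \<integral>\<^sup>+v. window c x (u + v + y) \<partial>P \<partial>\<sigma>) \<partial>lborel)"
    by (intro nn_integral_cong nn_integral_cmult) measurable
  also have "\<dots> = W"
    unfolding W_def q by (intro nn_integral_cong arg_cong2[where f="(*)"] refl) (auto simp: window_eq algebra_simps)
  finally have W: "W = (\<integral>\<^sup>+y. \<integral>\<^sup>+t. ennreal t * window c x (t + y) \<partial>P \<partial>\<sigma>)" by simp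
  have cm: "ennreal a * ennreal (q x) = (\<integral>\<^sup>+y. \<integral>\<^sup>+t. ennreal a * window c x (t + y) \<partial>P \<partial>\<sigma>)" for a
    by (simp add: q nn_integral_cmult)
  have "W \<le> (\<integral>\<^sup>+y. \<integral>\<^sup>+t. ennreal (x + D) * window c x (t + y) \<partial>P \<partial>\<sigma>)"
    unfolding W
  proof (rule nn_integral_mono_AE, use \<sigma>(3) in eventually_elim)
    case (elim y)
    show ?case
      using elim by (intro nn_integral_mono) (auto simp: window_eq D_def intro!: ennreal_leI)
  qed
  then show "W \<le> ennreal ((x + D) * q x)"
    unfolding cm[symmetric] using x A c q0 by (simp add: ennreal_mult D_def)
  have "(\<integral>\<^sup>+y. \<integral>\<^sup>+t. ennreal (x - D) * window c x (t + y) \<partial>P \<partial>\<sigma>) \<le> W"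
    unfolding W
  proof (rule nn_integral_mono_AE, use \<sigma>(3) in eventually_elim)
    case (elim y)
    show ?case
      using elim c by (intro nn_integral_mono) (auto simp: window_eq D_def intro!: ennreal_leI)
  qed
  then show "ennreal ((x - D) * q x) \<le> W"
    unfolding cm[symmetric] using q0 by (simp add: ennreal_mult'')
qed

text \<open>
  The analytic content of \<open>local_mass_size_bias\<close>: a function \<open>q\<close> that nearly solves the integral equation
  \<open>x q(x) = \<integral> u k(u) q(x - u) du\<close> with a decreasing kernel \<open>k\<close>. The constant \<open>D\<close> bounds the error in the
  factor \<open>x\<close> and the extent of \<open>q\<close> to the left.
\<close>

locale size_biased_density =
  fixes q k :: "real \<Rightarrow> real" and D Q \<Lambda> :: real
  assumes q: "q \<in> borel_measurable borel" "\<And>x. 0 \<le> q x" "\<And>x. x < - D \<Longrightarrow> q x = 0"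
      "(\<integral>\<^sup>+x. ennreal (q x) \<partial>lborel) = ennreal Q"
    and k: "k \<in> borel_measurable borel" "\<And>x. 0 \<le> k x" "\<And>x. x \<le> 1 \<Longrightarrow> k x = 0" "antimono_on {1<..} k"
      "(\<integral>\<^sup>+x. ennreal (k x) \<partial>lborel) = ennreal \<Lambda>"
    and D: "0 < D" and Q: "0 \<le> Q" and \<Lambda>: "0 \<le> \<Lambda>"
    and size_bias_le: "\<And>x. 0 \<le> x \<Longrightarrow>
      (\<integral>\<^sup>+u. ennreal (u * k u) * ennreal (q (x - u)) \<partial>lborel) \<le> ennreal ((x + D) * q x)"
    and size_bias_ge: "\<And>x. 0 \<le> x \<Longrightarrow>
      ennreal ((x - D) * q x) \<le> (\<integral>\<^sup>+u. ennreal (u * k u) * ennreal (q (x - u)) \<partial>lborel)"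
begin

lemmas [measurable] = q(1) k(1)

lemma k_antimono: "1 < x \<Longrightarrow> x \<le> y \<Longrightarrow> k y \<le> k x"
  using k(4) by (auto simp: monotone_on_def)

text \<open>
  Two disjoint ranges of \<open>u\<close>. For \<open>u\<close> close to \<open>x\<close> the weight is at least \<open>(x - B) k(x + D)\<close>, since \<open>q(x - u)\<close>
  vanishes for \<open>u > x + D\<close> and \<open>k\<close> decreases; the middle range is kept as it is.
\<close>

lemma lower_split:
  assumes x: "1 < x - B" "0 \<le> B"
  shows "ennreal ((x - B) * k (x + D)) * (\<integral>\<^sup>+w. ennreal (q w) * indicator {-B..<B} w \<partial>lborel) +
    (\<integral>\<^sup>+u. ennreal (u * k u) * ennreal (q (x - u)) * indicator {B..x - B} u \<partial>lborel)
      \<le> ennreal ((x + D) * q x)"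
proof -
  let ?g = "\<lambda>u. ennreal (u * k u) * ennreal (q (x - u))"
  have "ennreal ((x - B) * k (x + D)) * (\<integral>\<^sup>+w. ennreal (q w) * indicator {-B..<B} w \<partial>lborel) =
      (\<integral>\<^sup>+w. ennreal ((x - B) * k (x + D)) * (ennreal (q w) * indicator {-B..<B} w) \<partial>lborel)"
    by (rule nn_integral_cmult[symmetric]) measurable
  also have "\<dots> = (\<integral>\<^sup>+u. ennreal ((x - B) * k (x + D)) * (ennreal (q (x - u)) * indicator {-B..<B} (x - u)) \<partial>lborel)"
    by (rule nn_integral_reflect[symmetric]) measurable
  also have "\<dots> \<le> (\<integral>\<^sup>+u. ?g u * indicator {x - B<..x + B} u \<partial>lborel)"
  proof (rule nn_integral_mono)
    fix u
    show "ennreal ((x - B) * k (x + D)) * (ennreal (q (x - u)) * indicator {-B..<B} (x - u)) \<le>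
        ?g u * indicator {x - B<..x + B} u"
    proof (cases "x - u < - D")
      case True then show ?thesis using q(3) by simp
    next
      case False
      show ?thesis
      proof (cases "u \<in> {x - B<..x + B}")
        case True
        then have "(x - B) * k (x + D) \<le> u * k u"
          using False x k(2) by (intro mult_mono k_antimono) auto
        then show ?thesis using True
          by (auto simp: indicator_def intro!: mult_right_mono ennreal_leI)
      qed (auto simp: indicator_def)
    qed
  qed
  finally have "ennreal ((x - B) * k (x + D)) * (\<integral>\<^sup>+w. ennreal (q w) * indicator {-B..<B} w \<partial>lborel) +
      (\<integral>\<^sup>+u. ?g u * indicator {B..x - B} u \<partial>lborel) \<le>
      (\<integral>\<^sup>+u. ?g u * indicator {x - B<..x + B} u \<partial>lborel) + (\<integral>\<^sup>+u. ?g u * indicator {B..x - B} u \<partial>lborel)"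
    by (rule add_right_mono)
  also have "\<dots> = (\<integral>\<^sup>+u. ?g u * indicator {x - B<..x + B} u + ?g u * indicator {B..x - B} u \<partial>lborel)"
    by (rule nn_integral_add[symmetric]) measurable
  also have "\<dots> \<le> (\<integral>\<^sup>+u. ?g u \<partial>lborel)"
    by (intro nn_integral_mono) (auto simp: indicator_def)
  also have "\<dots> \<le> ennreal ((x + D) * q x)" using x by (intro size_bias_le) auto
  finally show ?thesis .
qed

text \<open>
  Three ranges of \<open>u\<close>: below \<open>B\<close> the weight is at most \<open>B\<close> and not of order \<open>x\<close>; in the middle it is at
  most \<open>x\<close>; above \<open>x - B\<close> the kernel is at most \<open>k(x - B)\<close>, and only \<open>u \<le> x + D\<close> count.
\<close>

lemma upper_split:
  assumes B: "1 \<le> B" "2 * B < x" and S: "0 \<le> S" "\<And>y. x - B \<le> y \<Longrightarrow> y \<le> x \<Longrightarrow> q y \<le> S"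
  shows "ennreal ((x - D) * q x) \<le>
    ennreal (B * S * \<Lambda>) + ennreal x * middle q k B x + ennreal ((x + D) * k (x - B) * Q)"
proof -
  let ?g = "\<lambda>u. ennreal (u * k u) * ennreal (q (x - u))"
  have x: "0 \<le> x" "1 < x - B" using B by auto
  have "ennreal ((x - D) * q x) \<le> (\<integral>\<^sup>+u. ?g u \<partial>lborel)" by (rule size_bias_ge[OF x(1)])
  also have "\<dots> \<le> (\<integral>\<^sup>+u. ennreal (B * S) * ennreal (k u) +
      ennreal x * (ennreal (q (x - u) * k u) * indicator {B..x - B} u) +
      ennreal ((x + D) * k (x - B)) * ennreal (q (x - u)) \<partial>lborel)"
  proof (rule nn_integral_mono)
    fix u
    consider "u \<le> 1" | "1 < u" "u < B" | "B \<le> u" "u \<le> x - B" | "x - B < u" "u \<le> x + D" | "x + D < u"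
      by linarith
    then show "?g u \<le> ennreal (B * S) * ennreal (k u) +
        ennreal x * (ennreal (q (x - u) * k u) * indicator {B..x - B} u) +
        ennreal ((x + D) * k (x - B)) * ennreal (q (x - u))"
    proof cases
      case 1 then show ?thesis by (simp add: k(3))
    next
      case 2
      have "u * k u * q (x - u) \<le> B * k u * S"
        using 2 S B k(2) q(2) by (intro mult_mono) auto
      then have "?g u \<le> ennreal (B * S) * ennreal (k u)"
        using 2 k(2) q(2) S B by (simp add: ennreal_mult[symmetric] mult_ac ennreal_leI)
      then show ?thesis by (simp add: add_increasing2 add.assoc)
    next
      case 3
      have "u * k u * q (x - u) \<le> x * k u * q (x - u)"
        using 3 B k(2) q(2) by (intro mult_right_mono) auto
      then have "?g u \<le> ennreal x * (ennreal (q (x - u) * k u) * indicator {B..x - B} u)"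
        using 3 k(2) q(2) B x by (simp add: ennreal_mult[symmetric] mult_ac ennreal_leI)
      then show ?thesis by (simp add: add_increasing add_increasing2)
    next
      case 4
      have "u * k u \<le> (x + D) * k (x - B)"
        using 4 x B D k(2) by (intro mult_mono k_antimono) auto
      then have "?g u \<le> ennreal ((x + D) * k (x - B)) * ennreal (q (x - u))"
        by (intro mult_right_mono ennreal_leI) auto
      then show ?thesis by (simp add: add_increasing)
    next
      case 5 then show ?thesis by (simp add: q(3))
    qed
  qed
  also have "\<dots> = ennreal (B * S) * (\<integral>\<^sup>+u. ennreal (k u) \<partial>lborel) + ennreal x * middle q k B x +
      ennreal ((x + D) * k (x - B)) * (\<integral>\<^sup>+u. ennreal (q (x - u)) \<partial>lborel)"
    unfolding middle_def by (simp add: nn_integral_add nn_integral_cmult)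
  also have "(\<integral>\<^sup>+u. ennreal (q (x - u)) \<partial>lborel) = ennreal Q"
    by (subst nn_integral_reflect) (auto simp: q(4))
  finally show ?thesis
    using B S k Q D \<Lambda> x by (simp add: ennreal_mult[symmetric])
qed

lemma eventually_linear_le:
  fixes a b :: real assumes "0 < \<delta>" shows "\<forall>\<^sub>F x in at_top. x + a \<le> (1 + \<delta>) * (x - b)"
proof (rule eventually_at_top_linorderI[of "(a + (1 + \<delta>) * b) / \<delta>"])
  fix x assume "(a + (1 + \<delta>) * b) / \<delta> \<le> x"
  then show "x + a \<le> (1 + \<delta>) * (x - b)" using assms by (simp add: field_simps)
qed

text \<open>
  \<open>lower_split\<close> without the middle part, divided by \<open>x\<close>. Monotonicity of \<open>k\<close> replaces any
  comparison of its values at nearby points; the price is the shift by \<open>D\<close>.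
\<close>

lemma density_le:
  assumes \<delta>: "0 < \<delta>"
  shows "\<forall>\<^sub>F x in at_top. (Q - \<delta>) * k (x + D) \<le> (1 + \<delta>) * q x"
proof (cases "Q \<le> \<delta>")
  case True
  have "(Q - \<delta>) * k (x + D) \<le> (1 + \<delta>) * q x" for x
  proof -
    have "(Q - \<delta>) * k (x + D) \<le> 0" using True k(2) by (intro mult_nonpos_nonneg) auto
    also have "0 \<le> (1 + \<delta>) * q x" using \<delta> q(2) by (intro mult_nonneg_nonneg) auto
    finally show ?thesis .
  qed
  then show ?thesis by (intro always_eventually allI)
next
  case False
  obtain B0 where B0: "\<And>B. B0 \<le> B \<Longrightarrow> ennreal (Q - \<delta>) \<le> (\<integral>\<^sup>+x. ennreal (q x) * indicator {-B..<B} x \<partial>lborel)"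
    by (rule nn_integral_mass_below[of "\<lambda>x. ennreal (q x)" lborel Q \<delta>])
       (use q(4) \<delta> in \<open>auto\<close>)
  define B where "B = max B0 0"
  show ?thesis
    using eventually_gt_at_top[of "B + 1"] eventually_linear_le[OF \<delta>, of D B]
  proof eventually_elim
    case (elim x)
    have "ennreal ((x - B) * k (x + D)) * ennreal (Q - \<delta>) \<le>
      ennreal ((x - B) * k (x + D)) * (\<integral>\<^sup>+w. ennreal (q w) * indicator {-B..<B} w \<partial>lborel)"
      by (intro mult_left_mono B0) (auto simp: B_def)
    also have "\<dots> \<le> \<dots> + (\<integral>\<^sup>+u. ennreal (u * k u) * ennreal (q (x - u)) * indicator {B..x - B} u \<partial>lborel)"
      by simp
    also have "\<dots> \<le> ennreal ((x + D) * q x)"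
      using elim by (intro lower_split) (auto simp: B_def)
    finally have "ennreal ((x - B) * k (x + D) * (Q - \<delta>)) \<le> ennreal ((x + D) * q x)"
      using False by (subst ennreal_mult'') auto
    moreover have "0 \<le> (x + D) * q x" using elim q(2) D by (auto simp: B_def intro!: mult_nonneg_nonneg)
    ultimately have "(x - B) * k (x + D) * (Q - \<delta>) \<le> (x + D) * q x" by simp
    also have "\<dots> \<le> (1 + \<delta>) * (x - B) * q x" using elim q(2) by (intro mult_right_mono) auto
    finally have "(x - B) * ((Q - \<delta>) * k (x + D)) \<le> (x - B) * ((1 + \<delta>) * q x)" by (simp add: mult_ac)
    then show ?case using elim by (simp add: mult_le_cancel_left)
  qed
qed

text \<open>
  \<open>upper_split\<close> divided by \<open>x\<close>: the small \<open>u\<close> contribute \<open>O(\<phi>(x) / x)\<close> and the middle part is controlled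
  by that of \<open>\<phi>\<close>.
\<close>

lemma le_density:
  assumes \<phi>: "\<phi> \<in> long_tailed_fun" "almost_decreasing \<phi>" "small_middle \<phi>"
    and O: "q \<in> O(\<phi>)" "k \<in> O(\<phi>)" and \<delta>: "0 < \<delta>"
  obtains B where "\<forall>\<^sub>F x in at_top. q x \<le> \<delta> * \<phi> x + (1 + \<delta>) * Q * k (x - B)"
proof -
  note [measurable] = long_tailedD(1)[OF \<phi>(1)]
  have \<phi>0: "0 \<le> \<phi> x" for x by (rule long_tailedD(2)[OF \<phi>(1)])
  obtain K where K: "0 < K" and bd: "\<And>T. \<forall>\<^sub>F x in at_top. \<forall>y\<ge>x - T. \<phi> y \<le> K * \<phi> x"
    using regular_backward_bound[OF \<phi>(1,2)] by auto
  obtain C C' where C: "0 < C" "0 < C'" and "\<forall>\<^sub>F x in at_top. q x \<le> C * \<phi> x" "\<forall>\<^sub>F x in at_top. k x \<le> C' * \<phi> x"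
    using O q(2) k(2) \<phi>0 by (auto simp: bigo_iff_eventually_le)
  from eventually_conj[OF this(3,4)] obtain x1 where x1: "\<And>x. x1 \<le> x \<Longrightarrow> q x \<le> C * \<phi> x \<and> k x \<le> C' * \<phi> x"
    by (auto simp: eventually_at_top_linorder)
  define \<delta>' where "\<delta>' = \<delta> / (4 * C * C')"
  have \<delta>': "0 < \<delta>'" using \<delta> C by (simp add: \<delta>'_def)
  obtain B0 where B0: "\<And>B x. B0 \<le> B \<Longrightarrow> middle \<phi> \<phi> B x \<le> ennreal (\<delta>' * \<phi> x)"
    using \<phi>(3) \<delta>' unfolding small_middle_def by meson
  define B where "B = max (max B0 x1) 1"
  have B: "1 \<le> B" by (simp add: B_def)
  have mid: "middle q k B x \<le> ennreal (\<delta> / 4 * \<phi> x)" for x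
  proof -
    have "middle q k B x \<le> ennreal (C * C') * middle \<phi> \<phi> B x"
    proof (rule middle_mono)
      fix u assume "B \<le> u" "u \<le> x - B"
      then have "q (x - u) \<le> C * \<phi> (x - u)" "k u \<le> C' * \<phi> u"
        using x1[of "x - u"] x1[of u] by (auto simp: B_def)
      then have "q (x - u) * k u \<le> (C * \<phi> (x - u)) * (C' * \<phi> u)"
        using C \<phi>0 k(2) q(2) by (intro mult_mono mult_nonneg_nonneg) auto
      then show "q (x - u) * k u \<le> C * C' * (\<phi> (x - u) * \<phi> u)" by (simp add: mult_ac)
    qed (use C in auto)
    also have "\<dots> \<le> ennreal (C * C') * ennreal (\<delta>' * \<phi> x)"
      by (intro mult_left_mono B0) (auto simp: B_def)
    also have "\<dots> = ennreal (C * C' * (\<delta>' * \<phi> x))" using C by (simp add: ennreal_mult'[symmetric])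
    also have "C * C' * (\<delta>' * \<phi> x) = \<delta> / 4 * \<phi> x" using C by (simp add: \<delta>'_def)
    finally show ?thesis .
  qed
  show thesis
  proof (rule that[of B])
    let ?S = "\<lambda>x. C * (K * \<phi> x)"
    \<comment> \<open>Beyond \<open>X\<close> the small \<open>u\<close> contribute at most \<open>\<delta> / 2 * \<phi> x\<close>.\<close>
    define X where "X = D + 2 * (B * C * K * \<Lambda>) / \<delta>"
    show "\<forall>\<^sub>F x in at_top. q x \<le> \<delta> * \<phi> x + (1 + \<delta>) * Q * k (x - B)"
      using bd[of B] eventually_gt_at_top[of "max X (max (2 * D) (max (2 * B) (x1 + B)))"]
        eventually_linear_le[OF \<delta>, of D D]
    proof eventually_elim
      case (elim x)
      have x: "0 < x" "2 * B < x" "0 < x - D" using elim D B by auto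
      have S: "q y \<le> ?S x" if "x - B \<le> y" for y
      proof -
        have "q y \<le> C * \<phi> y" using x1[of y] that elim by auto
        also have "\<dots> \<le> C * (K * \<phi> x)" using that elim C by (intro mult_left_mono) auto
        finally show ?thesis .
      qed
      have S0: "0 \<le> ?S x" using C K \<phi>0 by simp
      have "ennreal ((x - D) * q x) \<le> ennreal (B * ?S x * \<Lambda>) + ennreal x * middle q k B x
          + ennreal ((x + D) * k (x - B) * Q)"
        by (rule upper_split[OF B x(2) S0 S])
      also have "\<dots> \<le> ennreal (B * ?S x * \<Lambda>) + ennreal x * ennreal (\<delta> / 4 * \<phi> x)
          + ennreal ((x + D) * k (x - B) * Q)"
        by (intro add_right_mono add_left_mono mult_left_mono mid) simp
      also have "\<dots> = ennreal (B * ?S x * \<Lambda> + x * (\<delta> / 4 * \<phi> x) + (x + D) * k (x - B) * Q)"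
        using x B S0 \<Lambda> \<delta> \<phi>0[of x] D k(2) Q
        by (simp add: ennreal_mult[symmetric] ennreal_plus[symmetric] del: ennreal_plus)
      finally have main: "(x - D) * q x \<le> B * ?S x * \<Lambda> + x * (\<delta> / 4 * \<phi> x) + (x + D) * k (x - B) * Q"
        using x B S0 \<Lambda> \<delta> \<phi>0[of x] D k(2) Q by (subst (asm) ennreal_le_iff) (auto intro!: add_nonneg_nonneg)
      have "B * C * K * \<Lambda> \<le> (x - D) * (\<delta> / 2)"
        using elim \<delta> by (simp add: X_def field_simps)
      then have "B * C * K * \<Lambda> * \<phi> x \<le> (x - D) * (\<delta> / 2) * \<phi> x"
        using \<phi>0 by (rule mult_right_mono)
      then have a: "B * ?S x * \<Lambda> \<le> (x - D) * (\<delta> / 2 * \<phi> x)" by (simp add: mult_ac)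
      have "x * (\<delta> / 4 * \<phi> x) \<le> (2 * (x - D)) * (\<delta> / 4 * \<phi> x)"
        using elim \<delta> \<phi>0[of x] by (intro mult_right_mono) auto
      also have "\<dots> = (x - D) * (\<delta> / 2 * \<phi> x)" by simp
      finally have b: "x * (\<delta> / 4 * \<phi> x) \<le> (x - D) * (\<delta> / 2 * \<phi> x)" .
      have "(x + D) * (k (x - B) * Q) \<le> (1 + \<delta>) * (x - D) * (k (x - B) * Q)"
        using elim k(2) Q by (intro mult_right_mono) auto
      then have d: "(x + D) * k (x - B) * Q \<le> (x - D) * ((1 + \<delta>) * Q * k (x - B))" by (simp add: mult_ac)
      have "(x - D) * q x \<le> (x - D) * (\<delta> / 2 * \<phi> x) + (x - D) * (\<delta> / 2 * \<phi> x)
          + (x - D) * ((1 + \<delta>) * Q * k (x - B))"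
        using main a b d by linarith
      also have "\<dots> = (x - D) * (\<delta> * \<phi> x + (1 + \<delta>) * Q * k (x - B))" by (simp add: algebra_simps)
      finally show ?case using x(3) by (simp add: mult_le_cancel_left)
    qed
  qed
qed

end

section \<open>The law and its jump density\<close>

lemma convolution_return_0:
  assumes "real_distribution P" shows "(P \<star> return borel 0) = P"
  by (rule Levy_uniqueness)
     (auto simp: fun_eq_iff char_convolution char_return assms real_distribution_return
       intro: real_distribution_convolution)

text \<open>
  A law \<open>P \<star> M\<close> with a light factor \<open>M\<close>, where \<open>P\<close> has the size bias of a compound Poisson law with
  decreasing jump density \<open>k\<close>. The setting is closed under self-convolution, with \<open>k\<close>
  replaced by \<open>2 k\<close> (\<open>jump_decomposition_double\<close>); a description of \<open>P\<close> by its construction would not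
  show this as directly.
\<close>

locale jump_decomposition =
  fixes c \<Lambda> :: real and k :: "real \<Rightarrow> real" and P M :: "real measure"
  assumes c: "0 < c" and size_bias: "size_bias_identity P k" and light: "light_right_tail M"
    and k: "k \<in> borel_measurable borel" "\<And>x. 0 \<le> k x" "\<And>x. x \<le> 1 \<Longrightarrow> k x = 0" "antimono_on {1<..} k"
      "(\<integral>\<^sup>+x. ennreal (k x) \<partial>lborel) = ennreal \<Lambda>"
    and \<Lambda>: "0 \<le> \<Lambda>"
begin

sublocale P: real_distribution P using size_bias by (simp add: size_bias_identity_def)
sublocale M: real_distribution M using light by (simp add: light_right_tail_def)

lemmas finP = P.finite_measure_axioms and setsP = P.events_eq_borel
lemmas finM = M.finite_measure_axioms and setsM = M.events_eq_borel

abbreviation m :: "real \<Rightarrow> real" where "m \<equiv> local_mass c (P \<star> M)"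
abbreviation \<pi> :: "real \<Rightarrow> real" where "\<pi> \<equiv> local_mass c P"

definition truncated_mass :: "real \<Rightarrow> real \<Rightarrow> real" where
  "truncated_mass A = local_mass c (P \<star> restr M {-A..A})"

lemma real_distribution_law: "real_distribution (P \<star> M)"
  by (rule real_distribution_convolution[OF P.real_distribution_axioms M.real_distribution_axioms])

lemma measurable_pi [measurable]: "\<pi> \<in> borel_measurable borel"
  by (rule measurable_local_mass[OF finP setsP c])

lemma measurable_m [measurable]: "m \<in> borel_measurable borel"
  using real_distribution_law
  by (intro measurable_local_mass[OF _ _ c])
     (auto simp: real_distribution_def real_distribution_axioms_def prob_space_def)

lemma pi_le_1: "\<pi> x \<le> 1"
  by (auto simp: local_mass_def)

lemma m_nonneg: "0 \<le> m x"
  by (simp add: local_mass_def)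

lemma size_biased_density_convolution:
  assumes \<sigma>: "finite_measure \<sigma>" "sets \<sigma> = sets borel" "AE y in \<sigma>. \<bar>y\<bar> \<le> A" and A: "0 \<le> A"
  shows "size_biased_density (local_mass c (P \<star> \<sigma>)) k (A + c) (c * measure \<sigma> UNIV) \<Lambda>"
proof
  interpret \<sigma>: finite_measure \<sigma> by fact
  have fin: "finite_measure (P \<star> \<sigma>)"
    by (rule convolution_finite) (auto simp: \<sigma> finP)
  show "local_mass c (P \<star> \<sigma>) \<in> borel_measurable borel"
    by (rule measurable_local_mass[OF fin _ c]) simp
  have "emeasure (P \<star> \<sigma>) UNIV = (\<integral>\<^sup>+x. \<integral>\<^sup>+y. indicator UNIV (x + y) \<partial>\<sigma> \<partial>P)"
    by (rule convolution_emeasure') (auto simp: \<sigma> finP)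
  also have "\<dots> = emeasure \<sigma> UNIV"
    using P.emeasure_space_1 sets_eq_imp_space_eq[OF \<sigma>(2)] by simp
  finally have "measure (P \<star> \<sigma>) UNIV = measure \<sigma> UNIV" by (simp add: measure_def)
  then show "(\<integral>\<^sup>+x. ennreal (local_mass c (P \<star> \<sigma>) x) \<partial>lborel) = ennreal (c * measure \<sigma> UNIV)"
    by (subst nn_integral_local_mass[OF fin _ c]) auto
  show "local_mass c (P \<star> \<sigma>) x = 0" if x: "x < - (A + c)" for x
  proof -
    have \<pi>0: "\<pi> z = 0" if "z < - c" for z
    proof -
      have "AE t in P. 0 \<le> t" using size_bias by (simp add: size_bias_identity_def)
      then have "AE t in P. t \<notin> {z<..z + c}" by eventually_elim (use that in auto)
      then show ?thesis
        unfolding local_mass_def by (intro P.prob_eq_0[THEN iffD2]) auto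
    qed
    have "ennreal (local_mass c (P \<star> \<sigma>) x) = (\<integral>\<^sup>+y. ennreal (\<pi> (x - y)) \<partial>\<sigma>)"
      by (rule local_mass_convolution[OF finP setsP c \<sigma>(1,2)])
    also have "\<dots> = (\<integral>\<^sup>+y. 0 \<partial>\<sigma>)"
      by (rule nn_integral_cong_AE, use \<sigma>(3) in eventually_elim) (use x \<pi>0 in auto)
    finally show ?thesis by (simp add: local_mass_def)
  qed
qed (use k c A \<Lambda> local_mass_size_bias[OF size_bias \<sigma> k(1) A c] in \<open>auto simp: local_mass_def\<close>)

lemma restr_M:
  assumes "0 \<le> A"
  shows "finite_measure (restr M {-A..A})" "sets (restr M {-A..A}) = sets borel"
    "AE y in restr M {-A..A}. \<bar>y\<bar> \<le> A" "measure (restr M {-A..A}) UNIV = measure M {-A..A}"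
proof -
  have e: "emeasure (restr M {-A..A}) UNIV = emeasure M {-A..A}"
    by (subst emeasure_density) (auto simp: ennreal_indicator)
  show "finite_measure (restr M {-A..A})" by (rule finite_measureI) (simp add: e)
  show "measure (restr M {-A..A}) UNIV = measure M {-A..A}" by (simp add: e measure_def)
  show "AE y in restr M {-A..A}. \<bar>y\<bar> \<le> A" by (subst AE_density) (auto simp: indicator_def)
qed simp

lemma size_biased_truncated:
  assumes "0 \<le> A"
  shows "size_biased_density (truncated_mass A) k (A + c) (c * measure M {-A..A}) \<Lambda>"
  using size_biased_density_convolution[OF restr_M(1-3)[OF assms] assms] restr_M(4)[OF assms]
  by (simp add: truncated_mass_def)

lemma truncated_mass_eq:
  assumes "0 \<le> A"
  shows "ennreal (truncated_mass A x) = (\<integral>\<^sup>+y. ennreal (\<pi> (x - y)) * indicator {-A..A} y \<partial>M)"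
  unfolding truncated_mass_def local_mass_convolution[OF finP setsP c restr_M(1,2)[OF assms]]
  by (subst nn_integral_density) (auto simp: ennreal_indicator mult.commute)

lemma m_split:
  assumes "0 \<le> A"
  shows "ennreal (m x) = ennreal (truncated_mass A x) + (\<integral>\<^sup>+y. ennreal (\<pi> (x - y)) * indicator (- {-A..A}) y \<partial>M)"
  unfolding truncated_mass_eq[OF assms] local_mass_convolution[OF finP setsP c finM setsM]
  by (subst nn_integral_add[symmetric]) (auto simp: indicator_def intro!: nn_integral_cong)

lemma truncated_mass_nonneg: "0 \<le> truncated_mass A x"
  by (simp add: truncated_mass_def local_mass_def)

lemma truncated_mass_le: "0 \<le> A \<Longrightarrow> truncated_mass A x \<le> m x"
proof -
  assume "0 \<le> A"
  then have "ennreal (truncated_mass A x) \<le> ennreal (m x)" by (simp add: m_split)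
  then show ?thesis by (simp add: m_nonneg)
qed

lemma truncation_mass:
  assumes "0 < \<epsilon>"
  obtains A0 where "\<And>A. A0 \<le> A \<Longrightarrow> 1 - \<epsilon> \<le> measure M {-A..A}"
proof -
  have "(\<integral>\<^sup>+y. 1 \<partial>M) = ennreal 1" using M.emeasure_space_1 by simp
  then obtain A0 where A0: "\<And>A. A0 \<le> A \<Longrightarrow> ennreal (1 - \<epsilon>) \<le> (\<integral>\<^sup>+y. 1 * indicator {-A..<A} y \<partial>M)"
    using nn_integral_mass_below[OF _ setsM, of "\<lambda>_. 1" 1 \<epsilon>] assms by auto
  show thesis
  proof (rule that[of A0])
    fix A assume "A0 \<le> A"
    from A0[OF this] have "ennreal (1 - \<epsilon>) \<le> emeasure M {-A..<A}" by simp
    also have "\<dots> \<le> emeasure M {-A..A}" by (rule emeasure_mono) auto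
    finally show "1 - \<epsilon> \<le> measure M {-A..A}"
      unfolding M.emeasure_eq_measure ennreal_le_iff[OF measure_nonneg] .
  qed
qed

text \<open>
  A bounded part of the light factor carries almost all of its mass and almost all of \<open>m\<close>.
  Bounded support is what makes the size-bias identity applicable; \<open>M\<close> itself may have infinite mean.
\<close>

lemma truncation:
  assumes \<phi>: "\<phi> \<in> long_tailed_fun" "almost_decreasing \<phi>"
    and O: "\<pi> \<in> O(\<phi>)" and \<epsilon>: "0 < \<epsilon>"
  obtains A where "0 \<le> A" "1 - \<epsilon> \<le> measure M {-A..A}" "\<forall>\<^sub>F x in at_top. m x \<le> truncated_mass A x + \<epsilon> * \<phi> x"
proof -
  obtain A0 where A0: "\<And>A. A0 \<le> A \<Longrightarrow> 1 - \<epsilon> \<le> measure M {-A..A}"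
    by (rule truncation_mass[OF \<epsilon>], rule that; assumption)
  obtain A1 where A1: "\<And>A. A1 \<le> A \<Longrightarrow> \<forall>\<^sub>F x in at_top.
      (\<integral>\<^sup>+y. ennreal (\<pi> (x - y)) * indicator (- {-A..A}) y \<partial>M) \<le> ennreal (\<epsilon> * \<phi> x)"
    by (rule light_tail_negligible[OF \<phi> light measurable_pi local_mass_nonneg[OF finP setsP c] pi_le_1 O \<epsilon>],
        rule that; assumption)
  define A where "A = max 0 (max A0 A1)"
  show thesis
  proof (rule that[of A])
    show "0 \<le> A" "1 - \<epsilon> \<le> measure M {-A..A}" using A0[of A] by (auto simp: A_def)
    have "\<forall>\<^sub>F x in at_top. (\<integral>\<^sup>+y. ennreal (\<pi> (x - y)) * indicator (- {-A..A}) y \<partial>M) \<le> ennreal (\<epsilon> * \<phi> x)"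
      by (rule A1) (simp add: A_def)
    then show "\<forall>\<^sub>F x in at_top. m x \<le> truncated_mass A x + \<epsilon> * \<phi> x"
    proof eventually_elim
      case (elim x)
      have p: "0 \<le> truncated_mass A x" "0 \<le> \<epsilon> * \<phi> x"
        using \<epsilon> long_tailedD(2)[OF \<phi>(1)] by (auto simp: truncated_mass_nonneg)
      have "ennreal (m x) \<le> ennreal (truncated_mass A x) + ennreal (\<epsilon> * \<phi> x)"
        using elim m_split[OF \<open>0 \<le> A\<close>, of x] by (simp add: add_left_mono)
      also have "\<dots> = ennreal (truncated_mass A x + \<epsilon> * \<phi> x)" using p by (simp add: ennreal_plus)
      finally show ?case by (rule ennreal_le_iff[OF add_nonneg_nonneg[OF p], THEN iffD1])
    qed
  qed
qed

text \<open>
  The truncation level, and with it the shift \<open>D\<close>, depends on \<open>\<delta>\<close>; \<open>asymp_leI_shift\<close> removes the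
  shift.
\<close>

lemma density_le_law:
  assumes \<delta>: "0 < \<delta>" "\<delta> < 1"
  obtains D where "\<forall>\<^sub>F x in at_top. (1 - \<delta>) * (c * k (x + D)) \<le> (1 + \<delta>) * m x"
proof -
  have \<delta>2: "0 < \<delta> / 2" using \<delta> by simp
  obtain A0 where A0: "\<And>A. A0 \<le> A \<Longrightarrow> 1 - \<delta> / 2 \<le> measure M {-A..A}"
    by (rule truncation_mass[OF \<delta>2], rule that; assumption)
  define A where "A = max 0 A0"
  have A: "0 \<le> A" "1 - \<delta> / 2 \<le> measure M {-A..A}" using A0[of A] by (auto simp: A_def)
  interpret size_biased_density "truncated_mass A" k "A + c" "c * measure M {-A..A}" \<Lambda>
    by (rule size_biased_truncated[OF A(1)])
  define \<eta> where "\<eta> = min \<delta> (c * \<delta> / 2)"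
  have \<eta>: "0 < \<eta>" "\<eta> \<le> \<delta>" "\<eta> \<le> c * \<delta> / 2" using \<delta> c by (auto simp: \<eta>_def)
  have "c * (1 - \<delta> / 2) \<le> c * measure M {-A..A}" using A c by (intro mult_left_mono) auto
  then have Q: "(1 - \<delta>) * c \<le> c * measure M {-A..A} - \<eta>" using \<eta> by (simp add: algebra_simps)
  from density_le[OF \<eta>(1)] have "\<forall>\<^sub>F x in at_top. (1 - \<delta>) * (c * k (x + (A + c))) \<le> (1 + \<delta>) * m x"
  proof eventually_elim
    case (elim x)
    have "(1 - \<delta>) * (c * k (x + (A + c))) = (1 - \<delta>) * c * k (x + (A + c))" by simp
    also have "\<dots> \<le> (c * measure M {-A..A} - \<eta>) * k (x + (A + c))"
      using Q k(2) by (rule mult_right_mono)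
    also have "\<dots> \<le> (1 + \<eta>) * truncated_mass A x" by (rule elim)
    also have "\<dots> \<le> (1 + \<delta>) * m x"
      using \<eta> truncated_mass_le[OF A(1), of x] truncated_mass_nonneg by (intro mult_mono) auto
    finally show ?case .
  qed
  then show thesis by (rule that)
qed

lemma law_le_density:
  assumes \<phi>: "\<phi> \<in> long_tailed_fun" "almost_decreasing \<phi>" "small_middle \<phi>"
    and O: "\<pi> \<in> O(\<phi>)" "m \<in> O(\<phi>)" "k \<in> O(\<phi>)"
    and \<delta>: "0 < \<delta>"
  obtains B where "\<forall>\<^sub>F x in at_top. m x \<le> \<delta> * \<phi> x + (1 + \<delta>) * c * k (x - B)"
proof -
  have \<delta>2: "0 < \<delta> / 2" using \<delta> by simp
  obtain A where A: "0 \<le> A" "\<forall>\<^sub>F x in at_top. m x \<le> truncated_mass A x + \<delta> / 2 * \<phi> x"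
    by (rule truncation[OF \<phi>(1,2) O(1) \<delta>2], rule that; assumption)
  interpret size_biased_density "truncated_mass A" k "A + c" "c * measure M {-A..A}" \<Lambda>
    by (rule size_biased_truncated[OF A(1)])
  have "truncated_mass A \<in> O(m)"
    using truncated_mass_le[OF A(1)] by (intro bigoI[of _ 1]) (auto simp: truncated_mass_nonneg m_nonneg)
  then have qO: "truncated_mass A \<in> O(\<phi>)" using O(2) by (rule landau_o.big_trans)
  obtain B where B: "\<forall>\<^sub>F x in at_top. truncated_mass A x \<le> \<delta> / 2 * \<phi> x
      + (1 + \<delta> / 2) * (c * measure M {-A..A}) * k (x - B)"
    by (rule le_density[OF \<phi> qO O(3) \<delta>2], rule that; assumption)
  have "\<forall>\<^sub>F x in at_top. m x \<le> \<delta> * \<phi> x + (1 + \<delta>) * c * k (x - B)"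
    using A(2) B
  proof eventually_elim
    case (elim x)
    have "(1 + \<delta> / 2) * (c * measure M {-A..A}) \<le> (1 + \<delta>) * (c * 1)"
      using \<delta> c by (intro mult_mono) auto
    then have "(1 + \<delta> / 2) * (c * measure M {-A..A}) * k (x - B) \<le> (1 + \<delta>) * c * k (x - B)"
      using k(2) by (intro mult_right_mono) auto
    then show ?case using elim by linarith
  qed
  then show thesis by (rule that)
qed

lemma k_almost_decreasing: "almost_decreasing k"
  unfolding almost_decreasing_def
proof (intro exI[of _ 1] conjI allI impI)
  fix x y :: real assume "1 < x" "0 < y"
  then show "k (x + y) \<le> 1 * k x" using k(4) by (auto simp: monotone_on_def)
qed auto

lemma density_preceq_law:
  assumes "k \<in> long_tailed_fun \<or> m \<in> long_tailed_fun"
  shows "(\<lambda>x. c * k x) \<preceq> m"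
proof (rule asymp_leI_shift)
  show "(\<lambda>x. c * k x) \<in> long_tailed_fun \<or> m \<in> long_tailed_fun"
    using assms c long_tailed_cmult by blast
  fix \<delta> :: real assume "0 < \<delta>" "\<delta> < 1"
  then show "\<exists>D. \<forall>\<^sub>F x in at_top. (1 - \<delta>) * (c * k (x + D)) \<le> (1 + \<delta>) * m x"
    by (rule density_le_law) blast
qed (use c k(2) m_nonneg in auto)

theorem law_regular_imp_density_asymp:
  assumes lt: "m \<in> long_tailed_fun" and ad: "almost_decreasing m" and sm: "small_middle m"
  shows "(\<lambda>x. c * k x) \<preceq> m" "m \<preceq> (\<lambda>x. c * k x)"
proof -
  show le: "(\<lambda>x. c * k x) \<preceq> m" using lt by (intro density_preceq_law) simp
  have "\<pi> \<in> O(m)"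
    by (rule factor_local_mass_bigo[OF P.real_distribution_axioms M.real_distribution_axioms c lt ad])
  moreover have "k \<in> O(m)"
    using asymp_le_imp_bigo[OF le] c k(2) m_nonneg by simp
  ultimately have O: "\<pi> \<in> O(m)" "m \<in> O(m)" "k \<in> O(m)" by auto
  show "m \<preceq> (\<lambda>x. c * k x)"
  proof (rule asymp_leI_shift)
    fix \<delta> :: real assume \<delta>: "0 < \<delta>" "\<delta> < 1"
    obtain B where B: "\<forall>\<^sub>F x in at_top. m x \<le> \<delta> * m x + (1 + \<delta>) * c * k (x - B)"
      by (rule law_le_density[OF lt ad sm O \<delta>(1)], rule that; assumption)
    have "\<forall>\<^sub>F x in at_top. (1 - \<delta>) * m (x + B) \<le> (1 + \<delta>) * (c * k x)"
      using eventually_at_top_shift[OF B, of B] by eventually_elim (simp add: algebra_simps)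
    then show "\<exists>D. \<forall>\<^sub>F x in at_top. (1 - \<delta>) * m (x + D) \<le> (1 + \<delta>) * (c * k x)" by blast
  qed (use lt c k(2) m_nonneg in auto)
qed

text \<open>
  In \<open>lower_split\<close> the first term is already about \<open>x c k(x)\<close>, as is the right-hand side, so the weighted
  middle part is at most \<open>\<epsilon> x k(x)\<close>. There \<open>q\<close> is at least a multiple of \<open>k\<close>, and the integrand
  \<open>k(x - u) k(u)\<close> is symmetric about \<open>x / 2\<close>, so that the weight \<open>u\<close> averages to \<open>x / 2\<close>.
\<close>

theorem density_asymp_imp_small_middle:
  assumes lt: "k \<in> long_tailed_fun" and le: "(\<lambda>x. c * k x) \<preceq> m" "m \<preceq> (\<lambda>x. c * k x)"
  shows "small_middle k"
proof (rule small_middleI)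
  note [measurable] = k(1)
  have mlt: "m \<in> long_tailed_fun"
    by (rule long_tailed_transfer[OF long_tailed_cmult[OF lt c] measurable_m m_nonneg le])
  have lo: "\<forall>\<^sub>F x in at_top. c * k x \<le> 2 * m x" using le(1) by (rule asymp_leD) simp
  have mad: "almost_decreasing m"
    by (rule almost_decreasing_bigtheta[OF k_almost_decreasing k(2) m_nonneg])
       (rule bigtheta_if_asymp_le[OF le(2,1) c m_nonneg k(2)])
  have O: "\<pi> \<in> O(m)"
    by (rule factor_local_mass_bigo[OF P.real_distribution_axioms M.real_distribution_axioms c mlt mad])
  fix \<eta> :: real assume \<eta>: "0 < \<eta>"
  \<comment> \<open>The estimate below loses the factor \<open>8\<close> in the numerator and \<open>1 / 8\<close> from \<open>c / 4\<close> and the average weight \<open>x / 2\<close>.\<close>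
  define \<epsilon> where "\<epsilon> = min (1 / 2) (\<eta> / 64)"
  have \<epsilon>: "0 < \<epsilon>" "\<epsilon> \<le> 1 / 2" "64 * \<epsilon> \<le> \<eta>" using \<eta> by (auto simp: \<epsilon>_def)
  obtain A where A: "0 \<le> A" "1 - \<epsilon> \<le> measure M {-A..A}" "\<forall>\<^sub>F x in at_top. m x \<le> truncated_mass A x + \<epsilon> * m x"
    by (rule truncation[OF mlt mad O \<epsilon>(1)], rule that; assumption)
  define D where "D = A + c"
  interpret size_biased_density "truncated_mass A" k D "c * measure M {-A..A}" \<Lambda>
    unfolding D_def by (rule size_biased_truncated[OF A(1)])
  let ?q = "truncated_mass A"
  have "\<forall>\<^sub>F x in at_top. c / 4 * k x \<le> ?q x"
    using A(3) lo
  proof eventually_elim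
    case (elim x)
    have "\<epsilon> * m x \<le> 1 / 2 * m x" using \<epsilon> m_nonneg by (intro mult_right_mono) auto
    then show ?case using elim by simp
  qed
  then obtain x3 where x3: "\<And>x. x3 \<le> x \<Longrightarrow> c / 4 * k x \<le> ?q x"
    by (auto simp: eventually_at_top_linorder)
  have "0 < c * \<epsilon>" using c \<epsilon> by simp
  from nn_integral_mass_below[of "\<lambda>x. ennreal (?q x)" lborel, OF _ _ q(4) this]
  obtain B0 where B0: "\<And>B. B0 \<le> B \<Longrightarrow>
      ennreal (c * measure M {-A..A} - c * \<epsilon>) \<le> (\<integral>\<^sup>+x. ennreal (?q x) * indicator {-B..<B} x \<partial>lborel)"
    by auto
  define B where "B = max (max B0 x3) 1"
  have B: "1 \<le> B" by (simp add: B_def)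
  have mass: "ennreal (c * (1 - 2 * \<epsilon>)) \<le> (\<integral>\<^sup>+x. ennreal (?q x) * indicator {-B..<B} x \<partial>lborel)"
  proof -
    have "c * (1 - \<epsilon>) \<le> c * measure M {-A..A}" using A c by (intro mult_left_mono) auto
    then have "ennreal (c * (1 - 2 * \<epsilon>)) \<le> ennreal (c * measure M {-A..A} - c * \<epsilon>)"
      by (intro ennreal_leI) (simp add: algebra_simps)
    also have "\<dots> \<le> (\<integral>\<^sup>+x. ennreal (?q x) * indicator {-B..<B} x \<partial>lborel)" by (rule B0) (simp add: B_def)
    finally show ?thesis .
  qed
  have kD: "\<forall>\<^sub>F x in at_top. k x \<le> (1 + \<epsilon>) * k (x + D)"
    using \<epsilon> by (intro asymp_leD long_tailed_preceq_shift[OF lt]) auto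
  have mk: "\<forall>\<^sub>F x in at_top. m x \<le> (1 + \<epsilon>) * (c * k x)"
    using le(2) \<epsilon> by (intro asymp_leD) auto
  have "\<forall>\<^sub>F x in at_top. middle k k B x \<le> ennreal (\<eta> * k x)"
    using kD mk eventually_gt_at_top[of "B + 1"] eventually_ge_at_top[of "B / \<epsilon>"] eventually_ge_at_top[of "D / \<epsilon>"]
  proof eventually_elim
    case (elim x)
    have x: "1 < x - B" "0 < x" using elim B by auto
    have xB: "(1 - \<epsilon>) * x \<le> x - B" and xD: "x + D \<le> (1 + \<epsilon>) * x"
      using elim \<epsilon> by (simp_all add: field_simps)
    let ?I = "\<integral>\<^sup>+u. ennreal (u * k u) * ennreal (?q (x - u)) * indicator {B..x - B} u \<partial>lborel"
    let ?a = "(x - B) * k (x + D) * (c * (1 - 2 * \<epsilon>))"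
    have a0: "0 \<le> ?a" using x k(2) c \<epsilon> by (intro mult_nonneg_nonneg) auto
    have "ennreal ?a + ?I \<le> ennreal ((x - B) * k (x + D)) *
        (\<integral>\<^sup>+x. ennreal (?q x) * indicator {-B..<B} x \<partial>lborel) + ?I"
      using x k(2)[of "x + D"] by (subst ennreal_mult') (auto intro!: add_right_mono mult_left_mono mass)
    also have "\<dots> \<le> ennreal ((x + D) * ?q x)" using x B by (intro lower_split) auto
    finally have I: "?I \<le> ennreal ((x + D) * ?q x - ?a)" using a0 by (rule ennreal_le_diffI)
    have "(x + D) * ?q x \<le> ((1 + \<epsilon>) * x) * ((1 + \<epsilon>) * (c * k x))"
      using xD elim(2) truncated_mass_le[OF A(1), of x] truncated_mass_nonneg x \<epsilon> A(1) c
      by (intro mult_mono) (auto simp: D_def)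
    moreover have "((1 - \<epsilon>) * x) * ((1 - \<epsilon>) * k x) * (c * (1 - 2 * \<epsilon>)) \<le> ?a"
    proof -
      have "(1 - \<epsilon>) * k x \<le> (1 - \<epsilon>) * ((1 + \<epsilon>) * k (x + D))"
        using elim \<epsilon> by (intro mult_left_mono) auto
      also have "\<dots> = (1 - \<epsilon> * \<epsilon>) * k (x + D)" by (simp add: algebra_simps)
      also have "\<dots> \<le> 1 * k (x + D)" using k(2) by (intro mult_right_mono) auto
      finally have "(1 - \<epsilon>) * k x \<le> k (x + D)" by simp
      then show ?thesis
        using xB x k(2) c \<epsilon> by (intro mult_right_mono mult_mono) auto
    qed
    moreover have "((1 + \<epsilon>) * x) * ((1 + \<epsilon>) * (c * k x)) - ((1 - \<epsilon>) * x) * ((1 - \<epsilon>) * k x) * (c * (1 - 2 * \<epsilon>))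
        = (x * (c * k x)) * (6 * \<epsilon> - 4 * (\<epsilon> * \<epsilon>) + 2 * (\<epsilon> * \<epsilon> * \<epsilon>))"
      by (simp add: algebra_simps)
    moreover have "\<epsilon> * \<epsilon> * \<epsilon> \<le> \<epsilon> * \<epsilon> * 1" using \<epsilon> by (intro mult_left_mono) auto
    then have "6 * \<epsilon> - 4 * (\<epsilon> * \<epsilon>) + 2 * (\<epsilon> * \<epsilon> * \<epsilon>) \<le> 8 * \<epsilon>"
      using \<epsilon> zero_le_square[of \<epsilon>] by linarith
    then have "(x * (c * k x)) * (6 * \<epsilon> - 4 * (\<epsilon> * \<epsilon>) + 2 * (\<epsilon> * \<epsilon> * \<epsilon>)) \<le> (x * (c * k x)) * (8 * \<epsilon>)"
      using x c k(2) by (intro mult_left_mono) auto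
    ultimately have "(x + D) * ?q x - ?a \<le> (x * (c * k x)) * (8 * \<epsilon>)" by linarith
    with I have I8: "?I \<le> ennreal ((x * (c * k x)) * (8 * \<epsilon>))"
      by (meson ennreal_leI order.trans)
    let ?g = "\<lambda>u. ennreal (k (x - u) * k u) * indicator {B..x - B} u"
    let ?J = "\<integral>\<^sup>+u. ennreal u * ?g u \<partial>lborel"
    have "?J = (\<integral>\<^sup>+u. ennreal (x - u) * ?g (x - u) \<partial>lborel)"
      by (rule nn_integral_reflect[symmetric]) measurable
    also have "\<dots> = (\<integral>\<^sup>+u. ennreal (x - u) * ?g u \<partial>lborel)"
      by (intro nn_integral_cong) (auto simp: indicator_def mult.commute)
    finally have "?J + ?J = ?J + (\<integral>\<^sup>+u. ennreal (x - u) * ?g u \<partial>lborel)" by simp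
    also have "\<dots> = (\<integral>\<^sup>+u. ennreal u * ?g u + ennreal (x - u) * ?g u \<partial>lborel)"
      by (rule nn_integral_add[symmetric]) measurable
    also have "\<dots> = (\<integral>\<^sup>+u. ennreal x * ?g u \<partial>lborel)"
      using B by (intro nn_integral_cong)
        (auto simp: indicator_def distrib_right[symmetric] ennreal_plus[symmetric] simp del: ennreal_plus)
    also have "\<dots> = ennreal x * middle k k B x"
      unfolding middle_def by (rule nn_integral_cmult) measurable
    \<comment> \<open>Twice the weighted integral, by adding its reflection.\<close>
    finally have JJ: "?J + ?J = ennreal x * middle k k B x" .
    have "ennreal (c / 4) * ?J = (\<integral>\<^sup>+u. ennreal (c / 4) * (ennreal u * ?g u) \<partial>lborel)"
      by (rule nn_integral_cmult[symmetric]) measurable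
    also have "\<dots> \<le> ?I"
    proof (rule nn_integral_mono)
      fix u
      show "ennreal (c / 4) * (ennreal u * ?g u) \<le> ennreal (u * k u) * ennreal (?q (x - u)) * indicator {B..x - B} u"
      proof (cases "u \<in> {B..x - B}")
        case True
        have "c / 4 * k (x - u) \<le> ?q (x - u)" using True by (intro x3) (auto simp: B_def)
        then have "u * k u * (c / 4 * k (x - u)) \<le> u * k u * ?q (x - u)"
          using True B k(2) by (intro mult_left_mono) auto
        then show ?thesis
          using True B k(2) c q(2) by (simp add: ennreal_mult[symmetric] mult_ac ennreal_leI)
      qed simp
    qed
    finally have "ennreal (c / 4) * ?J \<le> ennreal ((x * (c * k x)) * (8 * \<epsilon>))" using I8 by (rule order.trans)
    then have "ennreal (c / 4) * ?J + ennreal (c / 4) * ?J \<le>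
        ennreal ((x * (c * k x)) * (8 * \<epsilon>)) + ennreal ((x * (c * k x)) * (8 * \<epsilon>))"
      by (intro add_mono)
    also have "\<dots> = ennreal (c / 4 * x) * ennreal (64 * \<epsilon> * k x)"
      using x c k(2) \<epsilon> by (simp add: ennreal_mult[symmetric] ennreal_plus[symmetric] mult_ac del: ennreal_plus)
    finally have "ennreal (c / 4) * (ennreal x * middle k k B x) \<le> ennreal (c / 4 * x) * ennreal (64 * \<epsilon> * k x)"
      by (simp only: distrib_left[symmetric] JJ)
    moreover have "ennreal (c / 4 * x) = ennreal (c / 4) * ennreal x"
      by (rule ennreal_mult) (use c x in auto)
    ultimately have "ennreal (c / 4 * x) * middle k k B x \<le> ennreal (c / 4 * x) * ennreal (64 * \<epsilon> * k x)"
      by (simp only: mult.assoc)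
    then have "middle k k B x \<le> ennreal (64 * \<epsilon> * k x)"
      using c x by (subst (asm) ennreal_mult_le_mult_iff) auto
    also have "\<dots> \<le> ennreal (\<eta> * k x)" using \<epsilon> k(2) by (intro ennreal_leI mult_right_mono) auto
    finally show ?case .
  qed
  then show "\<exists>B. \<forall>\<^sub>F x in at_top. middle k k B x \<le> ennreal (\<eta> * k x)" by blast
qed

text \<open>
  An a priori bound for the local mass \<open>\<pi>\<close> of \<open>P\<close>. Let \<open>s(x)\<close> be the supremum of \<open>\<pi> / k\<close> on \<open>[B,x]\<close>, which
  is finite because \<open>\<pi> \<le> 1\<close> and \<open>k\<close> is bounded below there. Inserting \<open>\<pi> \<le> s(x) k\<close> into \<open>upper_split\<close>
  gives \<open>\<pi>(x) / k(x) \<le> s(x) / 2 + 6 c\<close>: the factor \<open>1 / 2\<close> collects the small \<open>u\<close>, where the weight is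
  bounded, and the middle part, where \<open>\<epsilon> = 1 / 8\<close> was chosen. Hence \<open>s\<close> is bounded.
\<close>

lemma pi_bigo_density:
  assumes lt: "k \<in> long_tailed_fun" and sm: "small_middle k"
  shows "\<pi> \<in> O(k)"
proof -
  note [measurable] = k(1)
  have r0: "finite_measure (return borel (0::real))" "measure (return borel (0::real)) UNIV = 1"
    by (auto intro!: prob_space.axioms(1) prob_space_return simp: measure_return)
  \<comment> \<open>The identity is applied to \<open>P\<close> itself, that is, with the point mass at \<open>0\<close> as the bounded factor.\<close>
  have "Measurable.pred borel (\<lambda>y::real. \<bar>y\<bar> \<le> 0)" by measurable
  then have "AE y in return borel (0::real). \<bar>y\<bar> \<le> 0" by (subst AE_return) auto
  then interpret size_biased_density \<pi> k c c \<Lambda>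
    using size_biased_density_convolution[of "return borel 0" 0] r0
    by (simp add: convolution_return_0 P.real_distribution_axioms)
  have \<pi>0: "0 \<le> \<pi> x" for x by (rule q(2))
  obtain x0 where x0: "\<And>x. x0 \<le> x \<Longrightarrow> 0 < k x"
    using long_tailedD(3)[OF lt] by (auto simp: eventually_at_top_linorder)
  have e8: "0 < (1 / 8 :: real)" by simp
  obtain B0 where B0: "\<And>B x. B0 \<le> B \<Longrightarrow> middle k k B x \<le> ennreal (1 / 8 * k x)"
    using sm e8 unfolding small_middle_def by meson
  define B where "B = max (max B0 x0) 2"
  have B: "2 \<le> B" "x0 \<le> B" "B0 \<le> B" by (auto simp: B_def)
  have kpos: "0 < k x" if "B \<le> x" for x using that B by (intro x0) auto
  have "\<forall>\<^sub>F x in at_top. k (x + - B) \<le> 2 * k x"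
    by (intro asymp_leD long_tailedD(4)[OF lt]) auto
  then obtain X1 where X1: "\<And>x. X1 \<le> x \<Longrightarrow> k (x - B) \<le> 2 * k x"
    by (auto simp: eventually_at_top_linorder)
  \<comment> \<open>From \<open>2 * c\<close> on, \<open>x - c \<ge> x / 2\<close> and \<open>x + c \<le> 3 / 2 * x\<close>; from \<open>16 * (B * \<Lambda>)\<close> on, the small \<open>u\<close> contribute at most \<open>s x / 4\<close>.\<close>
  define X0 where "X0 = max (max X1 (2 * B + 1)) (max (2 * c) (16 * (B * \<Lambda>)))"
  define s where "s x = (SUP t\<in>{B..x}. \<pi> t / k t)" for x
  have bdd: "bdd_above ((\<lambda>t. \<pi> t / k t) ` {B..x})" for x
  proof (rule bdd_aboveI2)
    fix t assume t: "t \<in> {B..x}"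
    show "\<pi> t / k t \<le> 1 / k x"
      using t B kpos[of x] pi_le_1 \<pi>0 by (intro frac_le k_antimono) auto
  qed
  have le_s: "\<pi> t \<le> s x * k t" if "B \<le> t" "t \<le> x" for t x
  proof -
    have "\<pi> t / k t \<le> s x" unfolding s_def using that by (intro cSUP_upper bdd) auto
    then show ?thesis using kpos[OF that(1)] by (simp add: field_simps)
  qed
  have s0: "0 \<le> s x" if "B \<le> x" for x
  proof -
    have "0 \<le> \<pi> x / k x" using \<pi>0 kpos[OF that] by simp
    also have "\<dots> \<le> s x" unfolding s_def using that by (intro cSUP_upper bdd) auto
    finally show ?thesis .
  qed
  have s_mono: "s x \<le> s y" if "B \<le> x" "x \<le> y" for x y
    unfolding s_def using that by (intro cSUP_subset_mono bdd) auto
  have step: "\<pi> x \<le> (s x / 2 + 6 * c) * k x" if "X0 \<le> x" for x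
  proof -
    have x: "X1 \<le> x" "2 * B < x" "B \<le> x" "2 * c \<le> x" "16 * (B * \<Lambda>) \<le> x"
      using that B by (auto simp: X0_def)
    have S0: "0 \<le> s x * (2 * k x)" using s0[OF x(3)] k(2) by simp
    have "middle \<pi> k B x \<le> ennreal (s x) * middle k k B x"
    proof (rule middle_mono)
      fix u assume "B \<le> u" "u \<le> x - B"
      then have "\<pi> (x - u) \<le> s x * k (x - u)" using B by (intro le_s) auto
      then show "\<pi> (x - u) * k u \<le> s x * (k (x - u) * k u)"
        using k(2)[of u] mult_right_mono[of "\<pi> (x - u)" "s x * k (x - u)" "k u"] by (simp add: mult.assoc)
    qed (use s0[OF x(3)] in auto)
    also have "\<dots> \<le> ennreal (s x) * ennreal (1 / 8 * k x)"
      by (intro mult_left_mono B0 B) simp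
    also have "\<dots> = ennreal (s x * (1 / 8 * k x))"
      using s0[OF x(3)] by (rule ennreal_mult'[symmetric])
    finally have mid: "middle \<pi> k B x \<le> ennreal (s x * (1 / 8 * k x))" .
    have "ennreal ((x - c) * \<pi> x) \<le> ennreal (B * (s x * (2 * k x)) * \<Lambda>) + ennreal x * middle \<pi> k B x
        + ennreal ((x + c) * k (x - B) * c)"
    proof (rule upper_split[OF _ x(2) S0])
      fix y assume y: "x - B \<le> y" "y \<le> x"
      have "\<pi> y \<le> s x * k y" using y x by (intro le_s) auto
      also have "\<dots> \<le> s x * k (x - B)"
        using y x B s0[OF x(3)] by (intro mult_left_mono k_antimono) auto
      also have "\<dots> \<le> s x * (2 * k x)" using X1[OF x(1)] s0[OF x(3)] by (rule mult_left_mono)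
      finally show "\<pi> y \<le> s x * (2 * k x)" .
    qed (use B in auto)
    also have "\<dots> \<le> ennreal (B * (s x * (2 * k x)) * \<Lambda>) + ennreal x * ennreal (s x * (1 / 8 * k x))
        + ennreal ((x + c) * k (x - B) * c)"
      by (intro add_right_mono add_left_mono mult_left_mono mid) simp
    also have "\<dots> = ennreal (B * (s x * (2 * k x)) * \<Lambda> + x * (s x * (1 / 8 * k x)) + (x + c) * k (x - B) * c)"
      using x B S0 \<Lambda> k(2) c s0[OF x(3)]
      by (simp add: ennreal_mult[symmetric] ennreal_plus[symmetric] del: ennreal_plus)
    finally have main: "(x - c) * \<pi> x \<le>
        B * (s x * (2 * k x)) * \<Lambda> + x * (s x * (1 / 8 * k x)) + (x + c) * k (x - B) * c"
      using x B S0 \<Lambda> k(2) c s0[OF x(3)] by (subst (asm) ennreal_le_iff) (auto intro!: add_nonneg_nonneg)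
    have "16 * (B * \<Lambda>) * (s x * k x) \<le> x * (s x * k x)"
      using x(5) s0[OF x(3)] k(2) by (intro mult_right_mono) auto
    then have a: "B * (s x * (2 * k x)) * \<Lambda> \<le> x * (s x * k x) / 8" by (simp add: mult_ac)
    have "(x + c) * (k (x - B) * c) \<le> (3 / 2 * x) * (2 * k x * c)"
      using x c k(2) X1[OF x(1)] by (intro mult_mono) auto
    then have b: "(x + c) * k (x - B) * c \<le> 3 * (x * (c * k x))" by (simp add: mult_ac)
    have "x / 2 * \<pi> x \<le> (x - c) * \<pi> x" using x \<pi>0 by (intro mult_right_mono) auto
    moreover have "x * (s x * (1 / 8 * k x)) = x * (s x * k x) / 8" by simp
    ultimately have "x / 2 * \<pi> x \<le> x * (s x * k x) / 4 + 3 * (x * (c * k x))"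
      using main a b by linarith
    also have "\<dots> = x / 2 * ((s x / 2 + 6 * c) * k x)" by (simp add: algebra_simps)
    finally show ?thesis using x B by (simp add: mult_le_cancel_left)
  qed
  define C where "C = 1 / k X0 + 12 * c"
  have X0B: "B \<le> X0" using B by (simp add: X0_def)
  have C: "0 < C" using kpos[OF X0B] c by (simp add: C_def add_pos_pos)
  have s_le: "s x \<le> C" if x: "X0 \<le> x" for x
  proof -
    have "s x \<le> max (1 / k X0) (s x / 2 + 6 * c)"
      unfolding s_def[of x]
    proof (rule cSUP_least)
      show "{B..x} \<noteq> {}" using x X0B by auto
      fix t assume t: "t \<in> {B..x}"
      show "\<pi> t / k t \<le> max (1 / k X0) ((SUP t\<in>{B..x}. \<pi> t / k t) / 2 + 6 * c)"
        unfolding s_def[symmetric]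
      proof (cases "t \<le> X0")
        case True
        then have "\<pi> t / k t \<le> 1 / k X0"
          using t B kpos[OF X0B] pi_le_1 \<pi>0 by (intro frac_le k_antimono) auto
        then show "\<pi> t / k t \<le> max (1 / k X0) (s x / 2 + 6 * c)" by simp
      next
        case False
        then have "\<pi> t / k t \<le> s t / 2 + 6 * c"
          using step[of t] kpos[of t] t by (simp add: field_simps)
        also have "\<dots> \<le> s x / 2 + 6 * c" using s_mono[of t x] t by simp
        finally show "\<pi> t / k t \<le> max (1 / k X0) (s x / 2 + 6 * c)" by simp
      qed
    qed
    moreover have "0 < 1 / k X0" using kpos[OF X0B] by simp
    ultimately show ?thesis using c unfolding C_def by linarith
  qed
  have "\<forall>\<^sub>F x in at_top. \<pi> x \<le> C * k x"
    using eventually_ge_at_top[of X0]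
  proof eventually_elim
    case (elim x)
    have "\<pi> x \<le> s x * k x" using elim X0B by (intro le_s) auto
    also have "\<dots> \<le> C * k x" using s_le[OF elim] k(2) by (rule mult_right_mono)
    finally show ?case .
  qed
  with C show ?thesis using \<pi>0 k(2) by (auto simp: bigo_iff_eventually_le)
qed

text \<open>
  With the a priori bound, \<open>le_density\<close> applies with \<open>\<phi> = k\<close>; the light factor is removed by
  \<open>truncation\<close>.
\<close>

theorem density_regular_imp_law_asymp:
  assumes lt: "k \<in> long_tailed_fun" and sm: "small_middle k"
  shows "(\<lambda>x. c * k x) \<preceq> m" "m \<preceq> (\<lambda>x. c * k x)"
proof -
  show "(\<lambda>x. c * k x) \<preceq> m" using lt by (intro density_preceq_law) simp
  have \<pi>O: "\<pi> \<in> O(k)" by (rule pi_bigo_density[OF lt sm])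
  then obtain C0 where C0: "0 < C0" "\<forall>\<^sub>F x in at_top. \<pi> x \<le> C0 * k x"
    using k(2) local_mass_nonneg[OF finP setsP c] by (auto simp: bigo_iff_eventually_le)
  have "\<forall>\<^sub>F x in at_top. m x \<le> (2 * C0 + 1) * k x"
  proof -
    obtain A where A: "0 \<le> A" "\<forall>\<^sub>F x in at_top. m x \<le> truncated_mass A x + 1 * k x"
      by (rule truncation[OF lt k_almost_decreasing \<pi>O zero_less_one], rule that; assumption)
    obtain x0 where x0: "\<And>x. x0 \<le> x \<Longrightarrow> \<pi> x \<le> C0 * k x"
      using C0(2) by (auto simp: eventually_at_top_linorder)
    have "\<forall>\<^sub>F x in at_top. k (x + - A) \<le> 2 * k x"
      by (intro asymp_leD long_tailedD(4)[OF lt]) auto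
    with A(2) eventually_gt_at_top[of "A + max 1 x0"]
    show ?thesis
    proof eventually_elim
      case (elim x)
      have "ennreal (truncated_mass A x) \<le> (\<integral>\<^sup>+y. ennreal (C0 * (2 * k x)) \<partial>M)"
        unfolding truncated_mass_eq[OF A(1)]
      proof (rule nn_integral_mono)
        fix y
        show "ennreal (\<pi> (x - y)) * indicator {-A..A} y \<le> ennreal (C0 * (2 * k x))"
        proof (cases "y \<in> {-A..A}")
          case True
          have "\<pi> (x - y) \<le> C0 * k (x - y)" using True elim by (intro x0) auto
          also have "\<dots> \<le> C0 * k (x - A)"
          proof (rule mult_left_mono)
            show "k (x - y) \<le> k (x - A)" using True elim k(4) by (auto simp: monotone_on_def)
          qed (use C0 in auto)
          also have "\<dots> \<le> C0 * (2 * k x)" using elim C0 by (intro mult_left_mono) auto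
          finally show ?thesis using True by (simp add: ennreal_leI)
        qed simp
      qed
      also have "\<dots> = ennreal (C0 * (2 * k x))" using M.emeasure_space_1 by simp
      finally have "truncated_mass A x \<le> C0 * (2 * k x)" using C0 k(2) by simp
      then show ?case using elim by (simp add: algebra_simps)
    qed
  qed
  then have mO: "m \<in> O(k)"
    using C0(1) by (subst bigo_iff_eventually_le) (auto simp: k(2) m_nonneg intro!: exI[of _ "2 * C0 + 1"])
  show "m \<preceq> (\<lambda>x. c * k x)"
  proof (rule asymp_leI_perturbed[OF long_tailed_cmult[OF lt c]])
    fix \<delta> :: real assume \<delta>: "0 < \<delta>"
    define \<eta> where "\<eta> = min \<delta> (c * \<delta>)"
    have \<eta>: "0 < \<eta>" "\<eta> \<le> \<delta>" "\<eta> \<le> \<delta> * c" using \<delta> c by (auto simp: \<eta>_def mult.commute)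
    obtain B where B: "\<forall>\<^sub>F x in at_top. m x \<le> \<eta> * k x + (1 + \<eta>) * c * k (x - B)"
      by (rule law_le_density[OF lt k_almost_decreasing sm \<pi>O mO _ \<eta>(1)], simp, rule that; assumption)
    from B have "\<forall>\<^sub>F x in at_top. m x \<le> \<delta> * (c * k x) + (1 + \<delta>) * (c * k (x - B))"
    proof eventually_elim
      case (elim x)
      have "\<eta> * k x \<le> \<delta> * c * k x" "(1 + \<eta>) * c * k (x - B) \<le> (1 + \<delta>) * c * k (x - B)"
        using \<eta> c k(2) by (intro mult_right_mono; simp)+
      then show ?case using elim unfolding mult.assoc by linarith
    qed
    then show "\<exists>B. \<forall>\<^sub>F x in at_top. m x \<le> \<delta> * (c * k x) + (1 + \<delta>) * (c * k (x - B))" by blast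
  qed
qed

lemma size_bias_identity_double: "size_bias_identity (P \<star> P) (\<lambda>x. 2 * k x)"
  unfolding size_bias_identity_def
proof (intro conjI ballI)
  have nonneg: "AE x in P. 0 \<le> x" using size_bias by (simp add: size_bias_identity_def)
  note rP = P.real_distribution_axioms
  note [measurable] = k(1)
  interpret PP: pair_sigma_finite P P ..
  interpret LP: pair_sigma_finite lborel P ..
  show "real_distribution (P \<star> P)" by (rule real_distribution_convolution[OF rP rP])
  show "AE x in P \<star> P. 0 \<le> x" by (rule AE_nonneg_convolution[OF rP nonneg rP nonneg])
  fix h :: "real \<Rightarrow> ennreal" assume h[measurable]: "h \<in> borel_measurable borel"
  let ?T = "\<integral>\<^sup>+x. \<integral>\<^sup>+y. ennreal y * h (x + y) \<partial>P \<partial>P"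
  have "(\<integral>\<^sup>+x. \<integral>\<^sup>+y. ennreal x * h (x + y) \<partial>P \<partial>P) = (\<integral>\<^sup>+y. \<integral>\<^sup>+x. ennreal x * h (x + y) \<partial>P \<partial>P)"
    by (rule PP.Fubini') measurable
  also have "\<dots> = ?T" by (simp add: add.commute)
  finally have "(\<integral>\<^sup>+t. ennreal t * h t \<partial>(P \<star> P)) = ?T + ?T"
    by (simp add: size_bias_conv[OF rP nonneg rP nonneg h])
  also have "\<dots> = 2 * ?T" by (simp add: mult_2)
  also have "?T = (\<integral>\<^sup>+x. \<integral>\<^sup>+u. ennreal (u * k u) * (\<integral>\<^sup>+v. h (x + (u + v)) \<partial>P) \<partial>lborel \<partial>P)"
  proof (rule nn_integral_cong)
    fix x
    have "(\<lambda>y. h (x + y)) \<in> borel_measurable borel" by measurable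
    then show "(\<integral>\<^sup>+y. ennreal y * h (x + y) \<partial>P) =
        (\<integral>\<^sup>+u. ennreal (u * k u) * (\<integral>\<^sup>+v. h (x + (u + v)) \<partial>P) \<partial>lborel)"
      by (rule size_bias[unfolded size_bias_identity_def, THEN conjunct2, THEN conjunct2, rule_format])
  qed
  also have "\<dots> = (\<integral>\<^sup>+u. \<integral>\<^sup>+x. ennreal (u * k u) * (\<integral>\<^sup>+v. h (x + (u + v)) \<partial>P) \<partial>P \<partial>lborel)"
    by (rule LP.Fubini') measurable
  also have "\<dots> = (\<integral>\<^sup>+u. ennreal (u * k u) * (\<integral>\<^sup>+v. h (u + v) \<partial>(P \<star> P)) \<partial>lborel)"
  proof (rule nn_integral_cong)
    fix u
    have "(\<integral>\<^sup>+v. h (u + v) \<partial>(P \<star> P)) = (\<integral>\<^sup>+x. \<integral>\<^sup>+v. h (u + (x + v)) \<partial>P \<partial>P)"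
      by (rule nn_integral_convolution_prob[OF rP rP]) measurable
    then show "(\<integral>\<^sup>+x. ennreal (u * k u) * (\<integral>\<^sup>+v. h (x + (u + v)) \<partial>P) \<partial>P) =
        ennreal (u * k u) * (\<integral>\<^sup>+v. h (u + v) \<partial>(P \<star> P))"
      by (simp add: nn_integral_cmult add.left_commute)
  qed
  also have "2 * \<dots> = (\<integral>\<^sup>+u. 2 * (ennreal (u * k u) * (\<integral>\<^sup>+v. h (u + v) \<partial>(P \<star> P))) \<partial>lborel)"
  proof (rule nn_integral_cmult[symmetric])
    interpret PPd: real_distribution "P \<star> P" by (rule real_distribution_convolution[OF rP rP])
    show "(\<lambda>u. ennreal (u * k u) * (\<integral>\<^sup>+v. h (u + v) \<partial>(P \<star> P))) \<in> borel_measurable lborel"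
      by measurable
  qed
  also have "\<dots> = (\<integral>\<^sup>+u. ennreal (u * (2 * k u)) * (\<integral>\<^sup>+v. h (u + v) \<partial>(P \<star> P)) \<partial>lborel)"
  proof (rule nn_integral_cong)
    fix u
    have "ennreal (u * (2 * k u)) = 2 * ennreal (u * k u)"
      using ennreal_mult'[of 2 "u * k u"] by (simp add: mult.left_commute)
    then show "2 * (ennreal (u * k u) * (\<integral>\<^sup>+v. h (u + v) \<partial>(P \<star> P))) =
        ennreal (u * (2 * k u)) * (\<integral>\<^sup>+v. h (u + v) \<partial>(P \<star> P))" by (simp add: mult.assoc)
  qed
  finally show "(\<integral>\<^sup>+t. ennreal t * h t \<partial>(P \<star> P)) =
      (\<integral>\<^sup>+u. ennreal (u * (2 * k u)) * (\<integral>\<^sup>+v. h (u + v) \<partial>(P \<star> P)) \<partial>lborel)" .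
qed

lemma jump_decomposition_double: "jump_decomposition c (2 * \<Lambda>) (\<lambda>x. 2 * k x) (P \<star> P) (M \<star> M)"
proof
  show "size_bias_identity (P \<star> P) (\<lambda>x. 2 * k x)" by (rule size_bias_identity_double)
  show "light_right_tail (M \<star> M)" by (rule light_right_tail_convolution[OF light light])
  show "antimono_on {1<..} (\<lambda>x. 2 * k x)" using k(4) by (auto simp: monotone_on_def)
  show "(\<integral>\<^sup>+x. ennreal (2 * k x) \<partial>lborel) = ennreal (2 * \<Lambda>)"
    using k \<Lambda> by (simp add: ennreal_mult nn_integral_cmult)
qed (use c k \<Lambda> in auto)

lemma law_self_convolution: "((P \<star> M) \<star> (P \<star> M)) = ((P \<star> P) \<star> (M \<star> M))"
  using P.real_distribution_axioms M.real_distribution_axioms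
  by (intro Levy_uniqueness ext) (auto simp: char_convolution real_distribution_convolution)

text \<open>
  The law and its self-convolution both have the asymptotics given by their jump densities \<open>k\<close>
  and \<open>2 k\<close>, so the quotient of the local masses tends to \<open>2\<close>.
\<close>

lemma density_regular_imp_S_Delta:
  assumes lt: "k \<in> long_tailed_fun" and sm: "small_middle k"
  shows "(P \<star> M) \<in> S_Delta c \<inter> D_Delta c"
proof -
  note asym = density_regular_imp_law_asymp[OF lt sm]
  have mlt: "m \<in> long_tailed_fun"
    by (rule long_tailed_transfer[OF long_tailed_cmult[OF lt c] measurable_m m_nonneg asym])
  have mad: "almost_decreasing m"
    by (rule almost_decreasing_bigtheta[OF k_almost_decreasing k(2) m_nonneg])
       (rule bigtheta_if_asymp_le[OF asym(2,1) c m_nonneg k(2)])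
  interpret twice: jump_decomposition c "2 * \<Lambda>" "\<lambda>x. 2 * k x" "P \<star> P" "M \<star> M"
    by (rule jump_decomposition_double)
  have lt2: "(\<lambda>x. 2 * k x) \<in> long_tailed_fun" using lt by (rule long_tailed_cmult) simp
  have sm2: "small_middle (\<lambda>x. 2 * k x)"
    by (rule small_middle_bigtheta[OF sm k(1,2)]) (auto simp: k(2))
  note asym2 = twice.density_regular_imp_law_asymp[OF lt2 sm2]
  have "twice.m \<preceq> (\<lambda>x. 2 * (c * k x))" using asym2(2) by (simp add: mult.left_commute)
  also have "(\<lambda>x. 2 * (c * k x)) \<preceq> (\<lambda>x. 2 * m x)" using asym(1) by (rule asymp_le_cmult) simp
  finally have 1: "twice.m \<preceq> (\<lambda>x. 2 * m x)" .
  have "(\<lambda>x. 2 * m x) \<preceq> (\<lambda>x. 2 * (c * k x))" using asym(2) by (rule asymp_le_cmult) simp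
  also have "(\<lambda>x. 2 * (c * k x)) \<preceq> twice.m" using asym2(1) by (simp add: mult.left_commute)
  finally have 2: "(\<lambda>x. 2 * m x) \<preceq> twice.m" .
  have "\<forall>\<^sub>F x in at_top. 0 < 2 * m x" using long_tailedD(3)[OF mlt] by eventually_elim simp
  then have "twice.m \<sim>[at_top] (\<lambda>x. 2 * m x)" using 1 2 by (simp add: asymp_equiv_iff_asymp_le)
  then show ?thesis
    using mlt mad real_distribution_law
    by (simp add: S_Delta_def L_Delta_def D_Delta_def conv_power_2 law_self_convolution)
qed

end

section \<open>Laws with a decreasing density\<close>

locale decreasing_density =
  fixes c :: real and h :: "real \<Rightarrow> real" and F :: "real measure"
  assumes c: "0 < c" and F: "real_distribution F" and dens: "F = density lborel (\<lambda>x. ennreal (h x))"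
    and h: "h \<in> borel_measurable borel" "\<And>x. 0 \<le> h x" "\<And>x. x \<le> 1 \<Longrightarrow> h x = 0" "antimono_on {1<..} h"
begin

sublocale F: real_distribution F by (rule F)

lemmas finF = F.finite_measure_axioms and setsF = F.events_eq_borel
lemmas [measurable] = h(1)

abbreviation f :: "real \<Rightarrow> real" where "f \<equiv> local_mass c F"

lemma h_antimono: "1 < x \<Longrightarrow> x \<le> y \<Longrightarrow> h y \<le> h x"
  using h(4) by (auto simp: monotone_on_def)

lemma h_almost_decreasing: "almost_decreasing h"
  unfolding almost_decreasing_def
proof (intro exI[of _ 1] conjI allI impI)
  fix x y :: real assume "1 < x" "0 < y"
  then show "h (x + y) \<le> 1 * h x" using h_antimono[of x "x + y"] by auto
qed auto

lemma nn_integral_h: "(\<integral>\<^sup>+x. ennreal (h x) \<partial>lborel) = ennreal 1"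
  using F.emeasure_space_1 by (simp add: dens emeasure_density)

lemma f_nonneg: "0 \<le> f x" by (simp add: local_mass_def)

lemma measurable_f [measurable]: "f \<in> borel_measurable borel"
  by (rule measurable_local_mass[OF finF setsF c])

lemma nn_integral_f: "(\<integral>\<^sup>+x. ennreal (f x) \<partial>lborel) = ennreal c"
  using F.prob_space by (simp add: nn_integral_local_mass[OF finF setsF c])

lemma f_eq: "ennreal (f x) = (\<integral>\<^sup>+t. ennreal (h t) * indicator {x<..x + c} t \<partial>lborel)"
proof -
  have "ennreal (f x) = emeasure F {x<..x + c}" by (simp add: local_mass_def F.emeasure_eq_measure)
  then show ?thesis by (simp add: dens emeasure_density)
qed

lemma f_le: "1 < x \<Longrightarrow> f x \<le> c * h x"
proof -
  assume x: "1 < x"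
  have "ennreal (f x) \<le> (\<integral>\<^sup>+t. ennreal (h x) * indicator {x<..x + c} t \<partial>lborel)"
    unfolding f_eq using x
    by (intro nn_integral_mono) (auto simp: indicator_def intro!: ennreal_leI h_antimono)
  also have "\<dots> = ennreal (h x) * ennreal c" using c by (simp add: nn_integral_cmult)
  also have "\<dots> = ennreal (c * h x)" using c h(2) by (simp add: ennreal_mult mult.commute)
  finally show ?thesis using c h(2) by simp
qed

lemma f_ge: "1 < x \<Longrightarrow> c * h (x + c) \<le> f x"
proof -
  assume x: "1 < x"
  have "ennreal (c * h (x + c)) = ennreal (h (x + c)) * ennreal c"
    using c h(2) by (simp add: ennreal_mult mult.commute)
  also have "\<dots> = (\<integral>\<^sup>+t. ennreal (h (x + c)) * indicator {x<..x + c} t \<partial>lborel)"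
    using c by (simp add: nn_integral_cmult)
  also have "\<dots> \<le> ennreal (f x)"
    unfolding f_eq using x
    by (intro nn_integral_mono) (auto simp: indicator_def intro!: ennreal_leI h_antimono)
  finally show ?thesis using f_nonneg by simp
qed

lemma f_preceq: "f \<preceq> (\<lambda>x. c * h x)"
  unfolding asymp_le_def
proof (intro allI impI)
  fix \<eta> :: real assume \<eta>: "1 < \<eta>"
  show "\<forall>\<^sub>F x in at_top. f x \<le> \<eta> * (c * h x)"
    using eventually_gt_at_top[of 1]
  proof eventually_elim
    case (elim x)
    have "1 * (c * h x) \<le> \<eta> * (c * h x)" using \<eta> c h(2) by (intro mult_right_mono) auto
    then show ?case using f_le[OF elim] by simp
  qed
qed

lemma shifted_preceq_f: "(\<lambda>x. c * h (x + c)) \<preceq> f"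
  unfolding asymp_le_def
proof (intro allI impI)
  fix \<eta> :: real assume \<eta>: "1 < \<eta>"
  show "\<forall>\<^sub>F x in at_top. c * h (x + c) \<le> \<eta> * f x"
    using eventually_gt_at_top[of 1]
  proof eventually_elim
    case (elim x)
    have "1 * f x \<le> \<eta> * f x" using \<eta> f_nonneg by (intro mult_right_mono) auto
    then show ?case using f_ge[OF elim] by simp
  qed
qed

text \<open>
  The local mass lies between \<open>c h(x + c)\<close> and \<open>c h(x)\<close>, so regularity of either function gives
  comparability without the shift.
\<close>

lemma preceq_f:
  assumes "h \<in> long_tailed_fun \<or> f \<in> long_tailed_fun" shows "(\<lambda>x. c * h x) \<preceq> f"
  using assms
proof
  assume lt: "h \<in> long_tailed_fun"
  have "(\<lambda>x. c * h x) \<preceq> (\<lambda>x. c * h (x + c))"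
    using long_tailed_preceq_shift[OF lt] by (rule asymp_le_cmult) (use c in simp)
  also note shifted_preceq_f
  finally show ?thesis .
next
  assume lt: "f \<in> long_tailed_fun"
  have "(\<lambda>x. c * h x) \<preceq> (\<lambda>x. f (x + - c))"
    using asymp_le_shift[OF shifted_preceq_f, of "- c"] by simp
  also note long_tailedD(4)[OF lt, of "- c"]
  finally show ?thesis .
qed

lemma long_tailed_iff: "f \<in> long_tailed_fun \<longleftrightarrow> h \<in> long_tailed_fun"
proof
  assume lt: "h \<in> long_tailed_fun"
  show "f \<in> long_tailed_fun"
    by (rule long_tailed_transfer[OF long_tailed_cmult[OF lt c] measurable_f f_nonneg])
       (use lt preceq_f f_preceq in auto)
next
  assume lt: "f \<in> long_tailed_fun"
  have "(\<lambda>x. c * h x) \<in> long_tailed_fun"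
    by (rule long_tailed_transfer[OF lt]) (use c h(2) lt preceq_f f_preceq in auto)
  from long_tailed_cmult[OF this, of "1 / c"] show "h \<in> long_tailed_fun" using c by simp
qed

lemma f_bigtheta: "h \<in> long_tailed_fun \<Longrightarrow> f \<in> \<Theta>(h)"
  by (rule bigtheta_if_asymp_le[OF f_preceq preceq_f c f_nonneg h(2)]) simp

lemma nn_integral_F:
  assumes "g \<in> borel_measurable borel"
  shows "(\<integral>\<^sup>+x. g x \<partial>F) = (\<integral>\<^sup>+x. g x * ennreal (h x) \<partial>lborel)"
proof -
  have "(\<integral>\<^sup>+x. g x \<partial>F) = (\<integral>\<^sup>+x. g x \<partial>density lborel (\<lambda>x. ennreal (h x)))"
    by (simp only: dens[symmetric])
  also have "\<dots> = (\<integral>\<^sup>+x. g x * ennreal (h x) \<partial>lborel)"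
    using assms by (subst nn_integral_density) (auto simp: mult.commute)
  finally show ?thesis .
qed

lemma self_convolution_eq:
  "ennreal (local_mass c (F \<star> F) x) = (\<integral>\<^sup>+t. ennreal (f (x - t)) * ennreal (h t) \<partial>lborel)"
  unfolding local_mass_convolution[OF finF setsF c finF setsF]
  by (rule nn_integral_F) measurable

text \<open>
  The convolution integral of \<open>f\<close> and \<open>h\<close>, split at \<open>B\<close> and \<open>x - B\<close>. At either end one factor is nearly
  constant, by monotonicity of \<open>h\<close>, and the other one integrates to \<open>1\<close> or to \<open>c\<close>.
\<close>

lemma self_convolution_upper:
  assumes B: "1 < B" "2 * B < x" and mid: "middle h h B x \<le> ennreal (\<epsilon> * h x)" and \<epsilon>: "0 \<le> \<epsilon>"
  shows "local_mass c (F \<star> F) x \<le> 2 * c * h (x - B) + c * \<epsilon> * h x"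
proof -
  have "(\<integral>\<^sup>+t. ennreal (f (x - t)) * ennreal (h t) \<partial>lborel) \<le>
      (\<integral>\<^sup>+t. ennreal (c * h (x - B)) * ennreal (h t) +
        ennreal c * (ennreal (h (x - t) * h t) * indicator {B..x - B} t) +
        ennreal (h (x - B)) * ennreal (f (x - t)) \<partial>lborel)"
  proof (rule nn_integral_mono)
    fix t
    consider "t < B" | "B \<le> t" "t \<le> x - B" | "x - B < t" by linarith
    then show "ennreal (f (x - t)) * ennreal (h t) \<le> ennreal (c * h (x - B)) * ennreal (h t) +
        ennreal c * (ennreal (h (x - t) * h t) * indicator {B..x - B} t) +
        ennreal (h (x - B)) * ennreal (f (x - t))"
    proof cases
      case 1
      have "f (x - t) \<le> c * h (x - t)" using 1 B by (intro f_le) auto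
      also have "\<dots> \<le> c * h (x - B)" using 1 B c by (intro mult_left_mono h_antimono) auto
      finally have "ennreal (f (x - t)) * ennreal (h t) \<le> ennreal (c * h (x - B)) * ennreal (h t)"
        by (intro mult_right_mono ennreal_leI) auto
      then show ?thesis by (simp add: add_increasing2 add.assoc)
    next
      case 2
      have "f (x - t) \<le> c * h (x - t)" using 2 B by (intro f_le) auto
      then have "f (x - t) * h t \<le> c * (h (x - t) * h t)"
        using h(2)[of t] mult_right_mono by (metis mult.assoc)
      then have "ennreal (f (x - t)) * ennreal (h t) \<le>
          ennreal c * (ennreal (h (x - t) * h t) * indicator {B..x - B} t)"
        using 2 c h(2) f_nonneg by (simp add: ennreal_mult[symmetric] ennreal_leI)
      then show ?thesis by (simp add: add_increasing add_increasing2)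
    next
      case 3
      have "h t \<le> h (x - B)" using 3 B by (intro h_antimono) auto
      then have "ennreal (f (x - t)) * ennreal (h t) \<le> ennreal (h (x - B)) * ennreal (f (x - t))"
        by (subst mult.commute) (intro mult_right_mono ennreal_leI, auto)
      then show ?thesis by (simp add: add_increasing)
    qed
  qed
  also have "\<dots> = ennreal (c * h (x - B)) * (\<integral>\<^sup>+t. ennreal (h t) \<partial>lborel) + ennreal c * middle h h B x +
      ennreal (h (x - B)) * (\<integral>\<^sup>+t. ennreal (f (x - t)) \<partial>lborel)"
    unfolding middle_def by (simp add: nn_integral_add nn_integral_cmult)
  also have "(\<integral>\<^sup>+t. ennreal (f (x - t)) \<partial>lborel) = ennreal c"
    by (subst nn_integral_reflect) (auto simp: nn_integral_f)
  also have "ennreal (c * h (x - B)) * (\<integral>\<^sup>+t. ennreal (h t) \<partial>lborel) + ennreal c * middle h h B x +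
      ennreal (h (x - B)) * ennreal c \<le>
      ennreal (c * h (x - B)) * ennreal 1 + ennreal c * ennreal (\<epsilon> * h x) + ennreal (h (x - B)) * ennreal c"
    unfolding nn_integral_h by (intro add_right_mono add_left_mono mult_left_mono mid) simp
  also have "\<dots> = ennreal (c * h (x - B) + c * (\<epsilon> * h x) + h (x - B) * c)"
    using c h(2) \<epsilon> by (simp add: ennreal_mult[symmetric] ennreal_plus[symmetric] del: ennreal_plus)
  finally have "ennreal (local_mass c (F \<star> F) x) \<le> ennreal (c * h (x - B) + c * (\<epsilon> * h x) + h (x - B) * c)"
    unfolding self_convolution_eq .
  then have "local_mass c (F \<star> F) x \<le> c * h (x - B) + c * (\<epsilon> * h x) + h (x - B) * c"
    using c h(2) \<epsilon> by (subst (asm) ennreal_le_iff) (auto intro!: add_nonneg_nonneg)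
  then show ?thesis by (simp add: algebra_simps)
qed

lemma self_convolution_lower:
  assumes B: "0 < B" "2 * B + 1 < x" and \<epsilon>: "0 \<le> \<epsilon>" "\<epsilon> \<le> 1"
    and mass_h: "ennreal (1 - \<epsilon>) \<le> (\<integral>\<^sup>+t. ennreal (h t) * indicator {-B..<B} t \<partial>lborel)"
    and mass_f: "ennreal (c - c * \<epsilon>) \<le> (\<integral>\<^sup>+t. ennreal (f t) * indicator {-B..<B} t \<partial>lborel)"
  shows "(1 - \<epsilon>) * (2 * c * h (x + (B + c))) \<le> local_mass c (F \<star> F) x"
proof -
  let ?z = "h (x + (B + c))"
  let ?g = "\<lambda>t. ennreal (f (x - t)) * ennreal (h t)"
  have "ennreal (c * ?z) * ennreal (1 - \<epsilon>) \<le>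
      ennreal (c * ?z) * (\<integral>\<^sup>+t. ennreal (h t) * indicator {-B..<B} t \<partial>lborel)"
    by (intro mult_left_mono mass_h) simp
  also have "\<dots> = (\<integral>\<^sup>+t. ennreal (c * ?z) * (ennreal (h t) * indicator {-B..<B} t) \<partial>lborel)"
    by (rule nn_integral_cmult[symmetric]) measurable
  also have "\<dots> \<le> (\<integral>\<^sup>+t. ?g t * indicator {-B..<B} t \<partial>lborel)"
  proof (rule nn_integral_mono)
    fix t
    show "ennreal (c * ?z) * (ennreal (h t) * indicator {-B..<B} t) \<le> ?g t * indicator {-B..<B} t"
    proof (cases "t \<in> {-B..<B}")
      case True
      have "c * ?z \<le> c * h (x - t + c)" using True B c by (intro mult_left_mono h_antimono) auto
      also have "\<dots> \<le> f (x - t)" using True B by (intro f_ge) auto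
      finally show ?thesis using True by (simp add: mult_right_mono ennreal_leI)
    qed simp
  qed
  finally have 1: "ennreal (c * ?z) * ennreal (1 - \<epsilon>) \<le> (\<integral>\<^sup>+t. ?g t * indicator {-B..<B} t \<partial>lborel)" .
  have "ennreal ?z * ennreal (c - c * \<epsilon>) \<le> ennreal ?z * (\<integral>\<^sup>+t. ennreal (f t) * indicator {-B..<B} t \<partial>lborel)"
    by (intro mult_left_mono mass_f) simp
  also have "\<dots> = (\<integral>\<^sup>+t. ennreal ?z * (ennreal (f t) * indicator {-B..<B} t) \<partial>lborel)"
    by (rule nn_integral_cmult[symmetric]) measurable
  also have "\<dots> = (\<integral>\<^sup>+t. ennreal ?z * (ennreal (f (x - t)) * indicator {-B..<B} (x - t)) \<partial>lborel)"
    by (rule nn_integral_reflect[symmetric]) measurable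
  also have "\<dots> \<le> (\<integral>\<^sup>+t. ?g t * indicator {x - B<..x + B} t \<partial>lborel)"
  proof (rule nn_integral_mono)
    fix t
    show "ennreal ?z * (ennreal (f (x - t)) * indicator {-B..<B} (x - t)) \<le> ?g t * indicator {x - B<..x + B} t"
    proof (cases "t \<in> {x - B<..x + B}")
      case True
      have "?z \<le> h t" using True B c by (intro h_antimono) auto
      then have "ennreal ?z * ennreal (f (x - t)) \<le> ?g t"
        by (subst mult.commute) (intro mult_left_mono ennreal_leI, auto)
      then show ?thesis using True by (auto simp: indicator_def)
    qed (auto simp: indicator_def)
  qed
  finally have 2: "ennreal ?z * ennreal (c - c * \<epsilon>) \<le> (\<integral>\<^sup>+t. ?g t * indicator {x - B<..x + B} t \<partial>lborel)" .
  have "ennreal (c * ?z) * ennreal (1 - \<epsilon>) + ennreal ?z * ennreal (c - c * \<epsilon>) \<le>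
     (\<integral>\<^sup>+t. ?g t * indicator {-B..<B} t \<partial>lborel) + (\<integral>\<^sup>+t. ?g t * indicator {x - B<..x + B} t \<partial>lborel)"
    by (intro add_mono 1 2)
  also have "\<dots> = (\<integral>\<^sup>+t. ?g t * indicator {-B..<B} t + ?g t * indicator {x - B<..x + B} t \<partial>lborel)"
    by (rule nn_integral_add[symmetric]) measurable
  also have "\<dots> \<le> (\<integral>\<^sup>+t. ?g t \<partial>lborel)"
    using B by (intro nn_integral_mono) (auto simp: indicator_def)
  finally have main: "ennreal (c * ?z) * ennreal (1 - \<epsilon>) + ennreal ?z * ennreal (c - c * \<epsilon>)
      \<le> ennreal (local_mass c (F \<star> F) x)"
    by (simp add: self_convolution_eq)
  have c\<epsilon>: "0 \<le> c - c * \<epsilon>" using c \<epsilon> by (simp add: mult_left_le)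
  have "ennreal (c * ?z * (1 - \<epsilon>) + ?z * (c - c * \<epsilon>)) =
      ennreal (c * ?z) * ennreal (1 - \<epsilon>) + ennreal ?z * ennreal (c - c * \<epsilon>)"
    using c h(2)[of "x + (B + c)"] \<epsilon> c\<epsilon> by (subst ennreal_plus) (simp_all add: ennreal_mult)
  with main have "ennreal (c * ?z * (1 - \<epsilon>) + ?z * (c - c * \<epsilon>)) \<le> ennreal (local_mass c (F \<star> F) x)" by simp
  then have "c * ?z * (1 - \<epsilon>) + ?z * (c - c * \<epsilon>) \<le> local_mass c (F \<star> F) x"
    by (simp add: local_mass_def)
  then show ?thesis by (simp add: algebra_simps)
qed

theorem S_Delta_iff: "F \<in> S_Delta c \<longleftrightarrow> h \<in> long_tailed_fun \<and> small_middle h"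
proof
  assume S: "F \<in> S_Delta c"
  then have lt: "h \<in> long_tailed_fun" using long_tailed_iff by (simp add: S_Delta_def L_Delta_def)
  have "almost_decreasing f"
    by (rule almost_decreasing_bigtheta[OF h_almost_decreasing h(2) f_nonneg f_bigtheta[OF lt]])
  with S have "small_middle f" by (rule small_middle_if_S_Delta[OF c])
  then have "small_middle h"
    by (rule small_middle_bigtheta[OF _ measurable_f f_nonneg h(2)])
       (use f_bigtheta[OF lt] in \<open>simp add: bigtheta_sym\<close>)
  with lt show "h \<in> long_tailed_fun \<and> small_middle h" by simp
next
  assume "h \<in> long_tailed_fun \<and> small_middle h"
  then have lt: "h \<in> long_tailed_fun" and sm: "small_middle h" by auto
  have flt: "f \<in> long_tailed_fun" using lt long_tailed_iff by simp
  let ?f2 = "local_mass c (F \<star> F)"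
  have f20: "0 \<le> ?f2 x" for x by (simp add: local_mass_def)
  have hlt: "(\<lambda>x. 2 * c * h x) \<in> long_tailed_fun" using lt c by (intro long_tailed_cmult) auto
  have up: "?f2 \<preceq> (\<lambda>x. 2 * c * h x)"
  proof (rule asymp_leI_perturbed[OF hlt])
    fix \<delta> :: real assume \<delta>: "0 < \<delta>"
    then obtain B0 where B0: "\<And>B x. B0 \<le> B \<Longrightarrow> middle h h B x \<le> ennreal (\<delta> * h x)"
      using sm unfolding small_middle_def by meson
    define B where "B = max B0 2"
    have "\<forall>\<^sub>F x in at_top. ?f2 x \<le> \<delta> * (2 * c * h x) + (1 + \<delta>) * (2 * c * h (x - B))"
      using eventually_gt_at_top[of "2 * B"]
    proof eventually_elim
      case (elim x)
      have "?f2 x \<le> 2 * c * h (x - B) + c * \<delta> * h x"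
        using self_convolution_upper[of B x \<delta>] B0[of B] elim \<delta> by (simp add: B_def)
      moreover have "0 \<le> c * \<delta> * h x" "0 \<le> \<delta> * (2 * c * h (x - B))" using c \<delta> h(2) by auto
      ultimately show ?case by (simp add: algebra_simps)
    qed
    then show "\<exists>B. \<forall>\<^sub>F x in at_top. ?f2 x \<le> \<delta> * (2 * c * h x) + (1 + \<delta>) * (2 * c * h (x - B))" by blast
  qed
  have lo: "(\<lambda>x. 2 * c * h x) \<preceq> ?f2"
  proof (rule asymp_leI_shift)
    fix \<delta> :: real assume \<delta>: "0 < \<delta>" "\<delta> < 1"
    obtain B1 where B1: "\<And>B. B1 \<le> B \<Longrightarrow>
        ennreal (1 - \<delta>) \<le> (\<integral>\<^sup>+t. ennreal (h t) * indicator {-B..<B} t \<partial>lborel)"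
      using nn_integral_mass_below[of "\<lambda>t. ennreal (h t)" lborel 1 \<delta>] nn_integral_h \<delta> by auto
    have "0 < c * \<delta>" using c \<delta> by simp
    then obtain B2 where B2: "\<And>B. B2 \<le> B \<Longrightarrow>
        ennreal (c - c * \<delta>) \<le> (\<integral>\<^sup>+t. ennreal (f t) * indicator {-B..<B} t \<partial>lborel)"
      using nn_integral_mass_below[of "\<lambda>t. ennreal (f t)" lborel c "c * \<delta>"] nn_integral_f by auto
    define B where "B = max 1 (max B1 B2)"
    have "\<forall>\<^sub>F x in at_top. (1 - \<delta>) * (2 * c * h (x + (B + c))) \<le> (1 + \<delta>) * ?f2 x"
      using eventually_gt_at_top[of "2 * B + 1"]
    proof eventually_elim
      case (elim x)
      have "(1 - \<delta>) * (2 * c * h (x + (B + c))) \<le> ?f2 x"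
        using elim \<delta> by (intro self_convolution_lower B1 B2) (auto simp: B_def)
      also have "\<dots> \<le> (1 + \<delta>) * ?f2 x" using f20[of x] \<delta> by (simp add: algebra_simps)
      finally show ?case .
    qed
    then show "\<exists>D. \<forall>\<^sub>F x in at_top. (1 - \<delta>) * (2 * c * h (x + D)) \<le> (1 + \<delta>) * ?f2 x" by blast
  qed (use hlt c h(2) f20 in auto)
  have c2: "(\<lambda>x. 2 * c * h x) \<preceq> (\<lambda>x. 2 * f x)" "(\<lambda>x. 2 * f x) \<preceq> (\<lambda>x. 2 * c * h x)"
    unfolding mult.assoc by (rule asymp_le_cmult; use lt preceq_f f_preceq in auto)+
  have "\<forall>\<^sub>F x in at_top. 0 < 2 * f x" using long_tailedD(3)[OF flt] by eventually_elim simp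
  then have "?f2 \<sim>[at_top] (\<lambda>x. 2 * f x)"
    using asymp_le_trans[OF up c2(1)] asymp_le_trans[OF c2(2) lo] by (simp add: asymp_equiv_iff_asymp_le)
  then show "F \<in> S_Delta c"
    using flt F by (simp add: S_Delta_def L_Delta_def conv_power_2)
qed

end

section \<open>The equivalence\<close>

text \<open>
  A decreasing density that is positive at one large point is bounded below on a whole interval to
  the left of it.
\<close>

lemma positive_density_has_mass:
  fixes k :: "real \<Rightarrow> real"
  assumes k: "\<And>x. 0 \<le> k x" "antimono_on {1<..} k"
    and total: "(\<integral>\<^sup>+x. ennreal (k x) \<partial>lborel) = ennreal \<Lambda>" and pos: "\<forall>\<^sub>F x in at_top. 0 < k x"
  shows "0 < \<Lambda>"
proof -
  obtain x0 where x0: "\<And>x. x0 \<le> x \<Longrightarrow> 0 < k x" using pos by (auto simp: eventually_at_top_linorder)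
  define x where "x = max x0 3"
  have x: "0 < k x" "3 \<le> x" using x0 by (auto simp: x_def)
  have "ennreal (k x) = (\<integral>\<^sup>+t. ennreal (k x) * indicator {2..3::real} t \<partial>lborel)"
    by (simp add: nn_integral_cmult)
  also have "\<dots> \<le> (\<integral>\<^sup>+t. ennreal (k t) \<partial>lborel)"
    using x k by (intro nn_integral_mono) (auto simp: indicator_def monotone_on_def intro!: ennreal_leI)
  finally have "ennreal (k x) \<le> ennreal \<Lambda>" by (simp add: total)
  then show ?thesis using x(1) by (metis ennreal_le_iff2 not_le order.strict_trans1)
qed

lemma small_middle_cmult_iff:
  fixes \<phi> :: "real \<Rightarrow> real"
  assumes "\<phi> \<in> borel_measurable borel" "\<And>x. 0 \<le> \<phi> x" "0 < a"
  shows "small_middle (\<lambda>x. a * \<phi> x) \<longleftrightarrow> small_middle \<phi>"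
proof
  assume "small_middle (\<lambda>x. a * \<phi> x)"
  then show "small_middle \<phi>" by (rule small_middle_bigtheta) (use assms in auto)
next
  assume "small_middle \<phi>"
  then show "small_middle (\<lambda>x. a * \<phi> x)" by (rule small_middle_bigtheta) (use assms in auto)
qed

lemma long_tailed_cmult_iff:
  assumes "0 < a" shows "(\<lambda>x. a * \<phi> x) \<in> long_tailed_fun \<longleftrightarrow> \<phi> \<in> long_tailed_fun"
  using long_tailed_cmult[of "\<lambda>x. a * \<phi> x" "1 / a"] long_tailed_cmult[of \<phi> a] assms by auto

theorem theorem4p9:
  fixes c a b :: real and \<mu> \<nu> :: "real measure"
  assumes "c > 0"
    and "s_self_decomposable \<mu> a b \<nu>"
  shows "(\<mu> \<in> S_Delta c \<inter> D_Delta c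
            \<longleftrightarrow> emeasure \<nu> {1<..} > 0 \<and> normalized_tail \<nu> \<in> S_Delta c)
       \<and> (emeasure \<nu> {1<..} > 0 \<and> normalized_tail \<nu> \<in> S_Delta c
            \<longleftrightarrow> emeasure \<nu> {1<..} > 0 \<and> normalized_tail \<nu> \<in> L_Delta c
                \<and> local_mass c \<mu> \<sim>[at_top] local_mass c \<nu>)"
proof -
  note c = assms(1)
  obtain g where \<mu>: "real_distribution \<mu>" and lk: "levy_khintchine \<mu> a b \<nu>"
    and g[measurable]: "g \<in> borel_measurable borel" and g0: "\<And>x. 0 \<le> g x"
    and \<nu>: "\<nu> = density lborel (\<lambda>x. ennreal (g x))" and anti: "antimono_on {0<..} g"
    using assms(2) by (auto simp: s_self_decomposable_def infinitely_divisible_def)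
  have levy: "levy_measure \<nu>" using lk by (simp add: levy_khintchine_def)
  define k where "k x = g x * indicator {1<..} x" for x
  have k_meas[measurable]: "k \<in> borel_measurable borel" unfolding k_def[abs_def] by measurable
  have k0: "0 \<le> k x" for x by (simp add: k_def g0)
  have k1: "k x = 0" if "x \<le> 1" for x using that by (simp add: k_def)
  have k_anti: "antimono_on {1<..} k"
    using anti by (auto simp: monotone_on_def k_def)
  have tail: "emeasure \<nu> A = (\<integral>\<^sup>+x. ennreal (k x) * indicator A x \<partial>lborel)"
    if "A \<in> sets borel" "A \<subseteq> {1<..}" for A
    unfolding \<nu> using that
    by (subst emeasure_density) (auto simp: k_def indicator_def intro!: nn_integral_cong)
  have total_eq: "emeasure \<nu> {1<..} = (\<integral>\<^sup>+x. ennreal (k x) \<partial>lborel)"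
    by (subst tail) (auto simp: k_def indicator_def intro!: nn_integral_cong)
  have "finite_measure (restr \<nu> {1<..})"
    by (rule finite_measure_restr[OF levy, of 1]) auto
  then have "emeasure (restr \<nu> {1<..}) UNIV < \<infinity>"
    using finite_measure.emeasure_finite by (auto simp: less_top)
  then have "emeasure \<nu> {1<..} < \<infinity>"
    by (subst (asm) emeasure_density) (auto simp: ennreal_indicator sets_levy[OF levy] \<nu>)
  then obtain \<Lambda> where \<Lambda>: "0 \<le> \<Lambda>" "emeasure \<nu> {1<..} = ennreal \<Lambda>"
    by (cases "emeasure \<nu> {1<..}") auto
  have total: "(\<integral>\<^sup>+x. ennreal (k x) \<partial>lborel) = ennreal \<Lambda>" using \<Lambda> total_eq by simp
  have pos_iff: "emeasure \<nu> {1<..} > 0 \<longleftrightarrow> 0 < \<Lambda>" using \<Lambda> by simp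
  obtain P M where PM: "size_bias_identity P (\<lambda>x. g x * indicator {1<..} x)" "light_right_tail M" "\<mu> = (P \<star> M)"
    by (rule Levy_Khintchine_decomposition[OF \<mu> lk \<nu> g g0], rule that; assumption)
  interpret J: jump_decomposition c \<Lambda> k P M
    using PM(1,2) c k_meas k0 k1 k_anti total \<Lambda>(1) by unfold_locales (auto simp: k_def[abs_def])
  have \<mu>_mass: "local_mass c \<mu> = J.m" by (simp add: PM(3))

  define F where "F = normalized_tail \<nu>"
  have F: "decreasing_density c (\<lambda>x. (1 / \<Lambda>) * k x) F" if pos: "0 < \<Lambda>"
  proof (rule decreasing_density.intro)
    show "F = density lborel (\<lambda>x. ennreal ((1 / \<Lambda>) * k x))"
    proof (rule measure_eqI)
      fix A assume "A \<in> sets F"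
      then have A[measurable]: "A \<in> sets borel" by (simp add: F_def \<nu>)
      have "emeasure F A = emeasure \<nu> ({1<..} \<inter> A) / ennreal \<Lambda>"
        unfolding F_def by (subst emeasure_uniform_measure) (auto simp: \<nu> \<Lambda>(2)[unfolded \<nu>])
      also have "emeasure \<nu> ({1<..} \<inter> A) = (\<integral>\<^sup>+x. ennreal (k x) * indicator A x \<partial>lborel)"
        by (subst tail) (auto simp: k_def indicator_def intro!: nn_integral_cong)
      also have "\<dots> / ennreal \<Lambda> = (\<integral>\<^sup>+x. ennreal (k x) * indicator A x / ennreal \<Lambda> \<partial>lborel)"
        by (rule nn_integral_divide[symmetric]) measurable
      also have "\<dots> = (\<integral>\<^sup>+x. ennreal ((1 / \<Lambda>) * k x) * indicator A x \<partial>lborel)"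
        using pos k0 by (intro nn_integral_cong) (auto simp: indicator_def divide_ennreal)
      also have "\<dots> = emeasure (density lborel (\<lambda>x. ennreal ((1 / \<Lambda>) * k x))) A"
        by (rule emeasure_density[symmetric]) auto
      finally show "emeasure F A = emeasure (density lborel (\<lambda>x. ennreal ((1 / \<Lambda>) * k x))) A" .
    qed (simp add: F_def \<nu>)
    show "real_distribution F"
      unfolding F_def real_distribution_def real_distribution_axioms_def
      using pos \<Lambda>(2) by (auto intro!: prob_space_uniform_measure simp: \<nu>)
    show "antimono_on {1<..} (\<lambda>x. (1 / \<Lambda>) * k x)"
      using k_anti pos by (auto simp: monotone_on_def divide_right_mono)
  qed (use c pos k0 k1 in auto)

  let ?K = "k \<in> long_tailed_fun \<and> small_middle k"
  have pos_of_lt: "0 < \<Lambda>" if "k \<in> long_tailed_fun"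
    by (rule positive_density_has_mass[OF k0 k_anti total long_tailedD(3)[OF that]])
  have F_L: "F \<in> L_Delta c \<longleftrightarrow> k \<in> long_tailed_fun" if pos: "0 < \<Lambda>"
  proof -
    interpret decreasing_density c "\<lambda>x. (1 / \<Lambda>) * k x" F by (rule F[OF pos])
    show ?thesis
      using long_tailed_iff long_tailed_cmult_iff[of "1 / \<Lambda>" k] pos F by (simp add: L_Delta_def)
  qed
  have F_S: "F \<in> S_Delta c \<longleftrightarrow> ?K" if pos: "0 < \<Lambda>"
  proof -
    interpret decreasing_density c "\<lambda>x. (1 / \<Lambda>) * k x" F by (rule F[OF pos])
    show ?thesis
      using S_Delta_iff long_tailed_cmult_iff[of "1 / \<Lambda>" k] small_middle_cmult_iff[OF k_meas k0, of "1 / \<Lambda>"] pos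
      by simp
  qed
  have \<nu>_mass: "(\<lambda>x. c * k x) \<preceq> local_mass c \<nu>" "local_mass c \<nu> \<preceq> (\<lambda>x. c * k x)"
    if lt: "k \<in> long_tailed_fun"
  proof -
    have pos: "0 < \<Lambda>" by (rule pos_of_lt[OF lt])
    interpret decreasing_density c "\<lambda>x. (1 / \<Lambda>) * k x" F by (rule F[OF pos])
    have hlt: "(\<lambda>x. (1 / \<Lambda>) * k x) \<in> long_tailed_fun" using lt pos by (intro long_tailed_cmult) auto
    have ev: "\<forall>\<^sub>F x in at_top. \<Lambda> * f x = local_mass c \<nu> x"
      using eventually_ge_at_top[of 1]
    proof eventually_elim
      case (elim x)
      have "f x = measure \<nu> ({1<..} \<inter> {x<..x + c}) / measure \<nu> {1<..}"
        unfolding local_mass_def F_def by (rule measure_uniform_measure) (use pos in \<open>auto simp: \<Lambda>(2) ennreal_eq_0_iff sets_levy[OF levy]\<close>)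
      also have "{1<..} \<inter> {x<..x + c} = {x<..x + c}" using elim by auto
      also have "measure \<nu> {1<..} = \<Lambda>" using \<Lambda> by (simp add: measure_def)
      finally show ?case using pos by (simp add: local_mass_def)
    qed
    have *: "(\<lambda>x. \<Lambda> * (c * ((1 / \<Lambda>) * k x))) = (\<lambda>x. c * k x)" using pos by (simp add: fun_eq_iff)
    have "(\<lambda>x. \<Lambda> * (c * ((1 / \<Lambda>) * k x))) \<preceq> (\<lambda>x. \<Lambda> * f x)"
      "(\<lambda>x. \<Lambda> * f x) \<preceq> (\<lambda>x. \<Lambda> * (c * ((1 / \<Lambda>) * k x)))"
      using preceq_f f_preceq hlt pos by (auto intro!: asymp_le_cmult simp del: times_divide_eq_left)
    then have le: "(\<lambda>x. c * k x) \<preceq> (\<lambda>x. \<Lambda> * f x)" "(\<lambda>x. \<Lambda> * f x) \<preceq> (\<lambda>x. c * k x)"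
      by (simp_all only: *)
    have refl: "\<forall>\<^sub>F x in at_top. c * k x = c * k x" by simp
    show "(\<lambda>x. c * k x) \<preceq> local_mass c \<nu>" by (rule asymp_le_cong[OF refl ev le(1)])
    show "local_mass c \<nu> \<preceq> (\<lambda>x. c * k x)" by (rule asymp_le_cong[OF ev refl le(2)])
  qed
  have \<nu>_pos: "\<forall>\<^sub>F x in at_top. 0 < local_mass c \<nu> x" if lt: "k \<in> long_tailed_fun"
  proof -
    have "\<forall>\<^sub>F x in at_top. c * k x \<le> 2 * local_mass c \<nu> x"
      using \<nu>_mass(1)[OF lt] by (rule asymp_leD) simp
    with long_tailedD(3)[OF lt] show ?thesis
    proof eventually_elim
      case (elim x)
      have "0 < c * k x" using elim c by simp
      then show ?case using elim by linarith
    qed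
  qed

  have ii: "emeasure \<nu> {1<..} > 0 \<and> F \<in> S_Delta c \<longleftrightarrow> ?K"
    using pos_iff pos_of_lt F_S by blast
  have i: "\<mu> \<in> S_Delta c \<inter> D_Delta c \<longleftrightarrow> ?K"
  proof
    assume "\<mu> \<in> S_Delta c \<inter> D_Delta c"
    then have S: "(P \<star> M) \<in> S_Delta c" and lt: "J.m \<in> long_tailed_fun" and ad: "almost_decreasing J.m"
      by (auto simp: S_Delta_def L_Delta_def D_Delta_def PM(3))
    have sm: "small_middle J.m" by (rule small_middle_if_S_Delta[OF c S ad])
    note le = J.law_regular_imp_density_asymp[OF lt ad sm]
    have "(\<lambda>x. c * k x) \<in> long_tailed_fun"
      by (rule long_tailed_transfer[OF lt _ _ le(2,1)]) (use c k0 in auto)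
    then have "k \<in> long_tailed_fun" using c by (simp add: long_tailed_cmult_iff)
    moreover have "small_middle k" by (rule J.density_asymp_imp_small_middle[OF calculation le])
    ultimately show ?K by simp
  next
    assume ?K
    then show "\<mu> \<in> S_Delta c \<inter> D_Delta c"
      unfolding PM(3) by (intro J.density_regular_imp_S_Delta) auto
  qed
  have iii: "emeasure \<nu> {1<..} > 0 \<and> F \<in> L_Delta c \<and> local_mass c \<mu> \<sim>[at_top] local_mass c \<nu> \<longleftrightarrow> ?K"
  proof
    assume a: "emeasure \<nu> {1<..} > 0 \<and> F \<in> L_Delta c \<and> local_mass c \<mu> \<sim>[at_top] local_mass c \<nu>"
    then have lt: "k \<in> long_tailed_fun" using F_L pos_iff by simp
    have "J.m \<preceq> local_mass c \<nu>" "local_mass c \<nu> \<preceq> J.m"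
      using a asymp_equiv_iff_asymp_le[OF \<nu>_pos[OF lt], of J.m] by (auto simp: \<mu>_mass)
    then have "(\<lambda>x. c * k x) \<preceq> J.m" "J.m \<preceq> (\<lambda>x. c * k x)"
      using \<nu>_mass[OF lt] asymp_le_trans by blast+
    with lt show ?K using J.density_asymp_imp_small_middle by blast
  next
    assume K: ?K
    then have lt: "k \<in> long_tailed_fun" by simp
    have "J.m \<preceq> local_mass c \<nu>" "local_mass c \<nu> \<preceq> J.m"
      using J.density_regular_imp_law_asymp K \<nu>_mass[OF lt] asymp_le_trans by blast+
    then have "local_mass c \<mu> \<sim>[at_top] local_mass c \<nu>"
      by (simp add: asymp_equiv_iff_asymp_le[OF \<nu>_pos[OF lt]] \<mu>_mass)
    then show "emeasure \<nu> {1<..} > 0 \<and> F \<in> L_Delta c \<and> local_mass c \<mu> \<sim>[at_top] local_mass c \<nu>"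
      using F_L pos_of_lt[OF lt] pos_iff lt by simp
  qed
  show ?thesis using i ii iii unfolding F_def by blast
qed

end
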